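(* Let $x_1=w_1\varepsilon^{\mu_1}$ and $x_2=w_2\varepsilon^{\mu_2}$ be elements of $\widetilde W$. Then $x_1\le x_2$ in the Bruhat order if and only if for every $v_1\in W$ there exists $v_2\in W$ such that $$v_1^{-1}\mu_1+\mathrm{wt}(v_2\Rightarrow v_1)+\mathrm{wt}(w_1v_1\Rightarrow w_2v_2)\le v_2^{-1}\mu_2 .$$
   Context: Let $\Phi$ be a reduced crystallographic finite root system with fixed basis $\Delta$, positive roots $\Phi^+$, negative roots $\Phi^-=-\Phi^+$, Weyl group $W$ and $2\rho=\sum_{\beta\in\Phi^+}\beta$. For $\alpha\in\Phi$, $\alpha^\vee$ is its coroot and $s_\alpha$ its reflection; $\ell$ on $W$ is the Coxeter length with respect to $\{s_\alpha:\alpha\in\Delta\}$. Let $X_*$ be an abelian group containing the coroot lattice $\mathbb Z\Phi^\vee$, with a bilinear pairing $\langle\cdot,\cdot\rangle:X_*\times\mathbb Z\Phi\to\mathbb Z$ extending the natural coroot–root pairing; $W$ acts on $X_*$ by $s_\alpha(\mu)=\mu-\langle\mu,\alpha\rangle\alpha^\vee$. For $\mu,\mu'\in X_*$ write $\mu\le\mu'$ if $\mu'-\mu$ is a $\mathbb Z_{\ge0}$-linear combination of positive coroots. Write $\Phi^+(\alpha)=1$ if $\alpha\in\Phi^+$ and $\Phi^+(\alpha)=0$ if $\alpha\in\Phi^-$. The extended affine Weyl group is $\widetilde W=W\ltimes X_*$; its elements are written $w\varepsilon^\mu$ ($w\in W,\mu\in X_*$) with $\varepsilon^\mu w=w\varepsilon^{w^{-1}\mu}$.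 Affine roots are $\Phi_{\mathrm{af}}=\Phi\times\mathbb Z$, with $\widetilde W$-action $(w\varepsilon^\mu)(\alpha,k)=(w\alpha,k-\langle\mu,\alpha\rangle)$; positive affine roots are $\Phi_{\mathrm{af}}^+=\{(\alpha,k):k\ge\Phi^+(-\alpha)\}$ and $\Phi_{\mathrm{af}}^-=\Phi_{\mathrm{af}}\setminus\Phi_{\mathrm{af}}^+$. The length is $\ell(x)=\#\{a\in\Phi^+_{\mathrm{af}}:xa\in\Phi^-_{\mathrm{af}}\}$. For $a=(\alpha,k)$ the affine reflection is $r_a=s_\alpha\varepsilon^{k\alpha^\vee}$. The Bruhat order on $\widetilde W$ is the partial order generated by $x<xr_a$ for $x\in\widetilde W$, $a\in\Phi_{\mathrm{af}}$ with $\ell(x)<\ell(xr_a)$. The quantum Bruhat graph $\mathrm{QB}(W)$ is the directed graph with vertex set $W$ and an edge $w\to ws_\alpha$ ($\alpha\in\Phi^+$) whenever either $\ell(ws_\alpha)=\ell(w)+1$ (Bruhat edge, weight $0$) or $\ell(ws_\alpha)=\ell(w)+1-\langle\alpha^\vee,2\rho\rangle$ (quantum edge, weight $\alpha^\vee$). The weight of a path is the sum of its edge weights. It is known that $\mathrm{QB}(W)$ is strongly connected and that all shortest paths from $w$ to $w'$ have the same weight, denoted $\mathrm{wt}(w\Rightarrow w')\in\mathbb Z\Phi^\vee$; $d(w\Rightarrow w')$ denotes the length of a shortest path. *)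

theory Defs
  imports "HOL-Analysis.Analysis"
begin

definition refl :: "'v::euclidean_space \<Rightarrow> 'v \<Rightarrow> 'v" where
  "refl \<alpha> v = v - (2 * (v \<bullet> \<alpha>) / (\<alpha> \<bullet> \<alpha>)) *\<^sub>R \<alpha>"

definition coroot :: "'v::euclidean_space \<Rightarrow> 'v" where
  "coroot \<alpha> = (2 / (\<alpha> \<bullet> \<alpha>)) *\<^sub>R \<alpha>"

text \<open>Reduced crystallographic finite root system (in its span).\<close>
definition root_system :: "'v::euclidean_space set \<Rightarrow> bool" where
  "root_system \<Phi> \<longleftrightarrow> finite \<Phi> \<and> 0 \<notin> \<Phi>
     \<and> (\<forall>\<alpha>\<in>\<Phi>. \<forall>\<beta>\<in>\<Phi>. refl \<alpha> \<beta> \<in> \<Phi>)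
     \<and> (\<forall>\<alpha>\<in>\<Phi>. \<forall>\<beta>\<in>\<Phi>. coroot \<alpha> \<bullet> \<beta> \<in> \<int>)
     \<and> (\<forall>\<alpha>\<in>\<Phi>. \<forall>c::real. c *\<^sub>R \<alpha> \<in> \<Phi> \<longrightarrow> c = 1 \<or> c = -1)"

definition nonneg_int_comb :: "'v::euclidean_space set \<Rightarrow> 'v \<Rightarrow> bool" where
  "nonneg_int_comb S v \<longleftrightarrow> (\<exists>c::'v \<Rightarrow> nat. v = (\<Sum>\<delta>\<in>S. real (c \<delta>) *\<^sub>R \<delta>))"

definition is_base :: "'v::euclidean_space set \<Rightarrow> 'v set \<Rightarrow> bool" where
  "is_base \<Phi> \<Delta> \<longleftrightarrow> \<Delta> \<subseteq> \<Phi> \<and> independent \<Delta>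
     \<and> (\<forall>\<beta>\<in>\<Phi>. nonneg_int_comb \<Delta> \<beta> \<or> nonneg_int_comb \<Delta> (- \<beta>))"

definition pos_roots :: "'v::euclidean_space set \<Rightarrow> 'v set \<Rightarrow> 'v set" where
  "pos_roots \<Phi> \<Delta> = {\<beta>\<in>\<Phi>. nonneg_int_comb \<Delta> \<beta>}"

definition two_rho :: "'v::euclidean_space set \<Rightarrow> 'v set \<Rightarrow> 'v" where
  "two_rho \<Phi> \<Delta> = (\<Sum>\<beta>\<in>pos_roots \<Phi> \<Delta>. \<beta>)"

definition root_lattice :: "'v::euclidean_space set \<Rightarrow> 'v set" where
  "root_lattice \<Phi> = {(\<Sum>\<beta>\<in>\<Phi>. real_of_int (c \<beta>) *\<^sub>R \<beta>) | c :: 'v \<Rightarrow> int. True}"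

definition coroot_lattice :: "'v::euclidean_space set \<Rightarrow> 'v set" where
  "coroot_lattice \<Phi> = {(\<Sum>\<beta>\<in>\<Phi>. real_of_int (c \<beta>) *\<^sub>R coroot \<beta>) | c :: 'v \<Rightarrow> int. True}"

text \<open>\<open>X\<^sub>*\<close> is an abelian group (a type \<open>'x\<close>) containing the coroot lattice via an
  injective additive map \<open>\<iota>\<close>, with a bilinear pairing \<open>pr : X\<^sub>* \<times> \<int>\<Phi> \<rightarrow> \<int>\<close> extending the
  natural coroot--root pairing.\<close>
definition cochar_datum ::
  "'v::euclidean_space set \<Rightarrow> ('x::ab_group_add \<Rightarrow> 'v \<Rightarrow> int) \<Rightarrow> ('v \<Rightarrow> 'x) \<Rightarrow> bool" where
  "cochar_datum \<Phi> pr \<iota> \<longleftrightarrow>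
     inj_on \<iota> (coroot_lattice \<Phi>)
   \<and> (\<forall>a\<in>coroot_lattice \<Phi>. \<forall>b\<in>coroot_lattice \<Phi>. \<iota> (a + b) = \<iota> a + \<iota> b)
   \<and> (\<forall>\<mu> \<nu> \<beta>. \<beta> \<in> root_lattice \<Phi> \<longrightarrow> pr (\<mu> + \<nu>) \<beta> = pr \<mu> \<beta> + pr \<nu> \<beta>)
   \<and> (\<forall>\<mu> \<beta> \<gamma>. \<beta> \<in> root_lattice \<Phi> \<longrightarrow> \<gamma> \<in> root_lattice \<Phi> \<longrightarrow>
        pr \<mu> (\<beta> + \<gamma>) = pr \<mu> \<beta> + pr \<mu> \<gamma>)
   \<and> (\<forall>c\<in>coroot_lattice \<Phi>. \<forall>\<beta>\<in>root_lattice \<Phi>. real_of_int (pr (\<iota> c) \<beta>) = c \<bullet> \<beta>)"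

definition word_map :: "'v::euclidean_space list \<Rightarrow> 'v \<Rightarrow> 'v" where
  "word_map ws = foldr (\<lambda>\<alpha> f. refl \<alpha> \<circ> f) ws id"

definition weyl :: "'v::euclidean_space set \<Rightarrow> ('v \<Rightarrow> 'v) set" where
  "weyl \<Phi> = {word_map ws | ws. set ws \<subseteq> \<Phi>}"

definition wlen :: "'v::euclidean_space set \<Rightarrow> ('v \<Rightarrow> 'v) \<Rightarrow> nat" where
  "wlen \<Delta> w = (LEAST n. \<exists>ws. length ws = n \<and> set ws \<subseteq> \<Delta> \<and> word_map ws = w)"

definition reflX :: "('x::ab_group_add \<Rightarrow> 'v::euclidean_space \<Rightarrow> int) \<Rightarrow> ('v \<Rightarrow> 'x) \<Rightarrow> 'v \<Rightarrow> 'x \<Rightarrow> 'x" where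
  "reflX pr \<iota> \<alpha> \<mu> = \<mu> - \<iota> (real_of_int (pr \<mu> \<alpha>) *\<^sub>R coroot \<alpha>)"

definition word_actX :: "('x::ab_group_add \<Rightarrow> 'v::euclidean_space \<Rightarrow> int) \<Rightarrow> ('v \<Rightarrow> 'x) \<Rightarrow> 'v list \<Rightarrow> 'x \<Rightarrow> 'x" where
  "word_actX pr \<iota> ws = foldr (\<lambda>\<alpha> f. reflX pr \<iota> \<alpha> \<circ> f) ws id"

text \<open>Action of \<open>w \<in> W\<close> on \<open>X\<^sub>*\<close> (through any word in reflections representing \<open>w\<close>).\<close>
definition actX :: "'v::euclidean_space set \<Rightarrow> ('x::ab_group_add \<Rightarrow> 'v \<Rightarrow> int) \<Rightarrow> ('v \<Rightarrow> 'x)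
    \<Rightarrow> ('v \<Rightarrow> 'v) \<Rightarrow> 'x \<Rightarrow> 'x" where
  "actX \<Phi> pr \<iota> w = word_actX pr \<iota> (SOME ws. set ws \<subseteq> \<Phi> \<and> word_map ws = w)"

text \<open>A pair \<open>(w, \<mu>)\<close> stands for \<open>w \<epsilon>\<^sup>\<mu>\<close>.\<close>
definition ext_affine_weyl :: "'v::euclidean_space set \<Rightarrow> (('v \<Rightarrow> 'v) \<times> 'x) set" where
  "ext_affine_weyl \<Phi> = weyl \<Phi> \<times> UNIV"

definition aff_mult :: "'v::euclidean_space set \<Rightarrow> ('x::ab_group_add \<Rightarrow> 'v \<Rightarrow> int) \<Rightarrow> ('v \<Rightarrow> 'x)
    \<Rightarrow> ('v \<Rightarrow> 'v) \<times> 'x \<Rightarrow> ('v \<Rightarrow> 'v) \<times> 'x \<Rightarrow> ('v \<Rightarrow> 'v) \<times> 'x" where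
  "aff_mult \<Phi> pr \<iota> x y = (fst x \<circ> fst y, actX \<Phi> pr \<iota> (inv (fst y)) (snd x) + snd y)"

text \<open>Affine roots \<open>(\<alpha>, k) \<in> \<Phi> \<times> \<int>\<close>; action \<open>(w\<epsilon>\<^sup>\<mu>)(\<alpha>,k) = (w\<alpha>, k - \<langle>\<mu>,\<alpha>\<rangle>)\<close>.\<close>
definition aff_act :: "('x::ab_group_add \<Rightarrow> 'v::euclidean_space \<Rightarrow> int)
    \<Rightarrow> ('v \<Rightarrow> 'v) \<times> 'x \<Rightarrow> 'v \<times> int \<Rightarrow> 'v \<times> int" where
  "aff_act pr x a = (fst x (fst a), snd a - pr (snd x) (fst a))"

definition aff_pos :: "'v::euclidean_space set \<Rightarrow> 'v set \<Rightarrow> 'v \<times> int \<Rightarrow> bool" where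
  "aff_pos \<Phi> \<Delta> a \<longleftrightarrow> fst a \<in> \<Phi> \<and>
     snd a \<ge> (if - fst a \<in> pos_roots \<Phi> \<Delta> then 1 else 0)"

definition aff_len :: "'v::euclidean_space set \<Rightarrow> 'v set \<Rightarrow> ('x::ab_group_add \<Rightarrow> 'v \<Rightarrow> int)
    \<Rightarrow> ('v \<Rightarrow> 'v) \<times> 'x \<Rightarrow> nat" where
  "aff_len \<Phi> \<Delta> pr x = card {a. aff_pos \<Phi> \<Delta> a \<and> \<not> aff_pos \<Phi> \<Delta> (aff_act pr x a)}"

definition aff_refl :: "('v::euclidean_space \<Rightarrow> 'x) \<Rightarrow> 'v \<times> int \<Rightarrow> ('v \<Rightarrow> 'v) \<times> 'x" where
  "aff_refl \<iota> a = (refl (fst a), \<iota> (real_of_int (snd a) *\<^sub>R coroot (fst a)))"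

definition bruhat_step :: "'v::euclidean_space set \<Rightarrow> 'v set \<Rightarrow> ('x::ab_group_add \<Rightarrow> 'v \<Rightarrow> int)
    \<Rightarrow> ('v \<Rightarrow> 'x) \<Rightarrow> ('v \<Rightarrow> 'v) \<times> 'x \<Rightarrow> ('v \<Rightarrow> 'v) \<times> 'x \<Rightarrow> bool" where
  "bruhat_step \<Phi> \<Delta> pr \<iota> x y \<longleftrightarrow> x \<in> ext_affine_weyl \<Phi> \<and>
     (\<exists>\<alpha> k. \<alpha> \<in> \<Phi> \<and> y = aff_mult \<Phi> pr \<iota> x (aff_refl \<iota> (\<alpha>, k))
            \<and> aff_len \<Phi> \<Delta> pr x < aff_len \<Phi> \<Delta> pr y)"

definition bruhat_le :: "'v::euclidean_space set \<Rightarrow> 'v set \<Rightarrow> ('x::ab_group_add \<Rightarrow> 'v \<Rightarrow> int)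
    \<Rightarrow> ('v \<Rightarrow> 'x) \<Rightarrow> ('v \<Rightarrow> 'v) \<times> 'x \<Rightarrow> ('v \<Rightarrow> 'v) \<times> 'x \<Rightarrow> bool" where
  "bruhat_le \<Phi> \<Delta> pr \<iota> = (bruhat_step \<Phi> \<Delta> pr \<iota>)\<^sup>*\<^sup>*"

definition qb_edge :: "'v::euclidean_space set \<Rightarrow> 'v set \<Rightarrow> ('v \<Rightarrow> 'v) \<Rightarrow> ('v \<Rightarrow> 'v) \<Rightarrow> 'v \<Rightarrow> bool" where
  "qb_edge \<Phi> \<Delta> w w' c \<longleftrightarrow> w \<in> weyl \<Phi> \<and>
     (\<exists>\<alpha>\<in>pos_roots \<Phi> \<Delta>. w' = w \<circ> refl \<alpha> \<and>
        ((wlen \<Delta> w' = wlen \<Delta> w + 1 \<and> c = 0) \<or>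
         (real (wlen \<Delta> w') = real (wlen \<Delta> w) + 1 - coroot \<alpha> \<bullet> two_rho \<Phi> \<Delta> \<and> c = coroot \<alpha>)))"

inductive qb_path :: "'v::euclidean_space set \<Rightarrow> 'v set \<Rightarrow> ('v \<Rightarrow> 'v) \<Rightarrow> (('v \<Rightarrow> 'v) \<times> 'v) list
    \<Rightarrow> ('v \<Rightarrow> 'v) \<Rightarrow> bool" for \<Phi> \<Delta> where
  qb_nil: "qb_path \<Phi> \<Delta> w [] w"
| qb_cons: "qb_edge \<Phi> \<Delta> w u c \<Longrightarrow> qb_path \<Phi> \<Delta> u ps w' \<Longrightarrow> qb_path \<Phi> \<Delta> w ((u, c) # ps) w'"

definition qb_dist :: "'v::euclidean_space set \<Rightarrow> 'v set \<Rightarrow> ('v \<Rightarrow> 'v) \<Rightarrow> ('v \<Rightarrow> 'v) \<Rightarrow> nat" where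
  "qb_dist \<Phi> \<Delta> w w' = (LEAST n. \<exists>ps. qb_path \<Phi> \<Delta> w ps w' \<and> length ps = n)"

text \<open>\<open>wt(w \<Rightarrow> w')\<close>: the weight of a shortest path (all shortest paths have the same weight).\<close>
definition qb_wt :: "'v::euclidean_space set \<Rightarrow> 'v set \<Rightarrow> ('v \<Rightarrow> 'v) \<Rightarrow> ('v \<Rightarrow> 'v) \<Rightarrow> 'v" where
  "qb_wt \<Phi> \<Delta> w w' = sum_list (map snd
     (SOME ps. qb_path \<Phi> \<Delta> w ps w' \<and> length ps = qb_dist \<Phi> \<Delta> w w'))"

definition coweight_le :: "'v::euclidean_space set \<Rightarrow> 'v set \<Rightarrow> ('v \<Rightarrow> 'x::ab_group_add)
    \<Rightarrow> 'x \<Rightarrow> 'x \<Rightarrow> bool" where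
  "coweight_le \<Phi> \<Delta> \<iota> \<mu> \<mu>' \<longleftrightarrow>
     (\<exists>c::'v \<Rightarrow> nat. \<mu>' - \<mu> = \<iota> (\<Sum>\<alpha>\<in>pos_roots \<Phi> \<Delta>. real (c \<alpha>) *\<^sub>R coroot \<alpha>))"

end

theory Submission
  imports Defs
begin

text \<open>Far in the dominant direction the sign of an affine root \<open>b\<close> is that of its
  finite part, and there the Bruhat condition becomes the semi-infinite one. Length becomes
  \<open>slen\<close>, which is additive in the translation, so the number of edges of a path is
  determined by its endpoints and weight.

  The main work is the existence of a least weight. Lifting yields it by induction on the
  \<open>slen\<close> gap once a simple affine reflection raises the start and lowers the end. There
  may be no such reflection at first. Hence a translation by \<open>-w(2 rho check)\<close>, with
  \<open>w\<close> the finite part of the end, is factored into simple reflections: each lowers the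
  end, and one must raise the start unless the finite parts agree. The least weight is attained by a
  chain of covers, that is, a path; strict positivity of \<open>2 rho\<close> on positive coroots
  identifies it with the weight of a shortest path.

  The extended group is handled through inversions of affine roots, not as a Coxeter group:
  \<open>X\<^sub>*\<close> is arbitrary, so the pairing may be degenerate and nontrivial elements of
  length zero may occur.\<close>

text \<open>
  Write \<open>x \<preceq> y\<close> for the semi-infinite order on the extended affine Weyl group, generated by
  \<open>x \<preceq> x r\<^sub>b\<close> for affine roots \<open>b\<close> with positive finite part and \<open>x b\<close> positive; in coordinates the
  steps are \<open>(w, \<mu>) \<rightarrow> (w s\<^sub>\<alpha>, \<mu> + m \<alpha>\<^sup>\<or>)\<close> with \<open>\<alpha> \<in> \<Phi>\<^sup>+\<close> and \<open>m \<ge> \<Phi>\<^sup>+(- w \<alpha>)\<close>, and the steps raising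
  the semi-infinite length \<open>\<ell>(w) + \<langle>\<mu>, 2\<rho>\<rangle>\<close> by one are the edges of the quantum Bruhat graph.
  Lifting along left simple affine reflections shows that \<open>(w, 0) \<preceq> (w', \<nu>)\<close> holds exactly for
  \<open>\<nu> \<ge> wt(w \<Rightarrow> w')\<close>. The inequality of the theorem therefore says: for every \<open>g\<close> there is \<open>h\<close> with
  \<open>h \<preceq> g\<close> and \<open>x\<^sub>1 g \<preceq> x\<^sub>2 h\<close>.

  If \<open>x\<^sub>2 = x\<^sub>1 r\<^sub>a\<close> is a single Bruhat step, \<open>h = g\<close> or \<open>h = r\<^sub>a g\<close> works. Conversely, take \<open>g\<close> in
  \<open>W\<close> length positive for \<open>x\<^sub>1\<close>. After translating far into the dominant chamber the two
  relations become Bruhat relations \<open>y' \<le> y\<close> and \<open>x\<^sub>1 y \<le> x\<^sub>2 y'\<close> with \<open>\<ell>(x\<^sub>1 y) = \<ell>(x\<^sub>1) + \<ell>(y)\<close>,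
  and the lifting property lets one strip a reduced word of \<open>y\<close> from the right until \<open>x\<^sub>1 \<le> x\<^sub>2\<close> remains.
\<close>

section \<open>Reflections and the Weyl group\<close>

lemma refl_eq_root: "refl \<alpha> v = v - (coroot \<alpha> \<bullet> v) *\<^sub>R \<alpha>"
  by (simp add: refl_def coroot_def inner_commute)

lemma refl_eq_coroot: "refl \<alpha> v = v - (\<alpha> \<bullet> v) *\<^sub>R coroot \<alpha>"
  by (simp add: refl_def coroot_def inner_commute)

lemma linear_refl: "linear (refl \<alpha>)"
  by (rule linearI) (simp_all add: refl_eq_root inner_add_right algebra_simps)

lemma coroot_uminus [simp]: "coroot (- \<alpha>) = - coroot \<alpha>"
  by (simp add: coroot_def)

lemma refl_uminus_root [simp]: "refl (- \<alpha>) = refl \<alpha>"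
  by (rule ext) (simp add: refl_eq_root)

lemma refl_uminus: "refl \<alpha> (- v) = - refl \<alpha> v"
  by (simp add: refl_eq_root)

lemma coroot_inner_self: "\<alpha> \<noteq> 0 \<Longrightarrow> coroot \<alpha> \<bullet> \<alpha> = 2"
  by (simp add: coroot_def)

lemma refl_self [simp]: "refl \<alpha> \<alpha> = - \<alpha>"
  by (cases "\<alpha> = 0") (simp_all add: refl_eq_root coroot_inner_self scaleR_2)

lemma refl_refl [simp]: "refl \<alpha> (refl \<alpha> v) = v"
proof (cases "\<alpha> = 0")
  case False
  then show ?thesis
    by (simp add: refl_eq_root inner_diff_right coroot_inner_self algebra_simps scaleR_2)
qed (simp add: refl_def)

lemma refl_comp_refl [simp]: "refl \<alpha> \<circ> refl \<alpha> = id"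
  by (rule ext) simp

lemma inv_refl [simp]: "inv (refl \<alpha>) = refl \<alpha>"
  by (rule inv_unique_comp) simp_all

lemma refl_inner_refl [simp]: "refl \<alpha> u \<bullet> refl \<alpha> v = u \<bullet> v"
proof (cases "\<alpha> = 0")
  case False
  then show ?thesis
    by (simp add: refl_def inner_diff_left inner_diff_right inner_commute[of \<alpha> v])
qed (simp add: refl_def)

lemma coroot_orthogonal:
  assumes "linear w" "\<And>u v. w u \<bullet> w v = u \<bullet> v"
  shows "coroot (w \<alpha>) = w (coroot \<alpha>)"
  by (simp add: coroot_def assms linear_scale)

lemma refl_orthogonal:
  assumes "linear w" "\<And>u v. w u \<bullet> w v = u \<bullet> v"
  shows "refl (w \<alpha>) (w v) = w (refl \<alpha> v)"
  by (simp add: refl_def assms linear_scale linear_diff)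

section \<open>Words in reflections and the elements they represent\<close>

lemma word_map_Nil [simp]: "word_map [] = id"
  by (simp add: word_map_def)

lemma word_map_Cons [simp]: "word_map (\<alpha> # ws) = refl \<alpha> \<circ> word_map ws"
  by (simp add: word_map_def)

lemma word_map_append [simp]: "word_map (us @ ws) = word_map us \<circ> word_map ws"
  by (induction us) (simp_all add: comp_assoc)

lemma word_map_rev: "word_map (rev ws) \<circ> word_map ws = id"
proof (induction ws)
  case (Cons a ws)
  have "word_map (rev (a # ws)) \<circ> word_map (a # ws)
      = word_map (rev ws) \<circ> (refl a \<circ> refl a) \<circ> word_map ws"
    by (simp add: comp_assoc del: refl_comp_refl)
  with Cons show ?case by simp
qed simp

lemma word_map_rev': "word_map ws \<circ> word_map (rev ws) = id"
  using word_map_rev[of "rev ws"] by simp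

lemma inv_word_map: "inv (word_map ws) = word_map (rev ws)"
  by (rule inv_unique_comp) (rule word_map_rev' word_map_rev)+

lemma bij_word_map: "bij (word_map ws)"
  using word_map_rev word_map_rev' by (rule o_bij)

lemma linear_word_map: "linear (word_map ws)"
proof (induction ws)
  case Nil
  show ?case using linear_id by (simp add: id_def)
next
  case (Cons a ws)
  then show ?case using linear_compose[OF Cons linear_refl] by (simp add: o_def)
qed

lemma word_map_inner [simp]: "word_map ws u \<bullet> word_map ws v = u \<bullet> v"
  by (induction ws arbitrary: u v) simp_all

lemma weylI: "set ws \<subseteq> \<Phi> \<Longrightarrow> word_map ws \<in> weyl \<Phi>"
  by (auto simp: weyl_def)

lemma weylE:
  assumes "w \<in> weyl \<Phi>"
  obtains ws where "set ws \<subseteq> \<Phi>" "w = word_map ws"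
  using assms by (auto simp: weyl_def)

lemma id_in_weyl [simp]: "id \<in> weyl \<Phi>"
  using weylI[of "[]"] by simp

lemma refl_in_weyl: "\<alpha> \<in> \<Phi> \<Longrightarrow> refl \<alpha> \<in> weyl \<Phi>"
  using weylI[of "[\<alpha>]"] by simp

lemma weyl_comp: "u \<in> weyl \<Phi> \<Longrightarrow> w \<in> weyl \<Phi> \<Longrightarrow> u \<circ> w \<in> weyl \<Phi>"
  by (elim weylE) (metis weylI word_map_append set_append Un_subset_iff)

lemma weyl_inv: "w \<in> weyl \<Phi> \<Longrightarrow> inv w \<in> weyl \<Phi>"
  by (elim weylE) (metis weylI inv_word_map set_rev)

lemma weyl_bij: "w \<in> weyl \<Phi> \<Longrightarrow> bij w"
  by (elim weylE) (simp add: bij_word_map)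

lemma weyl_linear: "w \<in> weyl \<Phi> \<Longrightarrow> linear w"
  by (elim weylE) (simp add: linear_word_map)

lemma weyl_inner: "w \<in> weyl \<Phi> \<Longrightarrow> w u \<bullet> w v = u \<bullet> v"
  by (elim weylE) simp

lemma weyl_inv_left [simp]: "w \<in> weyl \<Phi> \<Longrightarrow> inv w (w v) = v"
  by (simp add: bij_is_inj weyl_bij)

lemma weyl_inv_right [simp]: "w \<in> weyl \<Phi> \<Longrightarrow> w (inv w v) = v"
  by (simp add: bij_is_surj surj_f_inv_f weyl_bij)

lemma weyl_inv_comp: "w \<in> weyl \<Phi> \<Longrightarrow> inv w \<circ> w = id" "w \<in> weyl \<Phi> \<Longrightarrow> w \<circ> inv w = id"
  by auto

lemma weyl_uminus: "w \<in> weyl \<Phi> \<Longrightarrow> w (- v) = - w v"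
  by (simp add: linear_neg weyl_linear)

lemma weyl_coroot: "w \<in> weyl \<Phi> \<Longrightarrow> coroot (w \<alpha>) = w (coroot \<alpha>)"
  by (intro coroot_orthogonal weyl_linear weyl_inner)

lemma weyl_refl: "w \<in> weyl \<Phi> \<Longrightarrow> refl (w \<alpha>) \<circ> w = w \<circ> refl \<alpha>"
  by (rule ext) (simp add: refl_orthogonal weyl_linear weyl_inner)

section \<open>Root systems with a base\<close>

locale based_root_system =
  fixes \<Phi> \<Delta> :: "'v::euclidean_space set"
  assumes root_system: "root_system \<Phi>" and base: "is_base \<Phi> \<Delta>"
begin

abbreviation P :: "'v set" where "P \<equiv> pos_roots \<Phi> \<Delta>"
abbreviation W :: "('v \<Rightarrow> 'v) set" where "W \<equiv> weyl \<Phi>"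

lemma finite_roots: "finite \<Phi>"
  and zero_not_root: "0 \<notin> \<Phi>"
  and refl_root: "\<alpha> \<in> \<Phi> \<Longrightarrow> \<beta> \<in> \<Phi> \<Longrightarrow> refl \<alpha> \<beta> \<in> \<Phi>"
  and coroot_inner_Ints: "\<alpha> \<in> \<Phi> \<Longrightarrow> \<beta> \<in> \<Phi> \<Longrightarrow> coroot \<alpha> \<bullet> \<beta> \<in> \<int>"
  and reduced: "\<alpha> \<in> \<Phi> \<Longrightarrow> c *\<^sub>R \<alpha> \<in> \<Phi> \<Longrightarrow> c = 1 \<or> c = -1"
  using root_system unfolding root_system_def by blast+

lemma base_subset: "\<Delta> \<subseteq> \<Phi>"
  and base_independent: "independent \<Delta>"
  using base unfolding is_base_def by blast+

lemma finite_base: "finite \<Delta>"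
  using base_subset finite_roots finite_subset by blast

lemma root_nonzero: "\<alpha> \<in> \<Phi> \<Longrightarrow> \<alpha> \<noteq> 0"
  using zero_not_root by blast

lemma uminus_root: "\<alpha> \<in> \<Phi> \<Longrightarrow> - \<alpha> \<in> \<Phi>"
  using refl_root[of \<alpha> \<alpha>] by simp

lemma uminus_root_iff [simp]: "- \<alpha> \<in> \<Phi> \<longleftrightarrow> \<alpha> \<in> \<Phi>"
  using uminus_root[of \<alpha>] uminus_root[of "- \<alpha>"] by auto

lemma weyl_root: "w \<in> W \<Longrightarrow> \<alpha> \<in> \<Phi> \<Longrightarrow> w \<alpha> \<in> \<Phi>"
proof (elim weylE)
  fix ws assume "set ws \<subseteq> \<Phi>" "\<alpha> \<in> \<Phi>" "w = word_map ws"
  then show "w \<alpha> \<in> \<Phi>"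
    by (induction ws arbitrary: w) (simp_all add: refl_root)
qed

lemma weyl_root_iff [simp]: "w \<in> W \<Longrightarrow> w \<alpha> \<in> \<Phi> \<longleftrightarrow> \<alpha> \<in> \<Phi>"
  using weyl_root weyl_inv weyl_inv_left by metis

lemma pos_root: "\<alpha> \<in> P \<Longrightarrow> \<alpha> \<in> \<Phi>"
  by (simp add: pos_roots_def)

lemma finite_pos: "finite P"
  using finite_roots by (simp add: pos_roots_def)

lemma pos_or_neg: "\<beta> \<in> \<Phi> \<Longrightarrow> \<beta> \<in> P \<or> - \<beta> \<in> P"
  using base by (auto simp: is_base_def pos_roots_def)

lemma base_coeffs_zero: "(\<Sum>\<delta>\<in>\<Delta>. u \<delta> *\<^sub>R \<delta>) = 0 \<Longrightarrow> \<delta> \<in> \<Delta> \<Longrightarrow> u \<delta> = 0"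
  using independentD[OF base_independent finite_base subset_refl] by blast

lemma base_pos: "\<Delta> \<subseteq> P"
proof
  fix \<delta> assume "\<delta> \<in> \<Delta>"
  then have "\<delta> = (\<Sum>\<gamma>\<in>\<Delta>. real (if \<gamma> = \<delta> then 1 else 0) *\<^sub>R \<gamma>)"
    by (simp add: finite_base if_distrib[of real] if_distrib[of "\<lambda>c. c *\<^sub>R _"] cong: if_cong)
  then show "\<delta> \<in> P"
    using \<open>\<delta> \<in> \<Delta>\<close> base_subset unfolding pos_roots_def nonneg_int_comb_def
    by (auto intro!: exI[of _ "\<lambda>\<gamma>. if \<gamma> = \<delta> then 1 else 0"])
qed

text \<open>Only the \<open>\<delta>\<close>-coefficient changes under the reflection, so a sign
  change leaves \<open>\<beta>\<close> a multiple of \<open>\<delta>\<close>, and reducedness makes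
  it \<open>\<delta>\<close> itself.\<close>

lemma refl_base_pos:
  assumes "\<delta> \<in> \<Delta>" "\<beta> \<in> P" "\<beta> \<noteq> \<delta>"
  shows "refl \<delta> \<beta> \<in> P"
proof (rule ccontr)
  assume "refl \<delta> \<beta> \<notin> P"
  moreover have "refl \<delta> \<beta> \<in> \<Phi>"
    using assms base_subset by (blast intro: refl_root pos_root)
  ultimately have "- refl \<delta> \<beta> \<in> P" using pos_or_neg by blast
  then obtain d where d: "- refl \<delta> \<beta> = (\<Sum>\<gamma>\<in>\<Delta>. real (d \<gamma>) *\<^sub>R \<gamma>)"
    by (auto simp: pos_roots_def nonneg_int_comb_def)
  obtain c where c: "\<beta> = (\<Sum>\<gamma>\<in>\<Delta>. real (c \<gamma>) *\<^sub>R \<gamma>)"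
    using assms by (auto simp: pos_roots_def nonneg_int_comb_def)
  let ?r = "coroot \<delta> \<bullet> \<beta>"
  have "(\<Sum>\<gamma>\<in>\<Delta>. (real (d \<gamma>) + real (c \<gamma>) - (if \<gamma> = \<delta> then ?r else 0)) *\<^sub>R \<gamma>)
      = - refl \<delta> \<beta> + \<beta> - ?r *\<^sub>R \<delta>"
    using assms(1) c unfolding d
    by (simp add: algebra_simps sum.distrib sum_subtractf finite_base
        if_distrib[of "\<lambda>c. c *\<^sub>R _"] cong: if_cong)
  also have "\<dots> = 0" by (simp add: refl_eq_root)
  finally have 0: "real (d \<gamma>) + real (c \<gamma>) - (if \<gamma> = \<delta> then ?r else 0) = 0" if "\<gamma> \<in> \<Delta>" for \<gamma>
    using base_coeffs_zero[of "\<lambda>\<gamma>. real (d \<gamma>) + real (c \<gamma>) - (if \<gamma> = \<delta> then ?r else 0)"] that by simp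
  have "c \<gamma> = 0" if "\<gamma> \<in> \<Delta>" "\<gamma> \<noteq> \<delta>" for \<gamma>
    using 0[OF that(1)] that(2) by simp
  then have "(\<Sum>\<gamma>\<in>\<Delta>. real (c \<gamma>) *\<^sub>R \<gamma>) = (\<Sum>\<gamma>\<in>\<Delta>. if \<gamma> = \<delta> then real (c \<delta>) *\<^sub>R \<delta> else 0)"
    by (intro sum.cong) auto
  then have b: "\<beta> = real (c \<delta>) *\<^sub>R \<delta>"
    using assms(1) c by (simp add: finite_base)
  then have "real (c \<delta>) = 1 \<or> real (c \<delta>) = -1"
    using reduced[of \<delta> "real (c \<delta>)"] assms base_subset pos_root by auto
  then have "real (c \<delta>) = 1" by linarith
  then show False using b assms by simp
qed

text \<open>The sum of the positive coroots serves both as a height function and as a regular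
  dominant translation.\<close>
definition two_rho_check :: 'v where
  "two_rho_check = (\<Sum>\<beta>\<in>P. coroot \<beta>)"

lemma base_neg_not_pos:
  assumes "\<delta> \<in> \<Delta>"
  shows "- \<delta> \<notin> P"
proof
  assume "- \<delta> \<in> P"
  then obtain c where c: "- \<delta> = (\<Sum>\<gamma>\<in>\<Delta>. real (c \<gamma>) *\<^sub>R \<gamma>)"
    by (auto simp: pos_roots_def nonneg_int_comb_def)
  have "(\<Sum>\<gamma>\<in>\<Delta>. (real (c \<gamma>) + (if \<gamma> = \<delta> then 1 else 0)) *\<^sub>R \<gamma>) = - \<delta> + \<delta>"
    using assms unfolding c
    by (simp add: algebra_simps sum.distrib finite_base
        if_distrib[of "\<lambda>c. c *\<^sub>R _"] cong: if_cong)
  then have "real (c \<delta>) + 1 = 0"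
    using base_coeffs_zero[of "\<lambda>\<gamma>. real (c \<gamma>) + (if \<gamma> = \<delta> then 1 else 0)" \<delta>] assms by simp
  then show False by linarith
qed

lemma refl_base_image: "\<delta> \<in> \<Delta> \<Longrightarrow> refl \<delta> ` (P - {\<delta>}) = P - {\<delta>}"
proof -
  assume d: "\<delta> \<in> \<Delta>"
  have sub: "refl \<delta> ` (P - {\<delta>}) \<subseteq> P - {\<delta>}"
  proof (rule image_subsetI)
    fix \<beta> assume "\<beta> \<in> P - {\<delta>}"
    then have "\<beta> \<in> P" "\<beta> \<noteq> \<delta>" by auto
    moreover have "\<beta> = - \<delta>" if "refl \<delta> \<beta> = \<delta>"
      using that by (metis refl_refl refl_self)
    ultimately show "refl \<delta> \<beta> \<in> P - {\<delta>}"
      using refl_base_pos base_neg_not_pos d by blast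
  qed
  moreover have "P - {\<delta>} \<subseteq> refl \<delta> ` (P - {\<delta>})"
    using sub by (metis (no_types, lifting) image_eqI image_subset_iff refl_refl subsetI)
  ultimately show ?thesis by blast
qed

lemma inj_refl: "inj_on (refl \<alpha>) A"
  by (metis inj_on_def refl_refl)

lemma sum_refl_base:
  "\<delta> \<in> \<Delta> \<Longrightarrow> (\<Sum>\<beta>\<in>P - {\<delta>}. f (refl \<delta> \<beta>)) = (\<Sum>\<beta>\<in>P - {\<delta>}. f \<beta>)"
  using sum.reindex[OF inj_refl, of f \<delta> "P - {\<delta>}"] by (simp add: refl_base_image)

text \<open>Reflection in \<open>\<delta>\<close> permutes the other positive coroots and negates
  \<open>coroot \<delta>\<close>; comparing with the reflection formula reads off the
  pairing.\<close>

lemma two_rho_check_base: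
  assumes d: "\<delta> \<in> \<Delta>"
  shows "two_rho_check \<bullet> \<delta> = 2"
proof -
  have d0: "\<delta> \<noteq> 0" "coroot \<delta> \<noteq> 0" using d base_subset root_nonzero by (auto simp: coroot_def)
  have eq: "two_rho_check = (\<Sum>\<beta>\<in>P - {\<delta>}. coroot \<beta>) + coroot \<delta>"
    unfolding two_rho_check_def using d base_pos finite_pos by (simp add: sum.remove add.commute subset_iff)
  have "refl \<delta> (\<Sum>\<beta>\<in>P - {\<delta>}. coroot \<beta>) = (\<Sum>\<beta>\<in>P - {\<delta>}. coroot (refl \<delta> \<beta>))"
    by (simp add: linear_sum linear_refl coroot_orthogonal o_def)
  also have "\<dots> = (\<Sum>\<beta>\<in>P - {\<delta>}. coroot \<beta>)"
    by (rule sum_refl_base[OF d])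
  finally have "refl \<delta> two_rho_check = two_rho_check - 2 *\<^sub>R coroot \<delta>"
    unfolding eq using coroot_orthogonal[OF linear_refl refl_inner_refl, of \<delta> \<delta>]
    by (simp add: linear_add[OF linear_refl] scaleR_2)
  then have "(\<delta> \<bullet> two_rho_check) *\<^sub>R coroot \<delta> = 2 *\<^sub>R coroot \<delta>"
    by (simp add: refl_eq_coroot)
  then show ?thesis using d0 by (simp add: inner_commute)
qed

lemma two_rho_check_pos:
  assumes "\<beta> \<in> P"
  shows "two_rho_check \<bullet> \<beta> > 0"
proof -
  obtain c where c: "\<beta> = (\<Sum>\<gamma>\<in>\<Delta>. real (c \<gamma>) *\<^sub>R \<gamma>)"
    using assms by (auto simp: pos_roots_def nonneg_int_comb_def)
  then have eq: "two_rho_check \<bullet> \<beta> = (\<Sum>\<gamma>\<in>\<Delta>. real (c \<gamma>) * 2)"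
    by (simp add: inner_sum_right two_rho_check_base)
  have "\<exists>\<gamma>\<in>\<Delta>. c \<gamma> > 0"
  proof (rule ccontr)
    assume "\<not> ?thesis"
    then have "\<beta> = 0" unfolding c by (intro sum.neutral) auto
    then show False using assms root_nonzero pos_root by blast
  qed
  then obtain \<gamma> where "\<gamma> \<in> \<Delta>" "c \<gamma> > 0" by blast
  then show ?thesis unfolding eq
    by (intro sum_pos2[OF finite_base]) auto
qed

lemma pos_iff: "\<beta> \<in> \<Phi> \<Longrightarrow> \<beta> \<in> P \<longleftrightarrow> two_rho_check \<bullet> \<beta> > 0"
  using pos_or_neg[of \<beta>] two_rho_check_pos[of \<beta>] two_rho_check_pos[of "- \<beta>"] by auto

lemma neg_iff: "\<beta> \<in> \<Phi> \<Longrightarrow> - \<beta> \<in> P \<longleftrightarrow> \<beta> \<notin> P"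
  using pos_or_neg[of \<beta>] two_rho_check_pos[of \<beta>] two_rho_check_pos[of "- \<beta>"] by auto

lemma two_rho_check_Ints: "\<beta> \<in> \<Phi> \<Longrightarrow> two_rho_check \<bullet> \<beta> \<in> \<int>"
  unfolding two_rho_check_def by (auto simp: inner_sum_left intro!: Ints_sum coroot_inner_Ints pos_root)

section \<open>Length in the finite Weyl group\<close>

definition finv :: "('v \<Rightarrow> 'v) \<Rightarrow> 'v set" where
  "finv w = {\<beta>\<in>P. w \<beta> \<notin> P}"

lemma finite_finv: "finite (finv w)"
  unfolding finv_def using finite_pos by simp

text \<open>\<open>refl \<delta>\<close> permutes \<open>P - {\<delta>}\<close>, so it carries
  inversions to inversions, and \<open>\<delta>\<close> is the one new inversion.\<close>

lemma finv_refl_base_up: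
  assumes w: "w \<in> W" and d: "\<delta> \<in> \<Delta>" and up: "w \<delta> \<in> P"
  shows "card (finv (w \<circ> refl \<delta>)) = card (finv w) + 1"
proof -
  have dP: "\<delta> \<in> P" using d base_pos by blast
  have neg: "w (- \<delta>) \<notin> P"
    using up by (metis neg_iff pos_root weyl_uminus w)
  have "finv (w \<circ> refl \<delta>) = insert \<delta> (refl \<delta> ` finv w)"
  proof (intro equalityI subsetI)
    fix \<beta> assume b: "\<beta> \<in> finv (w \<circ> refl \<delta>)"
    show "\<beta> \<in> insert \<delta> (refl \<delta> ` finv w)"
    proof (cases "\<beta> = \<delta>")
      case False
      then have "refl \<delta> \<beta> \<in> finv w" using b d refl_base_pos by (auto simp: finv_def)
      then show ?thesis by (metis imageI insertI2 refl_refl)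
    qed simp
  next
    fix \<beta> assume "\<beta> \<in> insert \<delta> (refl \<delta> ` finv w)"
    then consider "\<beta> = \<delta>" | \<gamma> where "\<gamma> \<in> finv w" "\<beta> = refl \<delta> \<gamma>" by blast
    then show "\<beta> \<in> finv (w \<circ> refl \<delta>)"
    proof cases
      case 1 then show ?thesis using dP neg by (simp add: finv_def)
    next
      case 2
      then have "\<gamma> \<noteq> \<delta>" using up by (auto simp: finv_def)
      then show ?thesis using 2 d refl_base_pos by (auto simp: finv_def)
    qed
  qed
  moreover have "\<delta> \<notin> refl \<delta> ` finv w"
    using base_neg_not_pos[OF d] by (auto simp: finv_def) (metis refl_refl refl_self)
  ultimately show ?thesis by (simp add: finite_finv card_image inj_refl)
qed

text \<open>Reading the word from the right, \<open>\<delta>\<close> first turns negative at some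
  letter \<open>d\<close>; just before, it has become \<open>d\<close> itself, so conjugation
  cancels that letter against \<open>refl \<delta>\<close>.\<close>

lemma exchange:
  assumes "set ds \<subseteq> \<Delta>" "\<delta> \<in> \<Delta>" "word_map ds \<delta> \<notin> P"
  shows "\<exists>ds'. set ds' \<subseteq> \<Delta> \<and> Suc (length ds') = length ds \<and> word_map ds' = word_map ds \<circ> refl \<delta>"
  using assms
proof (induction ds)
  case Nil
  then show ?case using base_pos by auto
next
  case (Cons d ds)
  show ?case
  proof (cases "word_map ds \<delta> \<in> P")
    case True
    then have eq: "word_map ds \<delta> = d"
      using Cons.prems refl_base_pos[of d "word_map ds \<delta>"] by auto
    have "word_map ds \<in> W"
      using Cons.prems base_subset by (auto intro: weylI)
    then have "word_map ds \<circ> refl \<delta> = refl d \<circ> word_map ds"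
      using weyl_refl[of "word_map ds" \<Phi> \<delta>] eq by simp
    then have "word_map (d # ds) \<circ> refl \<delta> = word_map ds"
      by (metis (no_types, lifting) word_map_Cons comp_assoc refl_comp_refl id_comp)
    then show ?thesis using Cons.prems
      by (intro exI[of _ ds]) (simp del: word_map_Cons)
  next
    case False
    have "set ds \<subseteq> \<Delta>" using Cons.prems by simp
    from Cons.IH[OF this Cons.prems(2) False] obtain ds' where "set ds' \<subseteq> \<Delta>"
      "Suc (length ds') = length ds" "word_map ds' = word_map ds \<circ> refl \<delta>"
      by blast
    then show ?thesis using Cons.prems
      by (intro exI[of _ "d # ds'"]) (simp add: comp_assoc)
  qed
qed

text \<open>Descent on the height: since \<open>\<beta> \<bullet> \<beta> > 0\<close>, some base
  root \<open>\<gamma>\<close> has positive product with \<open>\<beta>\<close>, and outside the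
  base \<open>refl \<gamma>\<close> lowers the height while keeping the root positive.\<close>

lemma pos_root_conj_base:
  assumes "\<beta> \<in> P"
  shows "\<exists>ds \<delta>. set ds \<subseteq> \<Delta> \<and> \<delta> \<in> \<Delta> \<and> \<beta> = word_map ds \<delta>"
proof -
  define h where "h \<beta> = nat \<lfloor>two_rho_check \<bullet> \<beta>\<rfloor>" for \<beta>
  show ?thesis using assms
  proof (induction "h \<beta>" arbitrary: \<beta> rule: less_induct)
    case less
    show ?case
    proof (cases "\<beta> \<in> \<Delta>")
      case True
      then show ?thesis by (intro exI[of _ "[]"] exI[of _ \<beta>]) auto
    next
      case False
      obtain c where c: "\<beta> = (\<Sum>\<gamma>\<in>\<Delta>. real (c \<gamma>) *\<^sub>R \<gamma>)"
        using less.prems by (auto simp: pos_roots_def nonneg_int_comb_def)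
      have "0 < \<beta> \<bullet> \<beta>" using less.prems root_nonzero pos_root by simp
      also have "\<beta> \<bullet> \<beta> = (\<Sum>\<gamma>\<in>\<Delta>. real (c \<gamma>) * (\<beta> \<bullet> \<gamma>))"
        by (subst (2) c) (simp add: inner_sum_right)
      finally obtain \<gamma> where g: "\<gamma> \<in> \<Delta>" "0 < real (c \<gamma>) * (\<beta> \<bullet> \<gamma>)"
        using sum_nonpos[of \<Delta> "\<lambda>\<gamma>. real (c \<gamma>) * (\<beta> \<bullet> \<gamma>)"] by force
      then have "\<beta> \<bullet> \<gamma> > 0" by (simp add: zero_less_mult_iff)
      moreover have "\<gamma> \<bullet> \<gamma> > 0" using g base_subset root_nonzero by auto
      ultimately have "coroot \<gamma> \<bullet> \<beta> > 0" by (simp add: coroot_def inner_commute)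
      then have lt: "two_rho_check \<bullet> refl \<gamma> \<beta> < two_rho_check \<bullet> \<beta>"
        by (simp add: refl_eq_root inner_diff_right two_rho_check_base g)
      have pos: "refl \<gamma> \<beta> \<in> P" using g False less.prems by (intro refl_base_pos) auto
      have "h (refl \<gamma> \<beta>) < h \<beta>"
        using lt two_rho_check_Ints[of \<beta>] two_rho_check_Ints[of "refl \<gamma> \<beta>"]
          two_rho_check_pos[OF less.prems] two_rho_check_pos[OF pos]
          pos_root[OF pos] pos_root[OF less.prems]
        by (auto simp: h_def elim!: Ints_cases)
      from less.hyps[OF this pos] obtain ds \<delta> where
        "set ds \<subseteq> \<Delta>" "\<delta> \<in> \<Delta>" "refl \<gamma> \<beta> = word_map ds \<delta>" by blast
      then show ?thesis using g
        by (intro exI[of _ "\<gamma> # ds"] exI[of _ \<delta>]) (auto, metis refl_refl)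
    qed
  qed
qed

lemma refl_base_word:
  assumes "\<beta> \<in> \<Phi>"
  shows "\<exists>ds. set ds \<subseteq> \<Delta> \<and> word_map ds = refl \<beta>"
proof -
  have *: "\<exists>ds. set ds \<subseteq> \<Delta> \<and> word_map ds = refl \<beta>" if b: "\<beta> \<in> P" for \<beta>
  proof -
    obtain ds \<delta> where d: "set ds \<subseteq> \<Delta>" "\<delta> \<in> \<Delta>" "\<beta> = word_map ds \<delta>"
      using pos_root_conj_base[OF b] by blast
    then have W: "word_map ds \<in> W" using base_subset by (auto intro: weylI)
    then have "refl \<beta> \<circ> word_map ds \<circ> word_map (rev ds) = word_map ds \<circ> refl \<delta> \<circ> word_map (rev ds)"
      using weyl_refl d by metis
    then have "refl \<beta> = word_map (ds @ \<delta> # rev ds)"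
      by (simp add: comp_assoc word_map_rev')
    then show ?thesis using d by (intro exI[of _ "ds @ \<delta> # rev ds"]) auto
  qed
  show ?thesis using pos_or_neg[OF assms] *[of \<beta>] *[of "- \<beta>"] by auto
qed

lemma weyl_base_word:
  assumes "w \<in> W"
  shows "\<exists>ds. set ds \<subseteq> \<Delta> \<and> word_map ds = w"
proof -
  obtain ws where ws: "set ws \<subseteq> \<Phi>" "w = word_map ws" using assms by (rule weylE)
  have "\<exists>ds. set ds \<subseteq> \<Delta> \<and> word_map ds = word_map ws" using ws(1)
  proof (induction ws)
    case Nil
    show ?case by (intro exI[of _ "[]"]) simp
  next
    case (Cons a ws)
    then obtain ds es where "set ds \<subseteq> \<Delta>" "word_map ds = word_map ws"
      "set es \<subseteq> \<Delta>" "word_map es = refl a"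
      using refl_base_word[of a] by auto
    then show ?case by (intro exI[of _ "es @ ds"]) auto
  qed
  then show ?thesis using ws by simp
qed

lemma wlen_word:
  assumes "w \<in> W"
  obtains ds where "set ds \<subseteq> \<Delta>" "word_map ds = w" "length ds = wlen \<Delta> w"
proof -
  have "\<exists>n ds. length ds = n \<and> set ds \<subseteq> \<Delta> \<and> word_map ds = w"
    using weyl_base_word[OF assms] by blast
  then have "\<exists>ds. length ds = wlen \<Delta> w \<and> set ds \<subseteq> \<Delta> \<and> word_map ds = w"
    unfolding wlen_def by (rule LeastI_ex)
  then show ?thesis using that by blast
qed

lemma wlen_le: "set ds \<subseteq> \<Delta> \<Longrightarrow> word_map ds = w \<Longrightarrow> wlen \<Delta> w \<le> length ds"
  unfolding wlen_def by (rule Least_le) blast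

text \<open>Dropping the last letter of a reduced word leaves a reduced word;
  \<open>exchange\<close> rules out that this letter was a descent, so the inversion count grows by
  exactly one per letter.\<close>

theorem wlen_eq_card_finv:
  assumes "w \<in> W"
  shows "wlen \<Delta> w = card (finv w)"
  using assms
proof (induction "wlen \<Delta> w" arbitrary: w)
  case 0
  then have "w = id" by (metis wlen_word length_0_conv word_map_Nil)
  then have "finv w = {}" by (simp add: finv_def)
  then show ?case using 0 by simp
next
  case (Suc n)
  obtain ds where ds: "set ds \<subseteq> \<Delta>" "word_map ds = w" "length ds = Suc n"
    using Suc wlen_word by metis
  then obtain es \<delta> where es: "ds = es @ [\<delta>]" by (metis length_Suc_conv_rev)
  let ?u = "word_map es"
  have u: "?u \<in> W" "\<delta> \<in> \<Delta>" "length es = n" "w = ?u \<circ> refl \<delta>"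
    using ds es base_subset by (auto intro: weylI)
  have wu: "wlen \<Delta> ?u = n"
  proof (rule antisym)
    show "wlen \<Delta> ?u \<le> n" using wlen_le[of es ?u] ds es by auto
    obtain fs where "set fs \<subseteq> \<Delta>" "word_map fs = ?u" "length fs = wlen \<Delta> ?u"
      using u wlen_word by metis
    then have "wlen \<Delta> w \<le> wlen \<Delta> ?u + 1"
      using wlen_le[of "fs @ [\<delta>]" w] u by auto
    then show "n \<le> wlen \<Delta> ?u" using Suc by simp
  qed
  have "?u \<delta> \<in> P"
  proof (rule ccontr)
    assume "?u \<delta> \<notin> P"
    then obtain ds' where "set ds' \<subseteq> \<Delta>" "Suc (length ds') = length es"
      "word_map ds' = ?u \<circ> refl \<delta>"
      using exchange[of es \<delta>] ds es u by auto
    then have "wlen \<Delta> w < n" using wlen_le[of ds' w] u by simp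
    then show False using Suc by simp
  qed
  then have "card (finv w) = card (finv ?u) + 1"
    using finv_refl_base_up u by metis
  then show ?case using Suc wu u by simp
qed

lemma finv_empty_id:
  assumes "w \<in> W" "finv w = {}"
  shows "w = id"
proof -
  have "wlen \<Delta> w = 0" using assms by (simp add: wlen_eq_card_finv)
  then show ?thesis using assms wlen_word by (metis length_0_conv word_map_Nil)
qed

lemma finite_weyl: "finite W"
proof (rule finite_subset)
  show "W \<subseteq> word_map ` {ds. set ds \<subseteq> \<Delta> \<and> length ds \<le> card P}"
  proof
    fix w assume w: "w \<in> W"
    then obtain ds where ds: "set ds \<subseteq> \<Delta>" "word_map ds = w" "length ds = wlen \<Delta> w"
      by (rule wlen_word)
    have "wlen \<Delta> w \<le> card P"
      using w by (auto simp: wlen_eq_card_finv finv_def intro: card_mono finite_pos)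
    then show "w \<in> word_map ` {ds. set ds \<subseteq> \<Delta> \<and> length ds \<le> card P}" using ds by auto
  qed
  show "finite (word_map ` {ds. set ds \<subseteq> \<Delta> \<and> length ds \<le> card P})"
    by (intro finite_imageI finite_lists_length_le finite_base)
qed

end

section \<open>Lattices and the action on cocharacters\<close>

lemma int_lattice_zero:
  fixes f :: "'a \<Rightarrow> 'b::real_vector"
  shows "0 \<in> {(\<Sum>\<beta>\<in>A. real_of_int (c \<beta>) *\<^sub>R f \<beta>) | c. True}"
  by (auto intro!: exI[of _ "\<lambda>_. 0"])

lemma int_lattice_add:
  fixes f :: "'a \<Rightarrow> 'b::real_vector"
  assumes "a \<in> {(\<Sum>\<beta>\<in>A. real_of_int (c \<beta>) *\<^sub>R f \<beta>) | c. True}"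
    "b \<in> {(\<Sum>\<beta>\<in>A. real_of_int (c \<beta>) *\<^sub>R f \<beta>) | c. True}"
  shows "a + b \<in> {(\<Sum>\<beta>\<in>A. real_of_int (c \<beta>) *\<^sub>R f \<beta>) | c. True}"
proof -
  from assms obtain c d where "a = (\<Sum>\<beta>\<in>A. real_of_int (c \<beta>) *\<^sub>R f \<beta>)"
    "b = (\<Sum>\<beta>\<in>A. real_of_int (d \<beta>) *\<^sub>R f \<beta>)" by blast
  then have "a + b = (\<Sum>\<beta>\<in>A. real_of_int (c \<beta> + d \<beta>) *\<^sub>R f \<beta>)"
    by (simp add: sum.distrib scaleR_add_left)
  then show ?thesis by (intro CollectI exI[of _ "\<lambda>\<beta>. c \<beta> + d \<beta>"]) simp
qed

lemma int_lattice_scale: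
  fixes f :: "'a \<Rightarrow> 'b::real_vector"
  assumes "a \<in> {(\<Sum>\<beta>\<in>A. real_of_int (c \<beta>) *\<^sub>R f \<beta>) | c. True}"
  shows "real_of_int n *\<^sub>R a \<in> {(\<Sum>\<beta>\<in>A. real_of_int (c \<beta>) *\<^sub>R f \<beta>) | c. True}"
proof -
  from assms obtain c where "a = (\<Sum>\<beta>\<in>A. real_of_int (c \<beta>) *\<^sub>R f \<beta>)" by blast
  then have "real_of_int n *\<^sub>R a = (\<Sum>\<beta>\<in>A. real_of_int (n * c \<beta>) *\<^sub>R f \<beta>)"
    by (simp add: scaleR_sum_right)
  then show ?thesis by (intro CollectI exI[of _ "\<lambda>\<beta>. n * c \<beta>"]) simp
qed

lemma int_lattice_gen:
  fixes f :: "'a \<Rightarrow> 'b::real_vector"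
  assumes "finite A" "\<alpha> \<in> A"
  shows "f \<alpha> \<in> {(\<Sum>\<beta>\<in>A. real_of_int (c \<beta>) *\<^sub>R f \<beta>) | c. True}"
proof -
  have "f \<alpha> = (\<Sum>\<beta>\<in>A. real_of_int (if \<beta> = \<alpha> then 1 else 0) *\<^sub>R f \<beta>)"
    using assms by (simp add: if_distrib[of real_of_int] if_distrib[of "\<lambda>c. c *\<^sub>R _"] cong: if_cong)
  then show ?thesis by (intro CollectI exI[of _ "\<lambda>\<beta>. if \<beta> = \<alpha> then 1 else 0"]) simp
qed

locale cochar_root_system = based_root_system \<Phi> \<Delta>
  for \<Phi> \<Delta> :: "'v::euclidean_space set" +
  fixes pr :: "'x::ab_group_add \<Rightarrow> 'v \<Rightarrow> int" and \<iota> :: "'v \<Rightarrow> 'x"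
  assumes datum: "cochar_datum \<Phi> pr \<iota>"
begin

abbreviation L :: "'v set" where "L \<equiv> coroot_lattice \<Phi>"
abbreviation Q :: "'v set" where "Q \<equiv> root_lattice \<Phi>"

lemma L_zero [simp]: "0 \<in> L"
  and L_add: "a \<in> L \<Longrightarrow> b \<in> L \<Longrightarrow> a + b \<in> L"
  and L_scale: "a \<in> L \<Longrightarrow> real_of_int n *\<^sub>R a \<in> L"
  and L_coroot: "\<alpha> \<in> \<Phi> \<Longrightarrow> coroot \<alpha> \<in> L"
  unfolding coroot_lattice_def
  by (fact int_lattice_zero, erule (1) int_lattice_add, erule int_lattice_scale,
      rule int_lattice_gen[OF finite_roots])

lemma Q_zero [simp]: "0 \<in> Q"
  and Q_add: "a \<in> Q \<Longrightarrow> b \<in> Q \<Longrightarrow> a + b \<in> Q"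
  and Q_scale: "a \<in> Q \<Longrightarrow> real_of_int n *\<^sub>R a \<in> Q"
  and Q_root: "\<alpha> \<in> \<Phi> \<Longrightarrow> \<alpha> \<in> Q"
  unfolding root_lattice_def
  by (rule int_lattice_zero[where f = "\<lambda>x. x"], erule (1) int_lattice_add[where f = "\<lambda>x. x"],
      erule int_lattice_scale[where f = "\<lambda>x. x"],
      erule int_lattice_gen[OF finite_roots, where f = "\<lambda>x. x"])

lemma L_uminus: "a \<in> L \<Longrightarrow> - a \<in> L"
  using L_scale[of a "-1"] by simp

lemma Q_uminus: "a \<in> Q \<Longrightarrow> - a \<in> Q"
  using Q_scale[of a "-1"] by simp

lemma L_diff: "a \<in> L \<Longrightarrow> b \<in> L \<Longrightarrow> a - b \<in> L"
  using L_add[of a "- b"] L_uminus by simp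

lemma L_scale_coroot: "\<alpha> \<in> \<Phi> \<Longrightarrow> real_of_int n *\<^sub>R coroot \<alpha> \<in> L"
  by (simp add: L_scale L_coroot)

lemma L_sum: "(\<And>i. i \<in> I \<Longrightarrow> f i \<in> L) \<Longrightarrow> sum f I \<in> L"
  by (induction I rule: infinite_finite_induct) (auto intro: L_add)

lemma Q_sum: "(\<And>i. i \<in> I \<Longrightarrow> f i \<in> Q) \<Longrightarrow> sum f I \<in> Q"
  by (induction I rule: infinite_finite_induct) (auto intro: Q_add)

lemma \<iota>_add: "a \<in> L \<Longrightarrow> b \<in> L \<Longrightarrow> \<iota> (a + b) = \<iota> a + \<iota> b"
  and pr_add: "\<beta> \<in> Q \<Longrightarrow> pr (\<mu> + \<nu>) \<beta> = pr \<mu> \<beta> + pr \<nu> \<beta>"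
  and pr_add_right: "\<beta> \<in> Q \<Longrightarrow> \<gamma> \<in> Q \<Longrightarrow> pr \<mu> (\<beta> + \<gamma>) = pr \<mu> \<beta> + pr \<mu> \<gamma>"
  and pr_\<iota>: "a \<in> L \<Longrightarrow> \<beta> \<in> Q \<Longrightarrow> real_of_int (pr (\<iota> a) \<beta>) = a \<bullet> \<beta>"
  using datum unfolding cochar_datum_def by blast+

lemma \<iota>_zero [simp]: "\<iota> 0 = 0"
  using \<iota>_add[of 0 0] by simp

lemma \<iota>_uminus: "a \<in> L \<Longrightarrow> \<iota> (- a) = - \<iota> a"
  using \<iota>_add[of a "- a"] by (simp add: L_uminus eq_neg_iff_add_eq_0 add.commute)

lemma \<iota>_diff: "a \<in> L \<Longrightarrow> b \<in> L \<Longrightarrow> \<iota> (a - b) = \<iota> a - \<iota> b"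
  using \<iota>_add[of a "- b"] by (simp add: L_uminus \<iota>_uminus)

lemma pr_zero: "\<beta> \<in> Q \<Longrightarrow> pr 0 \<beta> = 0"
  using pr_add[of \<beta> 0 0] by simp

lemma pr_uminus: "\<beta> \<in> Q \<Longrightarrow> pr (- \<mu>) \<beta> = - pr \<mu> \<beta>"
  using pr_add[of \<beta> \<mu> "- \<mu>"] by (simp add: pr_zero)

lemma pr_diff: "\<beta> \<in> Q \<Longrightarrow> pr (\<mu> - \<nu>) \<beta> = pr \<mu> \<beta> - pr \<nu> \<beta>"
  using pr_add[of \<beta> \<mu> "- \<nu>"] by (simp add: pr_uminus)

lemma pr_zero_right [simp]: "pr \<mu> 0 = 0"
  using pr_add_right[of 0 0] by simp

lemma pr_uminus_right: "\<beta> \<in> Q \<Longrightarrow> pr \<mu> (- \<beta>) = - pr \<mu> \<beta>"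
  using pr_add_right[of \<beta> "- \<beta>" \<mu>] by (simp add: Q_uminus)

lemma pr_diff_right: "\<beta> \<in> Q \<Longrightarrow> \<gamma> \<in> Q \<Longrightarrow> pr \<mu> (\<beta> - \<gamma>) = pr \<mu> \<beta> - pr \<mu> \<gamma>"
  using pr_add_right[of \<beta> "- \<gamma>"] by (simp add: Q_uminus pr_uminus_right)

lemma pr_scale_nat: "\<beta> \<in> Q \<Longrightarrow> pr \<mu> (real n *\<^sub>R \<beta>) = int n * pr \<mu> \<beta>"
proof (induction n)
  case (Suc n)
  have "real n *\<^sub>R \<beta> \<in> Q" using Q_scale[of \<beta> "int n"] Suc by simp
  then show ?case using Suc by (simp add: pr_add_right scaleR_add_left algebra_simps)
qed simp

lemma pr_scale_int:
  assumes "\<beta> \<in> Q"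
  shows "pr \<mu> (real_of_int n *\<^sub>R \<beta>) = n * pr \<mu> \<beta>"
proof (cases "n \<ge> 0")
  case True
  then show ?thesis using pr_scale_nat[OF assms, of \<mu> "nat n"] by simp
next
  case False
  then show ?thesis
    using pr_scale_nat[OF assms, of \<mu> "nat (- n)"] pr_uminus_right[of "real_of_int n *\<^sub>R \<beta>" \<mu>]
    by (simp add: Q_scale assms)
qed

lemma pr_sum: "(\<And>i. i \<in> I \<Longrightarrow> f i \<in> Q) \<Longrightarrow> pr \<mu> (sum f I) = (\<Sum>i\<in>I. pr \<mu> (f i))"
  by (induction I rule: infinite_finite_induct) (simp_all add: pr_add_right Q_sum)

abbreviation cart :: "'v \<Rightarrow> 'v \<Rightarrow> int" where "cart \<alpha> \<beta> \<equiv> pr (\<iota> (coroot \<alpha>)) \<beta>"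

lemma cart: "\<alpha> \<in> \<Phi> \<Longrightarrow> \<beta> \<in> Q \<Longrightarrow> real_of_int (cart \<alpha> \<beta>) = coroot \<alpha> \<bullet> \<beta>"
  by (simp add: pr_\<iota> L_coroot)

lemma refl_cart: "\<alpha> \<in> \<Phi> \<Longrightarrow> \<beta> \<in> Q \<Longrightarrow> refl \<alpha> \<beta> = \<beta> - real_of_int (cart \<alpha> \<beta>) *\<^sub>R \<alpha>"
  by (simp add: refl_eq_root cart)

lemma refl_Q: "\<alpha> \<in> \<Phi> \<Longrightarrow> \<beta> \<in> Q \<Longrightarrow> refl \<alpha> \<beta> \<in> Q"
  using Q_add[of \<beta> "- (real_of_int (cart \<alpha> \<beta>) *\<^sub>R \<alpha>)"]
  by (simp add: refl_cart Q_uminus Q_scale Q_root)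

lemma pr_refl: "\<alpha> \<in> \<Phi> \<Longrightarrow> \<beta> \<in> Q \<Longrightarrow> pr \<mu> (refl \<alpha> \<beta>) = pr \<mu> \<beta> - cart \<alpha> \<beta> * pr \<mu> \<alpha>"
  by (simp add: refl_cart pr_diff_right pr_scale_int Q_scale Q_root)

lemma pr_\<iota>_scale_coroot:
  assumes "\<alpha> \<in> \<Phi>" "\<beta> \<in> Q"
  shows "pr (\<iota> (real_of_int n *\<^sub>R coroot \<alpha>)) \<beta> = n * cart \<alpha> \<beta>"
proof -
  have "real_of_int (pr (\<iota> (real_of_int n *\<^sub>R coroot \<alpha>)) \<beta>) = real_of_int (n * cart \<alpha> \<beta>)"
    using assms by (simp add: pr_\<iota> L_scale_coroot cart)
  then show ?thesis by linarith
qed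

lemma pr_reflX: "\<alpha> \<in> \<Phi> \<Longrightarrow> \<beta> \<in> Q \<Longrightarrow> pr (reflX pr \<iota> \<alpha> \<mu>) \<beta> = pr \<mu> (refl \<alpha> \<beta>)"
  by (simp add: reflX_def pr_diff pr_refl pr_\<iota>_scale_coroot)

section \<open>The Weyl group action on cocharacters and its independence of words\<close>

lemma word_actX_Nil [simp]: "word_actX pr \<iota> [] = id"
  by (simp add: word_actX_def)

lemma word_actX_Cons [simp]: "word_actX pr \<iota> (\<alpha> # ws) = reflX pr \<iota> \<alpha> \<circ> word_actX pr \<iota> ws"
  by (simp add: word_actX_def)

lemma word_actX_append: "word_actX pr \<iota> (us @ ws) = word_actX pr \<iota> us \<circ> word_actX pr \<iota> ws"
  by (induction us) (simp_all add: comp_assoc)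

text \<open>The pairing may vanish on nonzero elements of \<open>X\<^sub>*\<close> and so cannot
  separate them; but the action moves \<open>\<mu>\<close> only by coroot-lattice elements, which
  the pairing does separate.\<close>

lemma word_actX_diff: "set ws \<subseteq> \<Phi> \<Longrightarrow> \<exists>c\<in>L. word_actX pr \<iota> ws \<mu> = \<mu> - \<iota> c"
proof (induction ws)
  case Nil
  show ?case by (intro bexI[of _ 0]) simp_all
next
  case (Cons a ws)
  then obtain c where c: "c \<in> L" "word_actX pr \<iota> ws \<mu> = \<mu> - \<iota> c" by auto
  let ?d = "real_of_int (pr (\<mu> - \<iota> c) a) *\<^sub>R coroot a"
  have "?d \<in> L" using Cons by (simp add: L_scale_coroot)
  then show ?case using c by (intro bexI[of _ "c + ?d"]) (simp_all add: reflX_def \<iota>_add L_add)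
qed

lemma pr_word_actX:
  "set ws \<subseteq> \<Phi> \<Longrightarrow> \<beta> \<in> Q \<Longrightarrow> pr (word_actX pr \<iota> ws \<mu>) \<beta> = pr \<mu> (word_map (rev ws) \<beta>)"
  by (induction ws arbitrary: \<beta>) (simp_all add: pr_reflX refl_Q)

text \<open>\<open>c \<bullet> c\<close> expands into terms
  \<open>c \<bullet> coroot \<beta>\<close>, each a multiple of
  \<open>c \<bullet> \<beta>\<close>.\<close>

lemma L_orthogonal_zero:
  assumes c: "c \<in> L" and "\<And>\<beta>. \<beta> \<in> \<Phi> \<Longrightarrow> c \<bullet> \<beta> = 0"
  shows "c = 0"
proof -
  obtain d where "c = (\<Sum>\<beta>\<in>\<Phi>. real_of_int (d \<beta>) *\<^sub>R coroot \<beta>)"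
    using c unfolding coroot_lattice_def by blast
  then have "c \<bullet> c = (\<Sum>\<beta>\<in>\<Phi>. real_of_int (d \<beta>) * (c \<bullet> coroot \<beta>))"
    by (metis (no_types, lifting) inner_scaleR_right inner_sum_right sum.cong)
  also have "\<dots> = 0" using assms by (intro sum.neutral) (simp add: coroot_def)
  finally show ?thesis by simp
qed

lemma word_actX_cong:
  assumes "set us \<subseteq> \<Phi>" "set ws \<subseteq> \<Phi>" "word_map us = word_map ws"
  shows "word_actX pr \<iota> us = word_actX pr \<iota> ws"
proof
  fix \<mu>
  obtain c d where c: "c \<in> L" "word_actX pr \<iota> us \<mu> = \<mu> - \<iota> c"
    and d: "d \<in> L" "word_actX pr \<iota> ws \<mu> = \<mu> - \<iota> d"
    using assms word_actX_diff by metis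
  have "(c - d) \<bullet> \<beta> = 0" if "\<beta> \<in> \<Phi>" for \<beta>
  proof -
    have "word_map (rev us) = word_map (rev ws)" using assms by (metis inv_word_map)
    then have "pr (\<mu> - \<iota> c) \<beta> = pr (\<mu> - \<iota> d) \<beta>"
      using pr_word_actX[of us \<beta> \<mu>] pr_word_actX[of ws \<beta> \<mu>] assms c d that by (simp add: Q_root)
    then have "real_of_int (pr (\<iota> c) \<beta>) = real_of_int (pr (\<iota> d) \<beta>)"
      using that by (simp add: pr_diff Q_root)
    then show ?thesis using c d that by (simp add: pr_\<iota> Q_root inner_diff_left)
  qed
  then have "c - d = 0" using c d by (intro L_orthogonal_zero L_diff)
  then show "word_actX pr \<iota> us \<mu> = word_actX pr \<iota> ws \<mu>" using c d by simp
qed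

abbreviation act :: "('v \<Rightarrow> 'v) \<Rightarrow> 'x \<Rightarrow> 'x" where "act \<equiv> actX \<Phi> pr \<iota>"

lemma act_word_map:
  assumes "set ws \<subseteq> \<Phi>"
  shows "act (word_map ws) = word_actX pr \<iota> ws"
proof -
  have "set (SOME us. set us \<subseteq> \<Phi> \<and> word_map us = word_map ws) \<subseteq> \<Phi> \<and>
     word_map (SOME us. set us \<subseteq> \<Phi> \<and> word_map us = word_map ws) = word_map ws"
    by (rule someI[of _ ws]) (simp add: assms)
  then show ?thesis unfolding actX_def using assms by (blast intro: word_actX_cong)
qed

lemma act_id [simp]: "act id = id"
  using act_word_map[of "[]"] by simp

lemma act_refl: "\<alpha> \<in> \<Phi> \<Longrightarrow> act (refl \<alpha>) = reflX pr \<iota> \<alpha>"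
  using act_word_map[of "[\<alpha>]"] by simp

lemma act_comp:
  assumes "u \<in> W" "w \<in> W"
  shows "act (u \<circ> w) \<mu> = act u (act w \<mu>)"
proof -
  obtain us ws where u: "set us \<subseteq> \<Phi>" "u = word_map us" and w: "set ws \<subseteq> \<Phi>" "w = word_map ws"
    using assms by (metis weylE)
  then have "act (u \<circ> w) = word_actX pr \<iota> (us @ ws)"
    using act_word_map[of "us @ ws"] by simp
  then show ?thesis using u w by (simp add: word_actX_append act_word_map)
qed

lemma reflX_add:
  assumes "\<alpha> \<in> \<Phi>"
  shows "reflX pr \<iota> \<alpha> (\<mu> + \<nu>) = reflX pr \<iota> \<alpha> \<mu> + reflX pr \<iota> \<alpha> \<nu>"
  using assms by (simp add: reflX_def pr_add Q_root scaleR_add_left \<iota>_add L_scale_coroot)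

lemma reflX_\<iota>:
  assumes "\<alpha> \<in> \<Phi>" "c \<in> L"
  shows "reflX pr \<iota> \<alpha> (\<iota> c) = \<iota> (refl \<alpha> c)" "refl \<alpha> c \<in> L"
proof -
  have *: "refl \<alpha> c = c - real_of_int (pr (\<iota> c) \<alpha>) *\<^sub>R coroot \<alpha>"
    using assms by (simp add: refl_eq_coroot pr_\<iota> Q_root inner_commute)
  show "reflX pr \<iota> \<alpha> (\<iota> c) = \<iota> (refl \<alpha> c)" "refl \<alpha> c \<in> L"
    unfolding * using assms by (simp_all add: reflX_def \<iota>_diff L_scale_coroot L_diff)
qed

lemma act_add: "w \<in> W \<Longrightarrow> act w (\<mu> + \<nu>) = act w \<mu> + act w \<nu>"
proof (elim weylE)
  fix ws assume ws: "set ws \<subseteq> \<Phi>" and w: "w = word_map ws"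
  have "word_actX pr \<iota> ws (\<mu> + \<nu>) = word_actX pr \<iota> ws \<mu> + word_actX pr \<iota> ws \<nu>"
    using ws by (induction ws) (simp_all add: reflX_add)
  then show ?thesis using ws w by (simp add: act_word_map)
qed

lemma act_\<iota>:
  assumes "w \<in> W" "c \<in> L"
  shows "act w (\<iota> c) = \<iota> (w c)" and "w c \<in> L"
proof -
  obtain ws where ws: "set ws \<subseteq> \<Phi>" "w = word_map ws" using assms(1) by (rule weylE)
  have "word_actX pr \<iota> ws (\<iota> c) = \<iota> (word_map ws c) \<and> word_map ws c \<in> L"
    using ws(1) by (induction ws) (simp_all add: reflX_\<iota> assms)
  then show "act w (\<iota> c) = \<iota> (w c)" "w c \<in> L" using ws by (simp_all add: act_word_map)
qed

lemma pr_act: "w \<in> W \<Longrightarrow> \<beta> \<in> Q \<Longrightarrow> pr (act w \<mu>) \<beta> = pr \<mu> (inv w \<beta>)"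
  by (elim weylE) (simp add: act_word_map pr_word_actX inv_word_map)

lemma pr_act_inv: "w \<in> W \<Longrightarrow> \<beta> \<in> Q \<Longrightarrow> pr (act (inv w) \<mu>) \<beta> = pr \<mu> (w \<beta>)"
  by (simp add: pr_act weyl_inv weyl_bij inv_inv_eq)

lemma act_zero: "w \<in> W \<Longrightarrow> act w 0 = 0"
  using act_add[of w 0 0] by simp

lemma act_uminus: "w \<in> W \<Longrightarrow> act w (- \<mu>) = - act w \<mu>"
  using act_add[of w \<mu> "- \<mu>"] by (simp add: act_zero eq_neg_iff_add_eq_0 add.commute)

section \<open>The extended affine Weyl group and affine roots\<close>

abbreviation mult (infixl "\<odot>" 70) where "x \<odot> y \<equiv> aff_mult \<Phi> pr \<iota> x y"
abbreviation aact (infixr "\<star>" 75) where "x \<star> a \<equiv> aff_act pr x a"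
abbreviation r where "r \<equiv> aff_refl \<iota>"
abbreviation E :: "(('v \<Rightarrow> 'v) \<times> 'x) set" where "E \<equiv> ext_affine_weyl \<Phi>"
abbreviation pos where "pos \<equiv> aff_pos \<Phi> \<Delta>"

definition aneg :: "'v \<times> int \<Rightarrow> 'v \<times> int" where
  "aneg a = (- fst a, - snd a)"

definition aone :: "('v \<Rightarrow> 'v) \<times> 'x" where
  "aone = (id, 0)"

text \<open>Inverting puts the translation by \<open>- \<mu>\<close> to the left of the inverse of
  \<open>w\<close>; moved to the right it becomes \<open>- w \<mu>\<close>.\<close>

definition ainv :: "('v \<Rightarrow> 'v) \<times> 'x \<Rightarrow> ('v \<Rightarrow> 'v) \<times> 'x" where
  "ainv x = (inv (fst x), - act (fst x) (snd x))"

lemma E_iff [simp]: "x \<in> E \<longleftrightarrow> fst x \<in> W"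
  by (cases x) (simp add: ext_affine_weyl_def)

lemma fst_mult [simp]: "fst (x \<odot> y) = fst x \<circ> fst y"
  by (simp add: aff_mult_def)

lemma fst_r [simp]: "fst (r a) = refl (fst a)"
  by (simp add: aff_refl_def)

lemma fst_aact [simp]: "fst (x \<star> a) = fst x (fst a)"
  by (simp add: aff_act_def)

lemma fst_aneg [simp]: "fst (aneg a) = - fst a"
  by (simp add: aneg_def)

lemma aneg_aneg [simp]: "aneg (aneg a) = a"
  by (simp add: aneg_def)

lemma r_aneg [simp]: "r (aneg a) = r a"
  by (simp add: aff_refl_def aneg_def)

lemma fst_ainv [simp]: "fst (ainv x) = inv (fst x)"
  by (simp add: ainv_def)

lemma fst_aone [simp]: "fst aone = id"
  by (simp add: aone_def)

lemma mult_assoc: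
  assumes "fst x \<in> W" "fst y \<in> W" "fst z \<in> W"
  shows "x \<odot> y \<odot> z = x \<odot> (y \<odot> z)"
  using assms
  by (simp add: aff_mult_def comp_assoc o_inv_distrib weyl_bij act_comp act_add weyl_inv add.assoc)

lemma mult_aone [simp]: "x \<odot> aone = x" "fst x \<in> W \<Longrightarrow> aone \<odot> x = x"
  by (simp_all add: aff_mult_def aone_def act_zero weyl_inv)

lemma mult_ainv: "fst x \<in> W \<Longrightarrow> x \<odot> ainv x = aone"
  by (simp add: aff_mult_def ainv_def aone_def weyl_inv_comp weyl_bij inv_inv_eq)

lemma ainv_mult: "fst x \<in> W \<Longrightarrow> ainv x \<odot> x = aone"
  by (simp add: aff_mult_def ainv_def aone_def weyl_inv_comp act_uminus weyl_inv
      act_comp[symmetric])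

lemma aact_mult:
  assumes "fst x \<in> W" "fst y \<in> W" "fst a \<in> \<Phi>"
  shows "(x \<odot> y) \<star> a = x \<star> y \<star> a"
  using assms by (simp add: aff_act_def aff_mult_def pr_add Q_root pr_act_inv)

lemma aact_aone [simp]: "fst a \<in> \<Phi> \<Longrightarrow> aone \<star> a = a"
  by (simp add: aff_act_def aone_def pr_zero Q_root)

lemma aact_ainv: "fst x \<in> W \<Longrightarrow> fst a \<in> \<Phi> \<Longrightarrow> x \<star> ainv x \<star> a = a"
  by (simp add: aact_mult[symmetric] weyl_inv mult_ainv)

lemma aact_surj:
  assumes "fst x \<in> W" "fst a \<in> \<Phi>"
  obtains b where "fst b \<in> \<Phi>" "x \<star> b = a"
  using aact_ainv[OF assms] assms that[of "ainv x \<star> a"] by (simp add: weyl_inv)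

lemma aact_aneg: "fst x \<in> W \<Longrightarrow> fst a \<in> \<Phi> \<Longrightarrow> x \<star> aneg a = aneg (x \<star> a)"
  by (simp add: aff_act_def aneg_def pr_uminus_right Q_root weyl_uminus)

lemma aact_inj: "fst x \<in> W \<Longrightarrow> fst a \<in> \<Phi> \<Longrightarrow> fst b \<in> \<Phi> \<Longrightarrow> x \<star> a = x \<star> b \<longleftrightarrow> a = b"
  by (metis aact_aone aact_mult ainv_mult fst_ainv weyl_inv)

lemma r_act: "fst a \<in> \<Phi> \<Longrightarrow> fst b \<in> \<Phi> \<Longrightarrow>
    r a \<star> b = (refl (fst a) (fst b), snd b - snd a * cart (fst a) (fst b))"
  by (simp add: aff_act_def aff_refl_def pr_\<iota>_scale_coroot Q_root)

lemma cart_self: "\<alpha> \<in> \<Phi> \<Longrightarrow> cart \<alpha> \<alpha> = 2"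
proof -
  assume "\<alpha> \<in> \<Phi>"
  then have "real_of_int (cart \<alpha> \<alpha>) = 2"
    by (simp add: cart Q_root coroot_inner_self root_nonzero)
  then show ?thesis by linarith
qed

lemma r_act_self: "fst a \<in> \<Phi> \<Longrightarrow> r a \<star> a = aneg a"
  by (simp add: r_act cart_self aneg_def)

lemma mult_r:
  assumes "fst x \<in> W" "fst a \<in> \<Phi>"
  shows "x \<odot> r a = (fst x \<circ> refl (fst a),
      snd x + \<iota> (real_of_int (snd (x \<star> a)) *\<^sub>R coroot (fst a)))"
  using assms by (simp add: aff_mult_def aff_refl_def aff_act_def act_refl reflX_def
      scaleR_diff_left \<iota>_diff L_scale_coroot)

text \<open>Translates between right steps, which define both orders, and left reflections, along
  which the semi-infinite order is lifted.\<close>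

lemma mult_r_conj:
  assumes "fst x \<in> W" "fst a \<in> \<Phi>"
  shows "x \<odot> r a = r (x \<star> a) \<odot> x"
proof -
  have "act (inv (fst x)) (\<iota> (real_of_int k *\<^sub>R fst x (coroot (fst a)))) = \<iota> (real_of_int k *\<^sub>R coroot (fst a))"
    for k
    using assms act_\<iota>[of "inv (fst x)" "real_of_int k *\<^sub>R fst x (coroot (fst a))"]
    by (simp add: weyl_inv act_\<iota>(2) L_scale L_coroot
        linear_scale[OF weyl_linear[OF weyl_inv[OF assms(1)]]])
  then show ?thesis unfolding mult_r[OF assms] using assms
    by (simp add: aff_mult_def aff_refl_def weyl_refl weyl_coroot add.commute)
qed

lemma r_mult_r: "fst a \<in> \<Phi> \<Longrightarrow> r a \<odot> r a = aone"
  by (simp add: mult_r refl_in_weyl r_act_self)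
    (simp add: aone_def aneg_def aff_refl_def \<iota>_uminus L_scale_coroot)

lemma mult_r_r: "fst x \<in> W \<Longrightarrow> fst a \<in> \<Phi> \<Longrightarrow> x \<odot> r a \<odot> r a = x"
  by (simp add: mult_assoc refl_in_weyl r_mult_r)

lemma r_r_mult: "fst x \<in> W \<Longrightarrow> fst a \<in> \<Phi> \<Longrightarrow> r a \<odot> (r a \<odot> x) = x"
  by (simp add: mult_assoc[symmetric] refl_in_weyl r_mult_r)

lemma r_act_r: "fst a \<in> \<Phi> \<Longrightarrow> fst b \<in> \<Phi> \<Longrightarrow> r a \<star> r a \<star> b = b"
  by (simp add: aact_mult[symmetric] refl_in_weyl r_mult_r)

subsection \<open>Positive affine roots\<close>

text \<open>Exceeds the absolute height of every root, so heights decide a sign only at level 0: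
  \<open>two_rho_check\<close> divided by \<open>hscale\<close> is an interior point of the base
  alcove.\<close>

definition hscale :: real where
  "hscale = 1 + (\<Sum>\<beta>\<in>\<Phi>. \<bar>two_rho_check \<bullet> \<beta>\<bar>)"

text \<open>Positivity of an affine root is the sign of this linear functional, which turns positivity
  arguments into linear arithmetic.\<close>
definition hgt :: "'v \<times> int \<Rightarrow> real" where
  "hgt a = two_rho_check \<bullet> fst a + hscale * real_of_int (snd a)"

lemma two_rho_check_less_hscale:
  assumes "\<beta> \<in> \<Phi>"
  shows "\<bar>two_rho_check \<bullet> \<beta>\<bar> < hscale"
  using member_le_sum[of \<beta> \<Phi> "\<lambda>\<beta>. \<bar>two_rho_check \<bullet> \<beta>\<bar>"] assms finite_roots
  by (simp add: hscale_def)

lemma hscale_pos: "hscale > 0"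
  by (simp add: hscale_def add_pos_nonneg sum_nonneg)

lemma hgt_pos_of_snd:
  assumes "fst a \<in> \<Phi>" "snd a \<ge> 1"
  shows "hgt a > 0"
proof -
  have "hscale * 1 \<le> hscale * real_of_int (snd a)"
    using assms hscale_pos by (intro mult_left_mono) auto
  then show ?thesis using two_rho_check_less_hscale[OF assms(1)] by (simp add: hgt_def)
qed

lemma hgt_aneg [simp]: "hgt (aneg a) = - hgt a"
  by (simp add: hgt_def aneg_def)

lemma pos_hgt: "pos a \<longleftrightarrow> fst a \<in> \<Phi> \<and> hgt a > 0"
proof (cases "fst a \<in> \<Phi>")
  case True
  consider "snd a \<ge> 1" | "snd a = 0" | "snd a \<le> -1" by linarith
  then show ?thesis
  proof cases
    case 1 then show ?thesis using hgt_pos_of_snd True by (auto simp: aff_pos_def)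
  next
    case 2 then show ?thesis using True pos_iff[of "- fst a"] pos_iff[of "fst a"] neg_iff[of "fst a"]
      by (auto simp: aff_pos_def hgt_def)
  next
    case 3 then show ?thesis using hgt_pos_of_snd[of "aneg a"] True
      by (auto simp: aff_pos_def aneg_def hgt_def)
  qed
qed (simp add: aff_pos_def)

lemma pos_fst: "pos a \<Longrightarrow> fst a \<in> \<Phi>"
  by (simp add: pos_hgt)

lemma not_pos_hgt: "fst a \<in> \<Phi> \<Longrightarrow> \<not> pos a \<longleftrightarrow> hgt a < 0"
proof -
  assume a: "fst a \<in> \<Phi>"
  have "pos a \<or> pos (aneg a)"
    using a neg_iff[of "fst a"] by (auto simp: aff_pos_def aneg_def)
  then show ?thesis using a by (auto simp: pos_hgt)
qed

lemma pos_aneg: "fst a \<in> \<Phi> \<Longrightarrow> pos (aneg a) \<longleftrightarrow> \<not> pos a"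
  using not_pos_hgt[of a] by (simp add: pos_hgt)

lemma hgt_reflect:
  assumes "fst x \<in> W" "fst a \<in> \<Phi>" "fst b \<in> \<Phi>"
  shows "hgt (x \<star> r a \<star> b) = hgt (x \<star> b) - real_of_int (cart (fst a) (fst b)) * hgt (x \<star> a)"
  using assms
  by (simp add: r_act) (simp add: aff_act_def hgt_def refl_cart Q_root pr_diff_right pr_scale_int Q_scale
      linear_diff[OF weyl_linear] linear_scale[OF weyl_linear] inner_diff_right algebra_simps)

lemma hgt_reflect':
  assumes "fst a \<in> \<Phi>" "fst b \<in> \<Phi>"
  shows "hgt (r a \<star> b) = hgt b - real_of_int (cart (fst a) (fst b)) * hgt a"
  using hgt_reflect[of aone a b] assms by (simp add: refl_root)

subsection \<open>Length and the Bruhat order\<close>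

definition ainvs :: "('v \<Rightarrow> 'v) \<times> 'x \<Rightarrow> ('v \<times> int) set" where
  "ainvs x = {a. pos a \<and> \<not> pos (x \<star> a)}"

abbreviation len :: "('v \<Rightarrow> 'v) \<times> 'x \<Rightarrow> nat" where "len \<equiv> aff_len \<Phi> \<Delta> pr"

lemma len_ainvs: "len x = card (ainvs x)"
  by (simp add: aff_len_def ainvs_def)

lemma ainvs_hgt: "fst x \<in> W \<Longrightarrow> a \<in> ainvs x \<longleftrightarrow> fst a \<in> \<Phi> \<and> hgt a > 0 \<and> hgt (x \<star> a) < 0"
  by (auto simp: ainvs_def pos_hgt not_pos_hgt[symmetric] pos_fst)

lemma finite_ainvs:
  assumes "fst x \<in> W"
  shows "finite (ainvs x)"
proof (rule finite_subset)
  show "ainvs x \<subseteq> (SIGMA \<alpha>:\<Phi>. {0..pr (snd x) \<alpha>})"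
    using assms by (auto simp: ainvs_def aff_pos_def aff_act_def split: if_splits)
  show "finite (SIGMA \<alpha>:\<Phi>. {0..pr (snd x) \<alpha>})"
    using finite_roots by auto
qed

text \<open>The inversions of \<open>x\<close> inject into those of \<open>x \<odot> r a\<close>,
  and the inversion \<open>a\<close> is missed.\<close>

lemma len_less_mult_r:
  assumes x: "fst x \<in> W" and a: "pos a" and xa: "pos (x \<star> a)"
  shows "len x < len (x \<odot> r a)"
proof -
  \<comment> \<open>Move \<open>b\<close> by \<open>r a\<close> when that keeps it positive;
    otherwise \<open>r a\<close> subtracts a positive multiple of \<open>a\<close>, and
    \<open>b\<close> itself stays an inversion.\<close>
  define f where "f b = (if pos (r a \<star> b) then r a \<star> b else b)" for b
  have a': "fst a \<in> \<Phi>" using a by (rule pos_fst)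
  have xr: "fst (x \<odot> r a) \<in> W" using x a' by (simp add: weyl_comp refl_in_weyl)
  have act: "(x \<odot> r a) \<star> b = x \<star> r a \<star> b" if "fst b \<in> \<Phi>" for b
    using x a' that by (simp add: aact_mult refl_in_weyl)
  have inj: "inj_on f (ainvs x)"
  proof (rule inj_onI)
    fix b c assume bc: "b \<in> ainvs x" "c \<in> ainvs x" "f b = f c"
    then have "fst b \<in> \<Phi>" "fst c \<in> \<Phi>" "pos b" "pos c" by (auto simp: ainvs_def pos_fst)
    moreover have "r a \<star> r a \<star> b = b" "r a \<star> r a \<star> c = c"
      using a' calculation by (simp_all add: r_act_r)
    ultimately show "b = c" using bc(3) unfolding f_def by metis
  qed
  have "f ` ainvs x \<subseteq> ainvs (x \<odot> r a) - {a}"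
  proof (rule image_subsetI)
    fix b assume b: "b \<in> ainvs x"
    then have b': "fst b \<in> \<Phi>" "hgt b > 0" "hgt (x \<star> b) < 0" using x by (auto simp: ainvs_hgt)
    have rb: "fst (r a \<star> b) \<in> \<Phi>" using a' b' by (simp add: refl_root)
    show "f b \<in> ainvs (x \<odot> r a) - {a}"
    proof (cases "pos (r a \<star> b)")
      case True
      have "r a \<star> b \<noteq> a"
      proof
        assume "r a \<star> b = a"
        then have "b = aneg a" using a' b' by (metis r_act_r r_act_self)
        then show False using a b' by (simp add: pos_hgt)
      qed
      moreover have "(x \<odot> r a) \<star> r a \<star> b = x \<star> b"
        using act[OF rb] r_act_r[OF a' b'(1)] by simp
      ultimately show ?thesis using True b' b by (simp add: f_def ainvs_def)
    next
      case False
      then have "hgt b - real_of_int (cart (fst a) (fst b)) * hgt a < 0"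
        using not_pos_hgt[OF rb] hgt_reflect'[OF a' b'(1)] by simp
      then have "real_of_int (cart (fst a) (fst b)) * hgt a > 0" using b' by linarith
      then have n: "real_of_int (cart (fst a) (fst b)) > 0"
        using a by (simp add: pos_hgt zero_less_mult_iff)
      have "hgt (x \<star> r a \<star> b) < 0"
        using hgt_reflect[OF x a' b'(1)] b'(3) mult_pos_pos[OF n, of "hgt (x \<star> a)"] xa by (simp add: pos_hgt)
      moreover have "b \<noteq> a" using b xa by (auto simp: ainvs_def)
      ultimately show ?thesis using False b' xr act[OF b'(1)] by (simp add: f_def ainvs_hgt)
    qed
  qed
  then have "len x \<le> card (ainvs (x \<odot> r a) - {a})"
    unfolding len_ainvs using inj xr by (intro card_inj_on_le[of f]) (auto simp: finite_ainvs)
  also have "a \<in> ainvs (x \<odot> r a)"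
    using a a' x xa by (simp add: ainvs_def act r_act_self aact_aneg pos_aneg)
  then have "card (ainvs (x \<odot> r a) - {a}) < len (x \<odot> r a)"
    unfolding len_ainvs using xr by (intro card_Diff1_less finite_ainvs)
  finally show ?thesis .
qed

text \<open>Since \<open>r (aneg a) = r a\<close>, the root may be taken positive, and a negative
  \<open>x \<star> a\<close> would make the step go down by \<open>len_less_mult_r\<close>. This
  trades a length comparison for a sign condition.\<close>

lemma bruhat_step_iff:
  "bruhat_step \<Phi> \<Delta> pr \<iota> x y \<longleftrightarrow> fst x \<in> W \<and> (\<exists>a. pos a \<and> pos (x \<star> a) \<and> y = x \<odot> r a)"
proof
  assume "bruhat_step \<Phi> \<Delta> pr \<iota> x y"
  then obtain b where b: "fst b \<in> \<Phi>" "y = x \<odot> r b" "len x < len y" and x: "fst x \<in> W"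
    by (auto simp: bruhat_step_def)
  define a where "a = (if pos b then b else aneg b)"
  have a: "pos a" "fst a \<in> \<Phi>" "y = x \<odot> r a" using b by (auto simp: a_def pos_aneg)
  have y: "fst y \<in> W" using x a by (simp add: weyl_comp refl_in_weyl)
  have "pos (x \<star> a)"
  proof (rule ccontr)
    assume "\<not> pos (x \<star> a)"
    then have "pos (y \<star> a)"
      using x a by (simp add: aact_mult refl_in_weyl r_act_self aact_aneg pos_aneg)
    then have "len y < len (y \<odot> r a)" using a y by (intro len_less_mult_r)
    then show False using b(3) a x by (simp add: mult_r_r)
  qed
  then show "fst x \<in> W \<and> (\<exists>a. pos a \<and> pos (x \<star> a) \<and> y = x \<odot> r a)" using x a by blast
next
  assume "fst x \<in> W \<and> (\<exists>a. pos a \<and> pos (x \<star> a) \<and> y = x \<odot> r a)"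
  then obtain a where a: "fst x \<in> W" "pos a" "pos (x \<star> a)" "y = x \<odot> r a" by blast
  then have "len x < len y" using len_less_mult_r by blast
  then show "bruhat_step \<Phi> \<Delta> pr \<iota> x y" unfolding bruhat_step_def
    using a pos_fst[OF a(2)] by (auto intro!: exI[of _ "fst a"] exI[of _ "snd a"])
qed

section \<open>Simple affine roots\<close>

text \<open>Characterised by how the reflection acts, rather than through base roots and highest
  roots of components; existence comes from \<open>simple_descent\<close>.\<close>

definition simple :: "'v \<times> int \<Rightarrow> bool" where
  "simple a \<longleftrightarrow> pos a \<and> (\<forall>b. pos b \<longrightarrow> b \<noteq> a \<longrightarrow> pos (r a \<star> b))"

lemma simple_pos: "simple a \<Longrightarrow> pos a"
  and simple_root: "simple a \<Longrightarrow> fst a \<in> \<Phi>"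
  and simple_permutes: "simple a \<Longrightarrow> pos b \<Longrightarrow> b \<noteq> a \<Longrightarrow> pos (r a \<star> b)"
  unfolding simple_def by (blast intro: pos_fst)+

text \<open>The value 4 is the equality case of Cauchy-Schwarz, where the roots would be
  proportional and, the system being reduced, equal up to sign.\<close>

lemma cart_mult_less_4:
  assumes a: "\<alpha> \<in> \<Phi>" and b: "\<beta> \<in> \<Phi>" and "\<beta> \<noteq> \<alpha>" "\<beta> \<noteq> - \<alpha>"
  shows "cart \<alpha> \<beta> * cart \<beta> \<alpha> < 4"
proof (rule ccontr)
  assume "\<not> ?thesis"
  then have "real_of_int (cart \<alpha> \<beta> * cart \<beta> \<alpha>) \<ge> 4" by linarith
  then have "(coroot \<alpha> \<bullet> \<beta>) * (coroot \<beta> \<bullet> \<alpha>) \<ge> 4"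
    using a b by (simp add: cart Q_root)
  moreover have pa: "\<alpha> \<bullet> \<alpha> > 0" and pb: "\<beta> \<bullet> \<beta> > 0" using a b root_nonzero by auto
  ultimately have "(\<alpha> \<bullet> \<beta>)\<^sup>2 \<ge> (\<alpha> \<bullet> \<alpha>) * (\<beta> \<bullet> \<beta>)"
    by (simp add: coroot_def inner_commute field_simps power2_eq_square)
  then have "(norm \<alpha> * norm \<beta>)\<^sup>2 \<le> (\<alpha> \<bullet> \<beta>)\<^sup>2"
    by (simp add: power_mult_distrib power2_norm_eq_inner)
  then have "\<bar>norm \<alpha> * norm \<beta>\<bar> \<le> \<bar>\<alpha> \<bullet> \<beta>\<bar>" by (simp only: abs_le_square_iff)
  then have "\<bar>\<alpha> \<bullet> \<beta>\<bar> \<ge> norm \<alpha> * norm \<beta>" by simp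
  then have "\<bar>\<alpha> \<bullet> \<beta>\<bar> = norm \<alpha> * norm \<beta>"
    using Cauchy_Schwarz_ineq2[of \<alpha> \<beta>] by linarith
  then have "norm \<alpha> *\<^sub>R \<beta> = norm \<beta> *\<^sub>R \<alpha> \<or> norm \<alpha> *\<^sub>R \<beta> = - norm \<beta> *\<^sub>R \<alpha>"
    by (simp add: norm_cauchy_schwarz_abs_eq)
  then obtain t where "norm \<alpha> *\<^sub>R \<beta> = t *\<^sub>R \<alpha>" by blast
  then have "inverse (norm \<alpha>) *\<^sub>R norm \<alpha> *\<^sub>R \<beta> = inverse (norm \<alpha>) *\<^sub>R t *\<^sub>R \<alpha>" by simp
  then have "\<beta> = (t / norm \<alpha>) *\<^sub>R \<alpha>"
    using root_nonzero[OF a] by (simp add: divide_inverse mult.commute)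
  then show False using reduced[OF a, of "t / norm \<alpha>"] b assms by auto
qed

text \<open>\<open>- refl \<alpha>\<close> is an isometry fixing \<open>\<alpha>\<close>. In
  \<open>simple_descent\<close> this gives \<open>c\<close> the same pairing with \<open>a\<close>
  as \<open>b\<close>, so the two play symmetric roles.\<close>

lemma cart_conj:
  assumes "\<alpha> \<in> \<Phi>" "\<beta> \<in> \<Phi>"
  shows "cart (- refl \<alpha> \<beta>) \<alpha> = cart \<beta> \<alpha>"
proof -
  have "coroot (refl \<alpha> \<beta>) \<bullet> \<alpha> = refl \<alpha> (coroot \<beta>) \<bullet> refl \<alpha> (- \<alpha>)"
    by (simp add: coroot_orthogonal linear_refl refl_uminus)
  moreover have "real_of_int (cart (- refl \<alpha> \<beta>) \<alpha>) = coroot (- refl \<alpha> \<beta>) \<bullet> \<alpha>"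
    using assms by (intro cart) (simp_all add: Q_root refl_root)
  ultimately have "real_of_int (cart (- refl \<alpha> \<beta>) \<alpha>) = real_of_int (cart \<beta> \<alpha>)"
    using assms by (simp add: cart Q_root)
  then show ?thesis by linarith
qed

text \<open>An inversion of minimal height is simple: if \<open>r\<^sub>a\<close> makes another positive root \<open>b\<close>
  negative, then \<open>n a = b + c\<close> with \<open>c\<close> positive and \<open>n \<in> {1, 2, 3}\<close>, and in each case some
  lower positive root is an inversion.\<close>
lemma simple_descent:
  assumes x: "fst x \<in> W" and ne: "ainvs x \<noteq> {}"
  obtains a where "simple a" "\<not> pos (x \<star> a)"
proof -
  obtain a where a: "a \<in> ainvs x" and min: "\<And>b. b \<in> ainvs x \<Longrightarrow> hgt a \<le> hgt b"
    using ex_is_arg_min_if_finite[OF finite_ainvs[OF x] ne, of hgt]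
    by (auto simp: is_arg_min_def not_less)
  have A: "fst a \<in> \<Phi>" "hgt a > 0" "hgt (x \<star> a) < 0" using a x by (auto simp: ainvs_hgt)
  have below: False if "fst d \<in> \<Phi>" "hgt d > 0" "hgt d < hgt a" "hgt (x \<star> d) < 0" for d
    using min[of d] that x by (simp add: ainvs_hgt)
  \<comment> \<open>A decomposition of \<open>a\<close> into positive roots is impossible: one
    summand would be an inversion, and it is lower than \<open>a\<close>.\<close>
  have decomp: False if "fst d \<in> \<Phi>" "fst e \<in> \<Phi>" "hgt d > 0" "hgt e > 0" "hgt d + hgt e = hgt a"
      "hgt (x \<star> d) + hgt (x \<star> e) = hgt (x \<star> a)" for d e
  proof -
    have "hgt (x \<star> d) < 0 \<or> hgt (x \<star> e) < 0" using that A by linarith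
    then show False using below[of d] below[of e] that by auto
  qed
  have "pos (r a \<star> b)" if b: "pos b" "b \<noteq> a" for b
  proof (rule ccontr)
    assume neg: "\<not> pos (r a \<star> b)"
    have B: "fst b \<in> \<Phi>" "hgt b > 0" using b by (auto simp: pos_hgt)
    define n where "n = cart (fst a) (fst b)"
    define m where "m = cart (fst b) (fst a)"
    define c where "c = aneg (r a \<star> b)"
    have C: "fst c \<in> \<Phi>" "hgt c > 0"
      using neg A B not_pos_hgt[of "r a \<star> b"] by (auto simp: c_def refl_root)
    have hc: "hgt c = real_of_int n * hgt a - hgt b"
      using A B by (simp add: c_def hgt_reflect' n_def)
    have hxc: "hgt (x \<star> c) = real_of_int n * hgt (x \<star> a) - hgt (x \<star> b)"
      using A B x by (simp add: c_def aact_aneg refl_root hgt_reflect n_def)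
    have "real_of_int n * hgt a > 0" using hc B C by linarith
    then have npos: "n > 0" using A by (simp add: zero_less_mult_iff)
    have mpos: "m > 0"
    proof -
      have "fst a \<bullet> fst b > 0"
      proof -
        have "real_of_int n > 0" using npos by simp
        then have "coroot (fst a) \<bullet> fst b > 0" using A B by (simp add: n_def cart Q_root)
        moreover have "fst a \<bullet> fst a > 0" using A root_nonzero by simp
        ultimately show ?thesis by (simp add: coroot_def zero_less_mult_iff zero_less_divide_iff)
      qed
      then have "coroot (fst b) \<bullet> fst a > 0" using B root_nonzero[of "fst b"]
        by (simp add: coroot_def inner_commute)
      then have "real_of_int m > 0" using A B by (simp add: m_def cart Q_root)
      then show ?thesis by linarith
    qed
    show False
    proof (cases "fst b = fst a")
      \<comment> \<open>Here \<open>b\<close> and \<open>c = 2a - b\<close> differ from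
        \<open>a\<close> only in level, on opposite sides; the lower of the two is an inversion
        below \<open>a\<close>.\<close>
      case True
      then have "n = 2" using A by (simp add: n_def cart_self)
      then have hc2: "hgt c = 2 * hgt a - hgt b" "hgt (x \<star> c) = 2 * hgt (x \<star> a) - hgt (x \<star> b)"
        using hc hxc by simp_all
      have ne: "snd b \<noteq> snd a" using b True by (metis prod.expand)
      have d: "hgt b - hgt a = hscale * real_of_int (snd b - snd a)"
        "hgt (x \<star> b) - hgt (x \<star> a) = hscale * real_of_int (snd b - snd a)"
        using True by (simp_all add: hgt_def aff_act_def algebra_simps)
      show False
      proof (cases "snd b < snd a")
        case True
        then have "hscale * real_of_int (snd b - snd a) < 0"
          using hscale_pos by (simp add: mult_pos_neg)
        then show False using below[of b] d A B by linarith
      next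
        case False
        then have "hscale * real_of_int (snd b - snd a) > 0"
          using ne hscale_pos by simp
        then show False using below[of c] d hc2 A B C by linarith
      qed
    next
      case False
      have "fst b \<noteq> - fst a"
      proof
        assume "fst b = - fst a"
        then have "n = -2" using A(1) by (simp add: n_def pr_uminus_right Q_root cart_self)
        then show False using npos by simp
      qed
      then have nm: "n * m < 4"
        unfolding n_def m_def using False A B by (intro cart_mult_less_4) auto
      have rb: "hgt (r b \<star> a) = hgt a - real_of_int m * hgt b"
        "hgt (x \<star> r b \<star> a) = hgt (x \<star> a) - real_of_int m * hgt (x \<star> b)"
        "fst (r b \<star> a) \<in> \<Phi>"
        using A B x by (simp_all add: hgt_reflect' hgt_reflect m_def refl_root)
      have "cart (fst c) (fst a) = m"
        using cart_conj[of "fst a" "fst b"] A B by (simp add: c_def m_def)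
      then have rc: "hgt (r c \<star> a) = hgt a - real_of_int m * hgt c"
        "hgt (x \<star> r c \<star> a) = hgt (x \<star> a) - real_of_int m * hgt (x \<star> c)"
        "fst (r c \<star> a) \<in> \<Phi>"
        using A C x by (simp_all add: hgt_reflect' hgt_reflect refl_root)
      have "n = 1 \<or> n \<ge> 2" using npos by linarith
      then show False
      proof
        assume "n = 1"
        then show False using decomp[of b c] hc hxc B C by auto
      next
        assume n2: "n \<ge> 2"
        have m1: "m = 1"
        proof (rule ccontr)
          assume "m \<noteq> 1"
          then have "m \<ge> 2" using mpos by linarith
          then have "2 * 2 \<le> n * m" using n2 by (intro mult_mono) auto
          then show False using nm by simp
        qed
        have n23: "n = 2 \<or> n = 3" using nm n2 m1 by auto
        \<comment> \<open>With \<open>m = 1\<close> these reflected roots are \<open>a - b\<close>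
          and \<open>a - c\<close>; a positive one would decompose \<open>a\<close>.\<close>
        have "\<not> hgt (r b \<star> a) > 0"
          using decomp[of b "r b \<star> a"] rb m1 B by auto
        moreover have "\<not> hgt (r c \<star> a) > 0"
          using decomp[of c "r c \<star> a"] rc m1 C by auto
        moreover have "hgt (r b \<star> a) \<noteq> 0" "hgt (r c \<star> a) \<noteq> 0"
          using not_pos_hgt[OF rb(3)] not_pos_hgt[OF rc(3)] by (auto simp: pos_hgt)
        ultimately have lt: "hgt (r b \<star> a) < 0" "hgt (r c \<star> a) < 0" by linarith+
        have xn: "hgt (x \<star> aneg (r b \<star> a)) = - hgt (x \<star> r b \<star> a)"
          "hgt (x \<star> aneg (r c \<star> a)) = - hgt (x \<star> r c \<star> a)"
          using x rb rc by (simp_all add: aact_aneg)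
        \<comment> \<open>Both \<open>b\<close> and \<open>c\<close> are now higher than
          \<open>a\<close>, while \<open>b + c = n a\<close>: absurd for \<open>n = 2\<close>, and
          for \<open>n = 3\<close> it decomposes \<open>a\<close> as
          \<open>(b - a) + (c - a)\<close>.\<close>
        show False
        proof (cases "n = 2")
          case True
          then show False using lt rb rc m1 hc by simp
        next
          case False
          then have "n = 3" using n23 by simp
          then show False
            using decomp[of "aneg (r b \<star> a)" "aneg (r c \<star> a)"] lt rb rc m1 hc hxc xn by simp
        qed
      qed
    qed
  qed
  then have "simple a" using a by (auto simp: simple_def ainvs_def)
  then show ?thesis using that a by (auto simp: ainvs_def)
qed

text \<open>\<open>r a\<close> changes the sign only of \<open>a\<close> and \<open>aneg a\<close>,
  so applying it after \<open>z\<close> creates the single inversion \<open>b\<close> and destroys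
  none.\<close>

lemma len_r_mult:
  assumes z: "fst z \<in> W" and a: "simple a" and b: "pos b" "z \<star> b = a"
  shows "len (r a \<odot> z) = len z + 1"
proof -
  have A: "fst a \<in> \<Phi>" using a by (rule simple_root)
  have B: "fst b \<in> \<Phi>" using b pos_fst by blast
  have act: "(r a \<odot> z) \<star> c = r a \<star> z \<star> c" if "fst c \<in> \<Phi>" for c
    using z A that by (simp add: aact_mult refl_in_weyl)
  have "ainvs (r a \<odot> z) = insert b (ainvs z)"
  proof (intro set_eqI iffI)
    fix c assume c: "c \<in> ainvs (r a \<odot> z)"
    then have C: "fst c \<in> \<Phi>" "pos c" by (auto simp: ainvs_def pos_fst)
    show "c \<in> insert b (ainvs z)"
    proof (rule ccontr)
      assume n: "c \<notin> insert b (ainvs z)"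
      then have "pos (z \<star> c)" "z \<star> c \<noteq> a" using C b B z by (auto simp: ainvs_def aact_inj)
      then have "pos (r a \<star> z \<star> c)" using a simple_permutes by blast
      then show False using c C by (simp add: ainvs_def act)
    qed
  next
    fix c assume "c \<in> insert b (ainvs z)"
    then consider "c = b" | "pos c" "\<not> pos (z \<star> c)" by (auto simp: ainvs_def)
    then show "c \<in> ainvs (r a \<odot> z)"
    proof cases
      case 1
      then show ?thesis using b B A simple_pos[OF a]
        by (simp add: ainvs_def act r_act_self pos_aneg)
    next
      case 2
      then have C: "fst c \<in> \<Phi>" using pos_fst by blast
      have zc: "fst (z \<star> c) \<in> \<Phi>" using z C by simp
      have "\<not> pos (r a \<star> z \<star> c)"
      proof
        assume p: "pos (r a \<star> z \<star> c)"
        have rr: "r a \<star> r a \<star> z \<star> c = z \<star> c" using A zc by (simp add: r_act_r)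
        show False
        proof (cases "r a \<star> z \<star> c = a")
          case True
          then have "z \<star> c = aneg a" using rr A by (simp add: r_act_self)
          then have "z \<star> aneg c = z \<star> b" using z C b by (simp add: aact_aneg)
          then have "aneg c = b" using z C B by (simp add: aact_inj)
          then show False using 2 b C pos_aneg[of c] by simp
        next
          case False
          then have "pos (z \<star> c)" using simple_permutes[OF a p] rr by simp
          then show False using 2 by simp
        qed
      qed
      then show ?thesis using 2 C by (simp add: ainvs_def act)
    qed
  qed
  moreover have "b \<notin> ainvs z" using b simple_pos[OF a] by (simp add: ainvs_def)
  ultimately show ?thesis using finite_ainvs[OF z] by (simp add: len_ainvs)
qed

section \<open>The semi-infinite order\<close>

text \<open>Differs from the Bruhat step in \<open>bruhat_step_iff\<close> only in that positivity
  is asked of the finite part of \<open>b\<close> instead of \<open>b\<close>.\<close>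

definition sstep :: "('v \<Rightarrow> 'v) \<times> 'x \<Rightarrow> ('v \<Rightarrow> 'v) \<times> 'x \<Rightarrow> bool" where
  "sstep x y \<longleftrightarrow> fst x \<in> W \<and> (\<exists>b. fst b \<in> P \<and> pos (x \<star> b) \<and> y = x \<odot> r b)"

abbreviation sle (infix "\<preceq>" 50) where "x \<preceq> y \<equiv> sstep\<^sup>*\<^sup>* x y"

lemma sstep_E: "sstep x y \<Longrightarrow> fst x \<in> W \<and> fst y \<in> W"
  by (auto simp: sstep_def weyl_comp refl_in_weyl pos_root)

lemma sle_E: "x \<preceq> y \<Longrightarrow> fst x \<in> W \<Longrightarrow> fst y \<in> W"
  by (induction rule: rtranclp_induct) (auto dest: sstep_E)

text \<open>Here \<open>m\<close> is the level of \<open>x \<star> b\<close>, not of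
  \<open>b\<close>: this removes \<open>\<mu>\<close> from the condition and makes steps invariant
  under translation.\<close>

lemma sstep_coords:
  "sstep (w, \<mu>) y \<longleftrightarrow> w \<in> W \<and> (\<exists>\<alpha>\<in>P. \<exists>m\<ge>(if w \<alpha> \<in> P then 0 else 1).
     y = (w \<circ> refl \<alpha>, \<mu> + \<iota> (real_of_int m *\<^sub>R coroot \<alpha>)))" (is "?l \<longleftrightarrow> ?r")
proof
  assume ?l
  then obtain b where w: "w \<in> W" and b: "fst b \<in> P" "pos ((w, \<mu>) \<star> b)" "y = (w, \<mu>) \<odot> r b"
    by (auto simp: sstep_def)
  then have "y = (w \<circ> refl (fst b), \<mu> + \<iota> (real_of_int (snd ((w, \<mu>) \<star> b)) *\<^sub>R coroot (fst b)))"
    using mult_r[of "(w, \<mu>)" b] by (simp add: pos_root)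
  moreover have "snd ((w, \<mu>) \<star> b) \<ge> (if w (fst b) \<in> P then 0 else 1)"
    using b w neg_iff[of "w (fst b)"] by (auto simp: aff_pos_def pos_root)
  ultimately show ?r using w b by blast
next
  assume ?r
  then obtain \<alpha> m where w: "w \<in> W" and a: "\<alpha> \<in> P" "m \<ge> (if w \<alpha> \<in> P then 0 else 1)"
    and y: "y = (w \<circ> refl \<alpha>, \<mu> + \<iota> (real_of_int m *\<^sub>R coroot \<alpha>))" by blast
  let ?b = "(\<alpha>, m + pr \<mu> \<alpha>)"
  have xb: "(w, \<mu>) \<star> ?b = (w \<alpha>, m)" by (simp add: aff_act_def)
  have "pos (w \<alpha>, m)" using a w neg_iff[of "w \<alpha>"] by (auto simp: aff_pos_def pos_root)
  moreover have "y = (w, \<mu>) \<odot> r ?b"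
    using mult_r[of "(w, \<mu>)" ?b] w a y xb by (simp add: pos_root)
  ultimately show ?l unfolding sstep_def using w a xb by (intro conjI exI[of _ ?b]) auto
qed

text \<open>Only the finite part of \<open>a\<close> enters; for positive \<open>a\<close> it
  decides whether left multiplication by \<open>r a\<close> goes up or down in the semi-infinite
  order.\<close>

abbreviation up :: "'v \<times> int \<Rightarrow> ('v \<Rightarrow> 'v) \<times> 'x \<Rightarrow> bool" where
  "up a x \<equiv> inv (fst x) (fst a) \<in> P"

lemma up_r_mult:
  assumes "fst x \<in> W" "fst a \<in> \<Phi>"
  shows "up a (r a \<odot> x) \<longleftrightarrow> \<not> up a x"
proof -
  have "inv (refl (fst a) \<circ> fst x) (fst a) = - inv (fst x) (fst a)"
    using assms by (simp add: o_inv_distrib weyl_bij[OF refl_in_weyl] weyl_bij weyl_uminus[OF weyl_inv])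
  then show ?thesis using assms neg_iff[of "inv (fst x) (fst a)"] by (simp add: weyl_inv)
qed

lemma sstep_r_mult:
  assumes x: "fst x \<in> W" and a: "pos a" and up: "up a x"
  shows "sstep x (r a \<odot> x)"
proof -
  let ?b = "ainv x \<star> a"
  have A: "fst a \<in> \<Phi>" using a by (rule pos_fst)
  then have eq: "x \<star> ?b = a" using x by (simp add: aact_ainv)
  have "x \<odot> r ?b = r a \<odot> x" using mult_r_conj[of x ?b] x A eq by (simp add: weyl_inv)
  then show ?thesis unfolding sstep_def using x up a eq by (intro conjI exI[of _ ?b]) simp_all
qed

lemma sstep_r_mult_down:
  assumes "fst x \<in> W" "pos a" "\<not> up a x"
  shows "sstep (r a \<odot> x) x"
  using sstep_r_mult[of "r a \<odot> x" a] assms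
  by (simp add: up_r_mult[OF _ pos_fst, simplified] weyl_comp refl_in_weyl pos_fst r_r_mult)

text \<open>A simple reflection keeps \<open>x \<star> b\<close> positive unless that root is
  \<open>a\<close>, and then the step is left multiplication by \<open>r a\<close>.\<close>

lemma sstep_left:
  assumes s: "sstep x y" and a: "simple a"
  shows "y = r a \<odot> x \<or> sstep (r a \<odot> x) (r a \<odot> y)"
proof -
  obtain b where x: "fst x \<in> W" and b: "fst b \<in> P" "pos (x \<star> b)" "y = x \<odot> r b"
    using s by (auto simp: sstep_def)
  have A: "fst a \<in> \<Phi>" and B: "fst b \<in> \<Phi>" using a b by (auto simp: simple_root pos_root)
  show ?thesis
  proof (cases "x \<star> b = a")
    case True
    then show ?thesis using mult_r_conj[OF x B] b by simp
  next
    case False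
    then have "pos (r a \<star> x \<star> b)" using a b simple_permutes by blast
    then have "pos ((r a \<odot> x) \<star> b)" using x A B by (simp add: aact_mult refl_in_weyl)
    moreover have "r a \<odot> y = r a \<odot> x \<odot> r b"
      using b x A B by (simp add: mult_assoc refl_in_weyl)
    ultimately have "sstep (r a \<odot> x) (r a \<odot> y)"
      unfolding sstep_def using x A b by (intro conjI exI[of _ b]) (simp_all add: weyl_comp refl_in_weyl)
    then show ?thesis by simp
  qed
qed

text \<open>The disjunction avoids up/down hypotheses, which intermediate elements of the chain
  could violate; a step that is itself \<open>r a\<close> swaps the two alternatives.\<close>

lemma sle_left_lift:
  assumes "x \<preceq> y" and x: "fst x \<in> W" and a: "simple a"
  shows "r a \<odot> x \<preceq> r a \<odot> y \<or> r a \<odot> x \<preceq> y \<and> x \<preceq> r a \<odot> y"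
  using assms(1)
proof (induction rule: rtranclp_induct)
  case (step y z)
  have y: "fst y \<in> W" using step sstep_E by blast
  from sstep_left[OF step(2) a] show ?case
  proof
    assume z: "z = r a \<odot> y"
    then have "r a \<odot> z = y" using y a simple_root by (simp add: r_r_mult)
    then show ?thesis using step z by auto
  next
    assume "sstep (r a \<odot> y) (r a \<odot> z)"
    then show ?thesis using step by (meson rtranclp.rtrancl_into_rtrancl)
  qed
qed simp

lemma sle_lift_up_down:
  assumes "x \<preceq> y" "fst x \<in> W" "simple a" "up a x" "\<not> up a y"
  shows "x \<preceq> r a \<odot> y"
proof -
  have "sstep x (r a \<odot> x)" using assms simple_pos sstep_r_mult by blast
  then show ?thesis using sle_left_lift[OF assms(1-3)] by (meson converse_rtranclp_into_rtranclp)
qed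

lemma sle_lift_down_down:
  assumes "x \<preceq> y" "fst x \<in> W" "simple a" "\<not> up a x"
  shows "r a \<odot> x \<preceq> r a \<odot> y"
proof -
  have "sstep (r a \<odot> x) x" using assms simple_pos sstep_r_mult_down by blast
  then show ?thesis using sle_left_lift[OF assms(1-3)] by (meson converse_rtranclp_into_rtranclp)
qed

subsection \<open>Deep dominant translates\<close>

definition shift :: "nat \<Rightarrow> ('v \<Rightarrow> 'v) \<times> 'x \<Rightarrow> ('v \<Rightarrow> 'v) \<times> 'x" where
  "shift n x = (fst x, snd x + \<iota> (real n *\<^sub>R two_rho_check))"

lemma fst_shift [simp]: "fst (shift n x) = fst x"
  by (simp add: shift_def)

lemma two_rho_check_L: "two_rho_check \<in> L"
  unfolding two_rho_check_def by (intro L_sum L_coroot pos_root)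

lemma nat_two_rho_check_L: "real n *\<^sub>R two_rho_check \<in> L"
  using L_scale[OF two_rho_check_L, of "int n"] by simp

abbreviation cht :: "'v \<Rightarrow> int" where "cht \<beta> \<equiv> pr (\<iota> two_rho_check) \<beta>"

lemma cht: "\<beta> \<in> Q \<Longrightarrow> real_of_int (cht \<beta>) = two_rho_check \<bullet> \<beta>"
  by (simp add: pr_\<iota> two_rho_check_L)

lemma cht_pos: "\<beta> \<in> P \<Longrightarrow> cht \<beta> \<ge> 1"
  using cht[of \<beta>] two_rho_check_pos[of \<beta>] by (simp add: Q_root pos_root)

lemma pr_shift: "\<beta> \<in> Q \<Longrightarrow> pr (snd (shift n x)) \<beta> = pr (snd x) \<beta> + int n * cht \<beta>"
proof -
  assume b: "\<beta> \<in> Q"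
  have "real_of_int (pr (\<iota> (real n *\<^sub>R two_rho_check)) \<beta>) = real_of_int (int n * cht \<beta>)"
    using b by (simp add: pr_\<iota> nat_two_rho_check_L cht)
  then have "pr (\<iota> (real n *\<^sub>R two_rho_check)) \<beta> = int n * cht \<beta>" by linarith
  then show ?thesis using b by (simp add: shift_def pr_add)
qed

lemma shift_mult: "fst x \<in> W \<Longrightarrow> x \<odot> shift n y = shift n (x \<odot> y)"
  by (simp add: shift_def aff_mult_def add.assoc)

lemma shift_dominant:
  "\<exists>N. \<forall>n\<ge>N. \<forall>\<beta>\<in>P. pr (snd (shift n x)) \<beta> \<ge> 1"
proof (intro exI[of _ "nat (1 + (\<Sum>\<beta>\<in>P. \<bar>pr (snd x) \<beta>\<bar>))"] allI impI ballI)
  fix n \<beta> assume n: "nat (1 + (\<Sum>\<beta>\<in>P. \<bar>pr (snd x) \<beta>\<bar>)) \<le> n" and b: "\<beta> \<in> P"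
  have "\<bar>pr (snd x) \<beta>\<bar> \<le> (\<Sum>\<beta>\<in>P. \<bar>pr (snd x) \<beta>\<bar>)"
    using b finite_pos by (intro member_le_sum) auto
  then have "int n \<ge> 1 + \<bar>pr (snd x) \<beta>\<bar>" using n by linarith
  moreover have "int n * 1 \<le> int n * cht \<beta>" using cht_pos[OF b] by (intro mult_left_mono) auto
  ultimately show "pr (snd (shift n x)) \<beta> \<ge> 1" using b by (simp add: pr_shift Q_root pos_root)
qed

abbreviation bstep where "bstep \<equiv> bruhat_step \<Phi> \<Delta> pr \<iota>"

lemma sstep_shift_bstep:
  assumes "sstep x y"
  shows "\<exists>N. \<forall>n\<ge>N. bstep (shift n x) (shift n y)"
proof -
  obtain b where x: "fst x \<in> W" and b: "fst b \<in> P" "pos (x \<star> b)" "y = x \<odot> r b"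
    using assms by (auto simp: sstep_def)
  have B: "fst b \<in> \<Phi>" using b pos_root by blast
  show ?thesis
  proof (intro exI[of _ "nat \<bar>snd b\<bar>"] allI impI)
    fix n assume n: "nat \<bar>snd b\<bar> \<le> n"
    \<comment> \<open>The level is raised so that its image under the shifted \<open>x\<close> is
      still \<open>x \<star> b\<close>; as the finite part is positive, a large \<open>n\<close>
      makes the root itself positive.\<close>
    let ?b = "(fst b, snd b + int n * cht (fst b))"
    have "int n * 1 \<le> int n * cht (fst b)" using cht_pos[OF b(1)] by (intro mult_left_mono) auto
    then have "snd ?b \<ge> 0" using n by simp
    then have p: "pos ?b" using b B neg_iff[of "fst b"] by (simp add: aff_pos_def)
    have eq: "shift n x \<star> ?b = x \<star> b"
      using B by (simp add: aff_act_def pr_shift Q_root)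
    have "shift n y = shift n x \<odot> r ?b"
      using mult_r[of "shift n x" ?b] mult_r[of x b] x B b(3) unfolding eq
      by (simp add: shift_def algebra_simps)
    then show "bstep (shift n x) (shift n y)"
      unfolding bruhat_step_iff using x p b eq by (intro conjI exI[of _ ?b]) simp_all
  qed
qed

lemma sle_shift_bruhat:
  assumes "x \<preceq> y"
  shows "\<exists>N. \<forall>n\<ge>N. bruhat_le \<Phi> \<Delta> pr \<iota> (shift n x) (shift n y)"
  using assms
proof (induction rule: rtranclp_induct)
  case base
  then show ?case by (simp add: bruhat_le_def)
next
  case (step y z)
  then obtain N M where "\<forall>n\<ge>N. bruhat_le \<Phi> \<Delta> pr \<iota> (shift n x) (shift n y)"
    "\<forall>n\<ge>M. bstep (shift n y) (shift n z)" using sstep_shift_bstep by blast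
  then show ?case unfolding bruhat_le_def
    by (intro exI[of _ "max N M"]) (auto intro: rtranclp.rtrancl_into_rtrancl)
qed

subsection \<open>Semi-infinite length\<close>

abbreviation rho2 :: 'v where "rho2 \<equiv> two_rho \<Phi> \<Delta>"

lemma rho2_Q: "rho2 \<in> Q"
  unfolding two_rho_def by (intro Q_sum Q_root pos_root)

definition slen :: "('v \<Rightarrow> 'v) \<times> 'x \<Rightarrow> int" where
  "slen x = int (card (finv (fst x))) + pr (snd x) rho2"

lemma slen_shift: "slen (shift n x) = slen x + int n * cht rho2"
  by (simp add: slen_def pr_shift rho2_Q)

text \<open>Each positive root contributes an interval of levels starting at 0, of length its
  pairing with the translation plus one if \<open>fst x\<close> makes it negative; negative roots
  contribute nothing.\<close>

lemma len_dominant: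
  assumes x: "fst x \<in> W" and dom: "\<forall>\<beta>\<in>P. pr (snd x) \<beta> \<ge> 1"
  shows "int (len x) = slen x"
proof -
  let ?f = "\<lambda>\<alpha>. pr (snd x) \<alpha> + (if fst x \<alpha> \<in> P then 0 else 1)"
  have "ainvs x = (SIGMA \<alpha>:P. {0..<?f \<alpha>})"
  proof (intro set_eqI iffI)
    fix a assume "a \<in> ainvs x"
    then have p: "pos a" and np: "\<not> pos (x \<star> a)" by (auto simp: ainvs_def)
    have A: "fst a \<in> \<Phi>" using p pos_fst by blast
    have "fst a \<in> P"
    proof (rule ccontr)
      assume "fst a \<notin> P"
      then have n: "- fst a \<in> P" using A by (simp add: neg_iff)
      then have "pr (snd x) (- fst a) \<ge> 1" "snd a \<ge> 1" using dom p by (auto simp: aff_pos_def)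
      then have "pos (x \<star> a)" using x A by (simp add: aff_pos_def aff_act_def pr_uminus_right Q_root)
      then show False using np by simp
    qed
    then show "a \<in> (SIGMA \<alpha>:P. {0..<?f \<alpha>})"
      using p np A x neg_iff[of "fst a"] neg_iff[of "fst x (fst a)"]
      by (cases a) (auto simp: aff_pos_def aff_act_def split: if_splits)
  next
    fix a assume "a \<in> (SIGMA \<alpha>:P. {0..<?f \<alpha>})"
    then show "a \<in> ainvs x"
      using x neg_iff[of "fst a"] neg_iff[of "fst x (fst a)"] pos_root[of "fst a"]
      by (cases a) (auto simp: ainvs_def aff_pos_def aff_act_def split: if_splits)
  qed
  then have "int (len x) = (\<Sum>\<alpha>\<in>P. int (nat (?f \<alpha>)))"
    using finite_pos by (simp add: len_ainvs)
  also have "\<dots> = (\<Sum>\<alpha>\<in>P. ?f \<alpha>)"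
    using dom by (intro sum.cong) (auto split: if_splits)
  also have "\<dots> = pr (snd x) rho2 + (\<Sum>\<alpha>\<in>P. if fst x \<alpha> \<in> P then 0 else 1)"
    by (simp add: sum.distrib two_rho_def pr_sum Q_root pos_root)
  also have "(\<Sum>\<alpha>\<in>P. if fst x \<alpha> \<in> P then 0 else 1) = int (card (finv (fst x)))"
    by (subst sum.mono_neutral_cong_right[of P "finv (fst x)" _ "\<lambda>_. 1"])
      (auto simp: finv_def finite_pos)
  finally show ?thesis by (simp add: slen_def)
qed

text \<open>Bruhat steps raise \<open>len\<close>; for large \<open>n\<close> both shifts are
  dominant, where \<open>len\<close> is \<open>slen\<close>, and shifting adds the same amount to
  both.\<close>

lemma slen_sstep:
  assumes "sstep x y"
  shows "slen x < slen y"
proof -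
  obtain N1 N2 N3 where
    "\<forall>n\<ge>N1. bstep (shift n x) (shift n y)"
    "\<forall>n\<ge>N2. \<forall>\<beta>\<in>P. pr (snd (shift n x)) \<beta> \<ge> 1"
    "\<forall>n\<ge>N3. \<forall>\<beta>\<in>P. pr (snd (shift n y)) \<beta> \<ge> 1"
    using sstep_shift_bstep[OF assms] shift_dominant by metis
  then obtain n where n: "bstep (shift n x) (shift n y)"
    "\<forall>\<beta>\<in>P. pr (snd (shift n x)) \<beta> \<ge> 1" "\<forall>\<beta>\<in>P. pr (snd (shift n y)) \<beta> \<ge> 1"
    by (metis max.cobounded1 max.cobounded2 max.coboundedI2)
  then have "len (shift n x) < len (shift n y)"
    by (auto simp: bruhat_step_def)
  then have "slen (shift n x) < slen (shift n y)"
    using len_dominant[of "shift n x"] len_dominant[of "shift n y"] sstep_E[OF assms] n by simp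
  then show ?thesis by (simp add: slen_shift)
qed

lemma slen_sle: "x \<preceq> y \<Longrightarrow> slen x \<le> slen y"
  by (induction rule: rtranclp_induct) (auto dest: slen_sstep)

text \<open>The same passage to dominant shifts, with \<open>len_r_mult\<close> giving the exact
  increase.\<close>

lemma slen_up:
  assumes x: "fst x \<in> W" and a: "simple a" and up: "up a x"
  shows "slen (r a \<odot> x) = slen x + 1"
proof -
  let ?b = "ainv x \<star> a"
  have A: "fst a \<in> \<Phi>" using a by (rule simple_root)
  have B: "fst ?b \<in> P" using up by simp
  have eq: "x \<star> ?b = a" using x A by (simp add: aact_ainv)
  have y: "fst (r a \<odot> x) \<in> W" using x A by (simp add: weyl_comp refl_in_weyl)
  obtain N2 N3 where
    N: "\<forall>n\<ge>N2. \<forall>\<beta>\<in>P. pr (snd (shift n x)) \<beta> \<ge> 1"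
    "\<forall>n\<ge>N3. \<forall>\<beta>\<in>P. pr (snd (shift n (r a \<odot> x))) \<beta> \<ge> 1"
    using shift_dominant by metis
  define n where "n = max (nat \<bar>snd ?b\<bar>) (max N2 N3)"
  let ?c = "(fst ?b, snd ?b + int n * cht (fst ?b))"
  have n: "\<forall>\<beta>\<in>P. pr (snd (shift n x)) \<beta> \<ge> 1" "\<forall>\<beta>\<in>P. pr (snd (shift n (r a \<odot> x))) \<beta> \<ge> 1"
    using N by (auto simp: n_def)
  have "int n * 1 \<le> int n * cht (fst ?b)" using cht_pos[OF B] by (intro mult_left_mono) auto
  moreover have "int n \<ge> \<bar>snd ?b\<bar>" by (simp add: n_def)
  ultimately have "snd ?c \<ge> 0" by simp
  then have "pos ?c" using B pos_root[OF B] neg_iff[of "fst ?b"] by (simp add: aff_pos_def)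
  moreover have "shift n x \<star> ?c = x \<star> ?b"
    using pos_root[OF B] by (simp add: aff_act_def[of _ "shift n x"] pr_shift Q_root)
      (simp add: aff_act_def)
  ultimately have "len (r a \<odot> shift n x) = len (shift n x) + 1"
    using x a eq by (intro len_r_mult[of _ _ ?c]) simp_all
  then have "len (shift n (r a \<odot> x)) = len (shift n x) + 1"
    using A by (simp add: shift_mult refl_in_weyl)
  then have "slen (shift n (r a \<odot> x)) = slen (shift n x) + 1"
    using len_dominant[of "shift n x"] len_dominant[of "shift n (r a \<odot> x)"] n x y by simp
  then show ?thesis by (simp add: slen_shift)
qed

lemma slen_down:
  assumes "fst x \<in> W" "simple a" "\<not> up a x"
  shows "slen (r a \<odot> x) = slen x - 1"
  using slen_up[of "r a \<odot> x" a] assms up_r_mult[of x a] simple_root[of a]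
  by (simp add: weyl_comp refl_in_weyl r_r_mult)

subsection \<open>Chains of covers\<close>

definition scover :: "('v \<Rightarrow> 'v) \<times> 'x \<Rightarrow> ('v \<Rightarrow> 'v) \<times> 'x \<Rightarrow> bool" where
  "scover x y \<longleftrightarrow> sstep x y \<and> slen y = slen x + 1"

lemma scover_up: "fst x \<in> W \<Longrightarrow> simple a \<Longrightarrow> up a x \<Longrightarrow> scover x (r a \<odot> x)"
  by (simp add: scover_def sstep_r_mult simple_pos slen_up)

text \<open>\<open>r a\<close> is pushed through the chain. The critical cover is one turning from
  up to down: lengths force it to be \<open>r a\<close> itself, and the moved chain then already
  ends at its target.\<close>

lemma scover_chain_left:
  assumes "scover\<^sup>*\<^sup>* u z" and u: "fst u \<in> W" "up a u" and a: "simple a"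
  shows "(up a z \<longrightarrow> scover\<^sup>*\<^sup>* (r a \<odot> u) (r a \<odot> z)) \<and> (\<not> up a z \<longrightarrow> scover\<^sup>*\<^sup>* (r a \<odot> u) z)"
  using assms(1)
proof (induction rule: rtranclp_induct)
  case base
  then show ?case using u by simp
next
  case (step y z)
  have y: "fst y \<in> W" and z: "fst z \<in> W" and yz: "sstep y z" and l: "slen z = slen y + 1"
    using step(2) sstep_E[of y z] unfolding scover_def by blast+
  have flip: "up a z \<longleftrightarrow> \<not> up a y" if "z = r a \<odot> y"
    using that up_r_mult[OF y simple_root[OF a]] by simp
  consider "up a y" "up a z" | "up a y" "\<not> up a z" | "\<not> up a y" "up a z" | "\<not> up a y" "\<not> up a z"
    by blast
  then show ?case
  proof cases
    case 1
    then have "sstep (r a \<odot> y) (r a \<odot> z)" using sstep_left[OF yz a] flip by blast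
    then have "scover (r a \<odot> y) (r a \<odot> z)"
      using slen_up[OF y a] slen_up[OF z a] l 1 by (simp add: scover_def)
    then show ?thesis using step 1 by (auto intro: rtranclp.rtrancl_into_rtrancl)
  next
    case 2
    \<comment> \<open>Otherwise the reflected step would have to lower \<open>slen\<close> by
      one.\<close>
    have "z = r a \<odot> y"
    proof (rule ccontr)
      assume "z \<noteq> r a \<odot> y"
      then have "sstep (r a \<odot> y) (r a \<odot> z)" using sstep_left[OF yz a] by blast
      then show False using slen_sstep[of "r a \<odot> y" "r a \<odot> z"] slen_up[OF y a] slen_down[OF z a] 2 l by simp
    qed
    then show ?thesis using step.IH 2 by metis
  next
    case 3
    then have "scover\<^sup>*\<^sup>* (r a \<odot> u) z" using step by (auto intro: rtranclp.rtrancl_into_rtrancl)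
    then show ?thesis using scover_up[OF z a] 3 by (auto intro: rtranclp.rtrancl_into_rtrancl)
  next
    case 4
    then show ?thesis using step by (auto intro: rtranclp.rtrancl_into_rtrancl)
  qed
qed

subsection \<open>The dominance order\<close>

abbreviation le :: "'x \<Rightarrow> 'x \<Rightarrow> bool" where "le \<equiv> coweight_le \<Phi> \<Delta> \<iota>"

lemma nat_comb_L: "S \<subseteq> P \<Longrightarrow> (\<Sum>\<alpha>\<in>S. real (c \<alpha>) *\<^sub>R coroot \<alpha>) \<in> L"
  using L_scale_coroot[OF pos_root, of _ "int (c _)"] by (intro L_sum) auto

lemma le_refl [simp]: "le \<mu> \<mu>"
  by (auto simp: coweight_le_def intro!: exI[of _ "\<lambda>_. 0"])

lemma le_trans: "le \<mu> \<nu> \<Longrightarrow> le \<nu> \<kappa> \<Longrightarrow> le \<mu> \<kappa>"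
proof -
  assume "le \<mu> \<nu>" "le \<nu> \<kappa>"
  then obtain c d where "\<nu> - \<mu> = \<iota> (\<Sum>\<alpha>\<in>P. real (c \<alpha>) *\<^sub>R coroot \<alpha>)"
    "\<kappa> - \<nu> = \<iota> (\<Sum>\<alpha>\<in>P. real (d \<alpha>) *\<^sub>R coroot \<alpha>)"
    by (auto simp: coweight_le_def)
  then have "(\<nu> - \<mu>) + (\<kappa> - \<nu>) = \<iota> (\<Sum>\<alpha>\<in>P. real (c \<alpha> + d \<alpha>) *\<^sub>R coroot \<alpha>)"
    by (simp add: \<iota>_add[symmetric] nat_comb_L sum.distrib scaleR_add_left)
  then show ?thesis unfolding coweight_le_def by (intro exI[of _ "\<lambda>\<alpha>. c \<alpha> + d \<alpha>"]) simp
qed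

lemma le_diff_cong: "\<nu> - \<mu> = \<nu>' - \<mu>' \<Longrightarrow> le \<mu> \<nu> \<Longrightarrow> le \<mu>' \<nu>'"
  by (simp add: coweight_le_def)

lemma le_coroot:
  assumes "\<alpha> \<in> P" "m \<ge> 0"
  shows "le \<mu> (\<mu> + \<iota> (real_of_int m *\<^sub>R coroot \<alpha>))"
proof -
  have "(\<Sum>\<beta>\<in>P. real (if \<beta> = \<alpha> then nat m else 0) *\<^sub>R coroot \<beta>) = real_of_int m *\<^sub>R coroot \<alpha>"
    using assms finite_pos
    by (simp add: if_distrib[of real] if_distrib[of "\<lambda>c. c *\<^sub>R _"] cong: if_cong)
  then show ?thesis unfolding coweight_le_def
    by (intro exI[of _ "\<lambda>\<beta>. if \<beta> = \<alpha> then nat m else 0"]) simp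
qed

lemma sle_le: "x \<preceq> y \<Longrightarrow> le (snd x) (snd y)"
proof (induction rule: rtranclp_induct)
  case (step y z)
  obtain w \<mu> where y: "y = (w, \<mu>)" by fastforce
  obtain \<alpha> m where "\<alpha> \<in> P" "m \<ge> (if w \<alpha> \<in> P then 0 else 1)"
    "z = (w \<circ> refl \<alpha>, \<mu> + \<iota> (real_of_int m *\<^sub>R coroot \<alpha>))"
    using step(2) unfolding y sstep_coords by blast
  then have "le (snd y) (snd z)" using le_coroot[of \<alpha> m \<mu>] y by (auto split: if_splits)
  then show ?case using step le_trans by blast
qed simp

lemma sstep_translate:
  "sstep (w, \<mu>) (w', \<mu>') \<Longrightarrow> sstep (w, \<mu> + \<kappa>) (w', \<mu>' + \<kappa>)"
  unfolding sstep_coords by (fastforce simp: algebra_simps)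

lemma sle_translate: "x \<preceq> y \<Longrightarrow> (fst x, snd x + \<kappa>) \<preceq> (fst y, snd y + \<kappa>)"
proof (induction rule: rtranclp_induct)
  case (step y z)
  then show ?case
    using sstep_translate[of "fst y" "snd y" "fst z" "snd z" \<kappa>]
    by (simp add: rtranclp.rtrancl_into_rtrancl)
qed simp

text \<open>Reflect twice along \<open>\<alpha>\<close>: exactly one of \<open>w\<close> and
  \<open>w \<circ> refl \<alpha>\<close> sends \<open>\<alpha>\<close> to a positive root, so the
  least levels 0 and 1 occur once each and add up to 1.\<close>

lemma sle_add_coroot:
  assumes w: "w \<in> W" and a: "\<alpha> \<in> P"
  shows "\<exists>y. sstep (w, \<mu>) y \<and> sstep y (w, \<mu> + \<iota> (coroot \<alpha>))"
proof -
  let ?m = "if w \<alpha> \<in> P then 0 else 1 :: int"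
  let ?y = "(w \<circ> refl \<alpha>, \<mu> + \<iota> (real_of_int ?m *\<^sub>R coroot \<alpha>))"
  have A: "\<alpha> \<in> \<Phi>" using a pos_root by blast
  have "sstep (w, \<mu>) ?y" unfolding sstep_coords using w a by blast
  moreover have neg: "(w \<circ> refl \<alpha>) \<alpha> \<in> P \<longleftrightarrow> w \<alpha> \<notin> P"
    using w A neg_iff[of "w \<alpha>"] by (simp add: weyl_uminus)
  have "sstep ?y (w, \<mu> + \<iota> (coroot \<alpha>))" unfolding sstep_coords
  proof (intro conjI bexI[of _ \<alpha>] exI[of _ "1 - ?m"])
    show "w \<circ> refl \<alpha> \<in> W" using w A by (simp add: weyl_comp refl_in_weyl)
    show "(if (w \<circ> refl \<alpha>) \<alpha> \<in> P then 0 else 1) \<le> 1 - ?m" unfolding neg by auto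
    show "(w, \<mu> + \<iota> (coroot \<alpha>)) = (w \<circ> refl \<alpha> \<circ> refl \<alpha>,
        \<mu> + \<iota> (real_of_int ?m *\<^sub>R coroot \<alpha>) + \<iota> (real_of_int (1 - ?m) *\<^sub>R coroot \<alpha>))"
      by (simp add: comp_assoc)
  qed (rule a)
  ultimately show ?thesis by blast
qed

text \<open>Read off from the strict growth of \<open>slen\<close> along the two steps of
  \<open>sle_add_coroot\<close>.\<close>

lemma cart_rho2_pos:
  assumes "\<alpha> \<in> P"
  shows "cart \<alpha> rho2 > 0"
proof -
  obtain y where "sstep (id, 0) y" "sstep y (id, 0 + \<iota> (coroot \<alpha>))"
    using sle_add_coroot[OF id_in_weyl assms, of 0] by blast
  then have "slen (id, 0) < slen y" "slen y < slen (id, 0 + \<iota> (coroot \<alpha>))" by (simp_all only: slen_sstep)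
  then show ?thesis by (simp add: slen_def pr_zero rho2_Q)
qed

lemma sle_add_nat_coroot:
  assumes w: "w \<in> W" and a: "\<alpha> \<in> P"
  shows "(w, \<mu>) \<preceq> (w, \<mu> + \<iota> (real n *\<^sub>R coroot \<alpha>))"
proof (induction n)
  case (Suc n)
  have "real n *\<^sub>R coroot \<alpha> \<in> L" using L_scale_coroot[OF pos_root[OF a], of "int n"] by simp
  then have eq: "\<mu> + \<iota> (real (Suc n) *\<^sub>R coroot \<alpha>) = \<mu> + \<iota> (real n *\<^sub>R coroot \<alpha>) + \<iota> (coroot \<alpha>)"
    using a by (simp add: scaleR_add_left \<iota>_add L_coroot pos_root add_ac)
  show ?case unfolding eq
    using Suc sle_add_coroot[OF w a, of "\<mu> + \<iota> (real n *\<^sub>R coroot \<alpha>)"]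
    by (meson rtranclp.rtrancl_into_rtrancl)
qed simp

lemma sle_mono:
  assumes w: "w \<in> W" and "le \<mu> \<nu>"
  shows "(w, \<mu>) \<preceq> (w, \<nu>)"
proof -
  obtain c where c: "\<nu> - \<mu> = \<iota> (\<Sum>\<alpha>\<in>P. real (c \<alpha>) *\<^sub>R coroot \<alpha>)"
    using assms by (auto simp: coweight_le_def)
  have "(w, \<mu>) \<preceq> (w, \<mu> + \<iota> (\<Sum>\<alpha>\<in>S. real (c \<alpha>) *\<^sub>R coroot \<alpha>))" if "S \<subseteq> P" for S
    using finite_subset[OF that finite_pos] that
  proof (induction S)
    case (insert \<alpha> S)
    have "real (c \<alpha>) *\<^sub>R coroot \<alpha> \<in> L"
      using L_scale_coroot[of \<alpha> "int (c \<alpha>)"] insert pos_root by auto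
    then have eq: "\<mu> + \<iota> (\<Sum>\<alpha>\<in>insert \<alpha> S. real (c \<alpha>) *\<^sub>R coroot \<alpha>)
        = \<mu> + \<iota> (\<Sum>\<alpha>\<in>S. real (c \<alpha>) *\<^sub>R coroot \<alpha>) + \<iota> (real (c \<alpha>) *\<^sub>R coroot \<alpha>)"
      using insert by (simp add: \<iota>_add nat_comb_L add_ac)
    show ?case unfolding eq using insert sle_add_nat_coroot[OF w]
      by (meson insert_subset rtranclp_trans)
  qed simp
  from this[of P] show ?thesis using c by (simp add: algebra_simps)
qed

text \<open>\<open>rho2\<close> is strictly positive on positive coroots, so a nonnegative
  combination of them that does not raise the pairing is zero.\<close>

lemma le_antisym_rho2:
  assumes "le \<mu> \<nu>" "pr \<nu> rho2 \<le> pr \<mu> rho2"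
  shows "\<mu> = \<nu>"
proof -
  obtain c where c: "\<nu> - \<mu> = \<iota> (\<Sum>\<alpha>\<in>P. real (c \<alpha>) *\<^sub>R coroot \<alpha>)"
    using assms by (auto simp: coweight_le_def)
  have "real_of_int (pr (\<nu> - \<mu>) rho2) = (\<Sum>\<alpha>\<in>P. real (c \<alpha>) * (coroot \<alpha> \<bullet> rho2))"
    unfolding c by (simp add: pr_\<iota> nat_comb_L rho2_Q inner_sum_left)
  also have "\<dots> = (\<Sum>\<alpha>\<in>P. real (c \<alpha>) * real_of_int (cart \<alpha> rho2))"
    by (intro sum.cong) (simp_all add: cart rho2_Q pos_root)
  finally have "(\<Sum>\<alpha>\<in>P. real (c \<alpha>) * real_of_int (cart \<alpha> rho2)) \<le> 0"
    using assms by (simp add: pr_diff rho2_Q)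
  moreover have nn: "\<forall>\<alpha>\<in>P. real (c \<alpha>) * real_of_int (cart \<alpha> rho2) \<ge> 0"
    using cart_rho2_pos by (simp add: less_imp_le)
  ultimately have "(\<Sum>\<alpha>\<in>P. real (c \<alpha>) * real_of_int (cart \<alpha> rho2)) = 0"
    by (meson antisym sum_nonneg)
  then have "\<forall>\<alpha>\<in>P. real (c \<alpha>) * real_of_int (cart \<alpha> rho2) = 0"
    using nn finite_pos by (subst (asm) sum_nonneg_eq_0_iff) auto
  then have "\<forall>\<alpha>\<in>P. c \<alpha> = 0" using cart_rho2_pos by fastforce
  then have "(\<Sum>\<alpha>\<in>P. real (c \<alpha>) *\<^sub>R coroot \<alpha>) = 0" by (intro sum.neutral) simp
  then show ?thesis using c by simp
qed

section \<open>Existence of minimal weights\<close>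

text \<open>The chain of covers will become a path of the quantum Bruhat graph; the lower bound
  ranges over all semi-infinite relations, hence over all paths.\<close>

definition has_min :: "('v \<Rightarrow> 'v) \<times> 'x \<Rightarrow> ('v \<Rightarrow> 'v) \<Rightarrow> bool" where
  "has_min x w' \<longleftrightarrow> (\<exists>\<nu>. scover\<^sup>*\<^sup>* x (w', \<nu>) \<and> (\<forall>\<nu>'. x \<preceq> (w', \<nu>') \<longrightarrow> le \<nu> \<nu>'))"

text \<open>\<open>r a\<close> shifts all translations over \<open>w'\<close> by one constant
  \<open>\<kappa>\<close>, so a minimum over the reflected vertex transports back: lifting gives the
  bound, and the chain is extended by \<open>r a\<close> or moved by
  \<open>scover_chain_left\<close>.\<close>

lemma has_min_lower:
  assumes x: "fst x \<in> W" and w': "w' \<in> W" and a: "simple a" and dn: "inv w' (fst a) \<notin> P"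
    and hm: "has_min (if up a x then x else r a \<odot> x) (refl (fst a) \<circ> w')"
  shows "has_min x w'"
proof -
  let ?x = "if up a x then x else r a \<odot> x"
  have A: "fst a \<in> \<Phi>" using a simple_root by blast
  define \<kappa> where "\<kappa> = act (inv w') (snd (r a))"
  have ra: "r a \<odot> (w', \<nu>) = (refl (fst a) \<circ> w', \<kappa> + \<nu>)" for \<nu>
    by (simp add: aff_mult_def \<kappa>_def)
  obtain \<nu> where c: "scover\<^sup>*\<^sup>* ?x (refl (fst a) \<circ> w', \<nu>)"
    and m: "\<And>\<nu>'. ?x \<preceq> (refl (fst a) \<circ> w', \<nu>') \<Longrightarrow> le \<nu> \<nu>'"
    using hm by (auto simp: has_min_def)
  let ?y = "(w', \<nu> - \<kappa>)"
  let ?z = "r a \<odot> ?y"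
  have z: "?z = (refl (fst a) \<circ> w', \<nu>)" by (simp add: ra)
  have zW: "fst ?z \<in> W" using w' A by (simp add: weyl_comp refl_in_weyl)
  have zup: "up a ?z" using up_r_mult[of ?y a] w' A dn by simp
  have rz: "r a \<odot> ?z = ?y" using w' A by (simp add: r_r_mult)
  have "scover\<^sup>*\<^sup>* x ?y"
  proof (cases "up a x")
    case True
    then have "scover\<^sup>*\<^sup>* x ?z" using c z by simp
    moreover have "scover ?z ?y" using scover_up[OF zW a zup] rz by simp
    ultimately show ?thesis by (rule rtranclp.rtrancl_into_rtrancl)
  next
    case False
    then have "scover\<^sup>*\<^sup>* (r a \<odot> x) ?z" using c z by simp
    moreover have "up a (r a \<odot> x)" using up_r_mult[OF x A] False by simp
    ultimately have "scover\<^sup>*\<^sup>* (r a \<odot> (r a \<odot> x)) (r a \<odot> ?z)"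
      using scover_chain_left[OF _ _ _ a] zup x A by (simp add: weyl_comp refl_in_weyl)
    then show ?thesis using rz x A by (simp add: r_r_mult)
  qed
  moreover have "le (\<nu> - \<kappa>) \<nu>'" if "x \<preceq> (w', \<nu>')" for \<nu>'
  proof -
    have "?x \<preceq> r a \<odot> (w', \<nu>')"
      using sle_lift_up_down[OF that x a] sle_lift_down_down[OF that x a] dn by simp
    then have "le \<nu> (\<kappa> + \<nu>')" unfolding ra by (rule m)
    then show ?thesis by (rule le_diff_cong[rotated]) simp
  qed
  ultimately show ?thesis unfolding has_min_def by blast
qed

text \<open>Left simple reflections along a reduced word of \<open>t\<close> lower \<open>y\<close> at every step; as soon as one
  of them raises \<open>x\<close>, the gap \<open>slen y - slen x\<close> shrinks.\<close>
lemma has_min_word: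
  assumes IH: "\<And>x' y'. x' \<preceq> y' \<Longrightarrow> fst x' \<in> W \<Longrightarrow> slen y' - slen x' < n \<Longrightarrow> has_min x' (fst y')"
    and "fst t \<in> W" "x \<preceq> y" "fst x \<in> W" "slen y - slen x = n"
    "\<And>b. pos b \<Longrightarrow> \<not> pos (t \<star> b) \<Longrightarrow> \<not> up b y" "\<exists>b. pos b \<and> \<not> pos (t \<star> b) \<and> up b x"
  shows "has_min x (fst y)"
  using assms(2-)
proof (induction "len t" arbitrary: t x y rule: less_induct)
  case less
  have y: "fst y \<in> W" using less.prems sle_E by blast
  obtain b where b: "pos b" "\<not> pos (t \<star> b)" "up b x" using less.prems by blast
  then have "ainvs t \<noteq> {}" unfolding ainvs_def by blast
  then obtain a where a: "simple a" "\<not> pos (t \<star> a)"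
    using simple_descent[OF less.prems(1)] by metis
  have A: "fst a \<in> \<Phi>" "pos a" using a simple_root simple_pos by auto
  have ydn: "\<not> up a y" using less.prems(5)[OF A(2) a(2)] .
  show ?case
  proof (cases "up a x")
    case True
    have "x \<preceq> r a \<odot> y" using less.prems True ydn a by (intro sle_lift_up_down) auto
    then have "has_min x (fst (r a \<odot> y))"
      using less.prems slen_down[OF y a(1) ydn] by (intro IH) auto
    then show ?thesis using True less.prems y a ydn by (intro has_min_lower[of x "fst y" a]) auto
  next
    case False
    \<comment> \<open>Both elements go down, so the gap stays \<open>n\<close>. The inversions of
      the shorter \<open>?t\<close> are those of \<open>t\<close> other than \<open>a\<close>, moved
      by \<open>r a\<close>, which carries both sign conditions along.\<close>
    let ?t = "t \<odot> r a"
    have tW: "fst ?t \<in> W" using less.prems A by (simp add: weyl_comp refl_in_weyl)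
    have tact: "?t \<star> c = t \<star> r a \<star> c" if "fst c \<in> \<Phi>" for c
      using that less.prems A by (simp add: aact_mult refl_in_weyl)
    have ta: "pos (?t \<star> a)"
      using less.prems(1) A a by (simp add: tact r_act_self aact_aneg pos_aneg)
    have "len ?t < len (?t \<odot> r a)" using tW A ta by (intro len_less_mult_r)
    then have lt: "len ?t < len t" using less.prems A by (simp add: mult_r_r)
    have upr: "up c (r a \<odot> z) \<longleftrightarrow> up (r a \<star> c) z" if "fst z \<in> W" "fst c \<in> \<Phi>" for c z
      using that A by (simp add: o_inv_distrib weyl_bij[OF refl_in_weyl] weyl_bij)
    have "has_min (r a \<odot> x) (fst (r a \<odot> y))"
    proof (rule less.hyps[OF lt tW])
      show "r a \<odot> x \<preceq> r a \<odot> y" using less.prems False a by (intro sle_lift_down_down) auto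
      show "fst (r a \<odot> x) \<in> W" using less.prems A by (simp add: weyl_comp refl_in_weyl)
      show "slen (r a \<odot> y) - slen (r a \<odot> x) = n"
        using slen_down[OF y a(1) ydn] slen_down[OF less.prems(3) a(1) False] less.prems by simp
      fix c assume c: "pos c" "\<not> pos (?t \<star> c)"
      then have C: "fst c \<in> \<Phi>" using pos_fst by blast
      have "c \<noteq> a" using c ta by auto
      then have "pos (r a \<star> c)" using a c simple_permutes by blast
      moreover have "\<not> pos (t \<star> r a \<star> c)" using c C tact by simp
      ultimately have "\<not> up (r a \<star> c) y" by (rule less.prems(5))
      then show "\<not> up c (r a \<odot> y)" using upr[OF y C] by simp
    next
      have B: "fst b \<in> \<Phi>" using b pos_fst by blast
      have "b \<noteq> a" using b False by auto
      then have "pos (r a \<star> b)" using a b simple_permutes by blast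
      moreover have "\<not> pos (?t \<star> r a \<star> b)"
        using b A B tact[of "r a \<star> b"] by (simp add: refl_root r_act_r)
      moreover have "up (r a \<star> b) (r a \<odot> x)"
        using b A B upr[of x "r a \<star> b"] less.prems by (simp add: refl_root)
      ultimately show "\<exists>b. pos b \<and> \<not> pos (?t \<star> b) \<and> up b (r a \<odot> x)" by blast
    qed
    then show ?thesis using False less.prems y a ydn
      by (intro has_min_lower[of x "fst y" a]) auto
  qed
qed

text \<open>The inclusion says that \<open>inv w' \<circ> w\<close> has no inversions. Its failure
  supplies a root separating two distinct vertices.\<close>

lemma weyl_eq_if_neg_subset:
  assumes w: "w \<in> W" and w': "w' \<in> W"
    and sub: "\<And>\<beta>. \<beta> \<in> \<Phi> \<Longrightarrow> inv w' \<beta> \<notin> P \<Longrightarrow> inv w \<beta> \<notin> P"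
  shows "w = w'"
proof -
  let ?u = "inv w' \<circ> w"
  have u: "?u \<in> W" using w w' by (simp add: weyl_comp weyl_inv)
  have "finv ?u = {}"
  proof (rule ccontr)
    assume "finv ?u \<noteq> {}"
    then obtain \<beta> where "\<beta> \<in> P" "inv w' (w \<beta>) \<notin> P" by (auto simp: finv_def)
    then show False using sub[of "w \<beta>"] w pos_root by auto
  qed
  then have "inv w' \<circ> w = id" using u finv_empty_id by blast
  then have "w' \<circ> (inv w' \<circ> w) = w'" by simp
  then show ?thesis using w' by (simp add: comp_assoc[symmetric] weyl_inv_comp)
qed

lemma sle_has_min:
  assumes "x \<preceq> y" "fst x \<in> W"
  shows "has_min x (fst y)"
  using assms
proof (induction "nat (slen y - slen x)" arbitrary: x y rule: less_induct)
  case less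
  have y: "fst y \<in> W" using less.prems sle_E by blast
  show ?case
  proof (cases "fst x = fst y")
    case True
    then have "scover\<^sup>*\<^sup>* x (fst y, snd x)" by (metis prod.collapse rtranclp.rtrancl_refl)
    then show ?thesis unfolding has_min_def using sle_le by fastforce
  next
    case False
    then obtain \<beta> where b: "\<beta> \<in> \<Phi>" "inv (fst y) \<beta> \<notin> P" "inv (fst x) \<beta> \<in> P"
      using weyl_eq_if_neg_subset less.prems y by blast
    \<comment> \<open>This translation raises the level of every root that is up for
      \<open>y\<close> and lowers the others, so positive roots it turns negative are all down for
      \<open>y\<close>.\<close>
    define t where "t = (id :: 'v \<Rightarrow> 'v, - act (fst y) (\<iota> two_rho_check))"
    have t: "t \<star> c = (fst c, snd c + cht (inv (fst y) (fst c)))" if "fst c \<in> \<Phi>" for c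
      using that y by (simp add: t_def aff_act_def pr_uminus Q_root pr_act)
    show ?thesis
    proof (rule has_min_word[of "slen y - slen x" t])
      show "has_min x' (fst y')" if "x' \<preceq> y'" "fst x' \<in> W" "slen y' - slen x' < slen y - slen x"
        for x' y' using less.hyps[OF _ that(1,2)] that(3) slen_sle[OF that(1)] by simp
      show "fst t \<in> W" by (simp add: t_def)
      show "\<not> up c y" if c: "pos c" "\<not> pos (t \<star> c)" for c
      proof
        assume "up c y"
        then have "cht (inv (fst y) (fst c)) \<ge> 1" by (rule cht_pos)
        then have "pos (t \<star> c)" using c(1) t[of c] by (auto simp: aff_pos_def)
        then show False using c by simp
      qed
      \<comment> \<open>The lowest level at which a root with finite part \<open>\<beta>\<close> is
        positive; any drop makes it negative.\<close>
      define k where "k = (if \<beta> \<in> P then 0 else 1 :: int)"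
      have ch: "cht (inv (fst y) \<beta>) \<le> -1"
      proof -
        have "- inv (fst y) \<beta> \<in> P" using b y neg_iff[of "inv (fst y) \<beta>"] by (simp add: weyl_inv)
        then have "cht (- inv (fst y) \<beta>) \<ge> 1" by (rule cht_pos)
        then show ?thesis using b y by (simp add: pr_uminus_right Q_root weyl_inv)
      qed
      have "pos (\<beta>, k)" using b neg_iff[of \<beta>] by (simp add: aff_pos_def k_def)
      moreover have "\<not> pos (t \<star> (\<beta>, k))"
        using b ch neg_iff[of \<beta>] t[of "(\<beta>, k)"] by (auto simp: aff_pos_def k_def)
      ultimately show "\<exists>c. pos c \<and> \<not> pos (t \<star> c) \<and> up c x" using b
        by (intro exI[of _ "(\<beta>, k)"]) simp
    qed (use less.prems in auto)
  qed
qed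

section \<open>Weights in the quantum Bruhat graph\<close>

text \<open>Level \<open>m = 1\<close> is admissible for every positive root, so any word can be
  followed upward.\<close>

lemma sle_connected:
  assumes "set ws \<subseteq> \<Phi>" "w \<in> W"
  shows "\<exists>\<nu>. (w, \<mu>) \<preceq> (w \<circ> word_map ws, \<nu>)"
  using assms
proof (induction ws arbitrary: w \<mu>)
  case Nil
  then show ?case by auto
next
  case (Cons a ws)
  define \<alpha> where "\<alpha> = (if a \<in> P then a else - a)"
  have al: "\<alpha> \<in> P" "refl \<alpha> = refl a" using Cons.prems neg_iff[of a] by (auto simp: \<alpha>_def)
  have "sstep (w, \<mu>) (w \<circ> refl \<alpha>, \<mu> + \<iota> (real_of_int 1 *\<^sub>R coroot \<alpha>))"
    unfolding sstep_coords using Cons.prems al(1)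
    by (intro conjI bexI[of _ \<alpha>] exI[of _ "1::int"]) simp_all
  moreover obtain \<nu> where
    "(w \<circ> refl \<alpha>, \<mu> + \<iota> (real_of_int 1 *\<^sub>R coroot \<alpha>)) \<preceq> (w \<circ> refl \<alpha> \<circ> word_map ws, \<nu>)"
    using Cons.IH[OF _ weyl_comp[OF Cons.prems(2) refl_in_weyl[OF pos_root[OF al(1)]]]] Cons.prems(1)
    by (meson set_subset_Cons subset_trans)
  ultimately show ?case using al
    by (metis comp_assoc converse_rtranclp_into_rtranclp word_map_Cons)
qed

lemma ex_min_weight:
  assumes "w \<in> W" "w' \<in> W"
  obtains \<nu> where "scover\<^sup>*\<^sup>* (w, 0) (w', \<nu>)" "\<And>\<nu>'. (w, 0) \<preceq> (w', \<nu>') \<Longrightarrow> le \<nu> \<nu>'"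
proof -
  have "inv w \<circ> w' \<in> W" using assms by (simp add: weyl_comp weyl_inv)
  then obtain ws where ws: "set ws \<subseteq> \<Phi>" "inv w \<circ> w' = word_map ws" by (rule weylE)
  then have "w \<circ> word_map ws = w'"
    using assms by (metis comp_assoc id_comp weyl_inv_comp(2))
  then obtain \<nu> where "(w, 0) \<preceq> (w', \<nu>)" using sle_connected[OF ws(1) assms(1)] by metis
  then show ?thesis using sle_has_min[of "(w, 0)" "(w', \<nu>)"] assms that by (auto simp: has_min_def)
qed

text \<open>One direction is the growth of \<open>slen\<close> along a step of level 0; applied to
  \<open>w \<circ> refl \<alpha>\<close> it gives the other.\<close>

lemma finv_refl_less_iff:
  assumes "w \<in> W" "\<alpha> \<in> P"
  shows "card (finv (w \<circ> refl \<alpha>)) > card (finv w) \<longleftrightarrow> w \<alpha> \<in> P"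
proof -
  have A: "\<alpha> \<in> \<Phi>" using assms pos_root by blast
  have *: "card (finv (w \<circ> refl \<alpha>)) > card (finv w)" if "w \<in> W" "w \<alpha> \<in> P" for w
  proof -
    have "sstep (w, 0) (w \<circ> refl \<alpha>, 0 + \<iota> (real_of_int 0 *\<^sub>R coroot \<alpha>))"
      unfolding sstep_coords using that assms
      by (intro conjI bexI[of _ \<alpha>] exI[of _ "0::int"]) simp_all
    then show ?thesis using slen_sstep by (fastforce simp: slen_def pr_zero rho2_Q)
  qed
  show ?thesis
  proof
    assume gt: "card (finv (w \<circ> refl \<alpha>)) > card (finv w)"
    show "w \<alpha> \<in> P"
    proof (rule ccontr)
      assume "w \<alpha> \<notin> P"
      then have "(w \<circ> refl \<alpha>) \<alpha> \<in> P" using assms A neg_iff[of "w \<alpha>"] by (simp add: weyl_uminus)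
      then have "card (finv (w \<circ> refl \<alpha> \<circ> refl \<alpha>)) > card (finv (w \<circ> refl \<alpha>))"
        using assms A by (intro *) (simp_all add: weyl_comp refl_in_weyl)
      then show False using gt by (simp add: comp_assoc)
    qed
  qed (use * assms in blast)
qed

text \<open>Bruhat edges are steps of level 0 and quantum edges steps of level 1; at level 0 the
  length condition has to supply \<open>w \<alpha> \<in> P\<close>.\<close>

lemma qb_edge_scover:
  assumes "qb_edge \<Phi> \<Delta> w w' c"
  shows "c \<in> L" "scover (w, \<mu>) (w', \<mu> + \<iota> c)"
proof -
  obtain \<alpha> where w: "w \<in> W" and a: "\<alpha> \<in> P" and w': "w' = w \<circ> refl \<alpha>"
    and c: "wlen \<Delta> w' = wlen \<Delta> w + 1 \<and> c = 0 \<or>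
      real (wlen \<Delta> w') = real (wlen \<Delta> w) + 1 - coroot \<alpha> \<bullet> rho2 \<and> c = coroot \<alpha>"
    using assms by (auto simp: qb_edge_def)
  have A: "\<alpha> \<in> \<Phi>" using a pos_root by blast
  have W: "w' \<in> W" using w w' A by (simp add: weyl_comp refl_in_weyl)
  show L: "c \<in> L" using c A by (auto simp: L_coroot)
  show "scover (w, \<mu>) (w', \<mu> + \<iota> c)" using c
  proof
    assume "wlen \<Delta> w' = wlen \<Delta> w + 1 \<and> c = 0"
    then have l: "card (finv w') = card (finv w) + 1" and c0: "c = 0"
      using w W by (simp_all add: wlen_eq_card_finv)
    then have "w \<alpha> \<in> P" using finv_refl_less_iff[OF w a] w' by simp
    then have "sstep (w, \<mu>) (w', \<mu> + \<iota> (real_of_int 0 *\<^sub>R coroot \<alpha>))"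
      unfolding sstep_coords using w a w' by (intro conjI bexI[of _ \<alpha>] exI[of _ "0::int"]) simp_all
    then show ?thesis using c0 l by (simp add: scover_def slen_def)
  next
    assume q: "real (wlen \<Delta> w') = real (wlen \<Delta> w) + 1 - coroot \<alpha> \<bullet> rho2 \<and> c = coroot \<alpha>"
    then have "real_of_int (int (card (finv w'))) = real_of_int (int (card (finv w)) + 1 - cart \<alpha> rho2)"
      using w W A by (simp add: wlen_eq_card_finv cart rho2_Q)
    then have l: "int (card (finv w')) = int (card (finv w)) + 1 - cart \<alpha> rho2" by linarith
    have "sstep (w, \<mu>) (w', \<mu> + \<iota> (real_of_int 1 *\<^sub>R coroot \<alpha>))"
      unfolding sstep_coords using w a w' by (intro conjI bexI[of _ \<alpha>] exI[of _ "1::int"]) simp_all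
    then show ?thesis using q l by (simp add: scover_def slen_def pr_add rho2_Q)
  qed
qed

lemma scover_qb_edge:
  assumes "scover (w, \<mu>) (w', \<mu>')"
  obtains c where "c \<in> L" "qb_edge \<Phi> \<Delta> w w' c" "\<mu>' = \<mu> + \<iota> c"
proof -
  obtain \<alpha> m where w: "w \<in> W" and a: "\<alpha> \<in> P" "m \<ge> (if w \<alpha> \<in> P then 0 else 1)"
    and w': "w' = w \<circ> refl \<alpha>" and m': "\<mu>' = \<mu> + \<iota> (real_of_int m *\<^sub>R coroot \<alpha>)"
    and l: "slen (w', \<mu>') = slen (w, \<mu>) + 1"
    using assms unfolding scover_def sstep_coords by blast
  have A: "\<alpha> \<in> \<Phi>" using a pos_root by blast
  have W: "w' \<in> W" using w w' A by (simp add: weyl_comp refl_in_weyl)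
  have l': "int (card (finv w')) + m * cart \<alpha> rho2 = int (card (finv w)) + 1"
    using l A by (simp add: slen_def m' pr_add rho2_Q pr_\<iota>_scale_coroot)
  \<comment> \<open>The step of level 1 always exists and already gains at least one; each further
    level adds \<open>cart \<alpha> rho2 > 0\<close>, so a cover has level at most 1.\<close>
  have "sstep (w, \<mu>) (w', \<mu> + \<iota> (real_of_int 1 *\<^sub>R coroot \<alpha>))"
    unfolding sstep_coords using w a w' by (intro conjI bexI[of _ \<alpha>] exI[of _ "1::int"]) simp_all
  then have l1: "int (card (finv w')) + cart \<alpha> rho2 \<ge> int (card (finv w)) + 1"
    using slen_sstep by (fastforce simp: slen_def pr_add rho2_Q)
  have "m = 0 \<or> m = 1"
  proof (rule ccontr)
    assume "\<not> ?thesis"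
    then have "m \<ge> 2" using a by (auto split: if_splits)
    then have "2 * cart \<alpha> rho2 \<le> m * cart \<alpha> rho2"
      using cart_rho2_pos[OF a(1)] by (intro mult_right_mono) auto
    then show False using l' l1 cart_rho2_pos[OF a(1)] by linarith
  qed
  then show ?thesis
  proof
    assume m: "m = 0"
    then have "qb_edge \<Phi> \<Delta> w w' 0" unfolding qb_edge_def
      using w W w' a l' by (intro conjI bexI[of _ \<alpha>]) (auto simp: wlen_eq_card_finv)
    then show ?thesis using that[of 0] m m' by simp
  next
    assume m: "m = 1"
    have "real_of_int (int (card (finv w'))) = real_of_int (int (card (finv w)) + 1 - cart \<alpha> rho2)"
      using l' m by simp
    then have "qb_edge \<Phi> \<Delta> w w' (coroot \<alpha>)" unfolding qb_edge_def
      using w W w' a A by (intro conjI bexI[of _ \<alpha>]) (auto simp: wlen_eq_card_finv cart rho2_Q)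
    then show ?thesis using that[of "coroot \<alpha>"] m m' A by (simp add: L_coroot)
  qed
qed

section \<open>Paths of the quantum Bruhat graph as chains of covers\<close>

abbreviation path_wt :: "(('v \<Rightarrow> 'v) \<times> 'v) list \<Rightarrow> 'v" where
  "path_wt ps \<equiv> sum_list (map snd ps)"

text \<open>Each edge is a cover, so the number of edges is the gain in \<open>slen\<close>: for
  fixed endpoints, shortest means least pairing of the weight with \<open>rho2\<close>.\<close>

lemma qb_path_sle:
  assumes "qb_path \<Phi> \<Delta> w ps w'"
  shows "path_wt ps \<in> L \<and> (w, \<mu>) \<preceq> (w', \<mu> + \<iota> (path_wt ps)) \<and>
    slen (w', \<mu> + \<iota> (path_wt ps)) = slen (w, \<mu>) + int (length ps)"
  using assms
proof (induction arbitrary: \<mu> rule: qb_path.induct)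
  case (qb_nil w)
  then show ?case by simp
next
  case (qb_cons w u c ps w')
  have c: "c \<in> L" "scover (w, \<mu>) (u, \<mu> + \<iota> c)" using qb_edge_scover qb_cons by blast+
  note IH = qb_cons.IH[of "\<mu> + \<iota> c"]
  have eq: "\<mu> + \<iota> (c + path_wt ps) = \<mu> + \<iota> c + \<iota> (path_wt ps)"
    using c IH by (simp add: \<iota>_add add.assoc)
  have st: "sstep (w, \<mu>) (u, \<mu> + \<iota> c)" "slen (u, \<mu> + \<iota> c) = slen (w, \<mu>) + 1"
    using c by (auto simp: scover_def)
  then show ?case using IH c(1) unfolding eq[symmetric]
    by (auto simp: L_add intro: converse_rtranclp_into_rtranclp)
qed

lemma scover_chain_qb_path:
  assumes "scover\<^sup>*\<^sup>* x y"
  shows "\<exists>ps. qb_path \<Phi> \<Delta> (fst x) ps (fst y) \<and> path_wt ps \<in> L \<and> snd y = snd x + \<iota> (path_wt ps)"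
  using assms
proof (induction rule: converse_rtranclp_induct)
  case base
  then show ?case by (intro exI[of _ "[]"]) (simp add: qb_nil)
next
  case (step x z)
  then obtain ps where ps: "qb_path \<Phi> \<Delta> (fst z) ps (fst y)" "path_wt ps \<in> L"
    "snd y = snd z + \<iota> (path_wt ps)" by blast
  obtain c where c: "c \<in> L" "qb_edge \<Phi> \<Delta> (fst x) (fst z) c" "snd z = snd x + \<iota> c"
    using scover_qb_edge[of "fst x" "snd x" "fst z" "snd z"] step by auto
  then show ?case using ps
    by (intro exI[of _ "(fst z, c) # ps"]) (simp add: qb_cons L_add \<iota>_add add.assoc)
qed

text \<open>The minimum is the weight of some path and lies below the weight of the chosen shortest
  path; the latter, being no longer, pairs no higher with \<open>rho2\<close>, so
  \<open>le_antisym_rho2\<close> forces equality.\<close>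

theorem qb_wt_minimal:
  assumes w: "w \<in> W" and w': "w' \<in> W"
  shows "(w, 0) \<preceq> (w', \<iota> (qb_wt \<Phi> \<Delta> w w'))"
    and "\<And>\<nu>. (w, 0) \<preceq> (w', \<nu>) \<Longrightarrow> le (\<iota> (qb_wt \<Phi> \<Delta> w w')) \<nu>"
proof -
  obtain \<nu>0 where ch: "scover\<^sup>*\<^sup>* (w, 0) (w', \<nu>0)" and min: "\<And>\<nu>. (w, 0) \<preceq> (w', \<nu>) \<Longrightarrow> le \<nu>0 \<nu>"
    using ex_min_weight[OF w w'] by blast
  obtain ps0 where ps0: "qb_path \<Phi> \<Delta> w ps0 w'" "\<nu>0 = \<iota> (path_wt ps0)"
    using scover_chain_qb_path[OF ch] by auto
  define ps where "ps = (SOME ps. qb_path \<Phi> \<Delta> w ps w' \<and> length ps = qb_dist \<Phi> \<Delta> w w')"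
  have "\<exists>n ps. qb_path \<Phi> \<Delta> w ps w' \<and> length ps = n" using ps0 by blast
  then have "\<exists>ps. qb_path \<Phi> \<Delta> w ps w' \<and> length ps = qb_dist \<Phi> \<Delta> w w'"
    unfolding qb_dist_def by (rule LeastI_ex)
  then have ps: "qb_path \<Phi> \<Delta> w ps w'" "length ps = qb_dist \<Phi> \<Delta> w w'"
    unfolding ps_def by (metis (mono_tags, lifting) someI_ex)+
  have "qb_dist \<Phi> \<Delta> w w' \<le> length ps0"
    unfolding qb_dist_def using ps0 by (intro Least_le) blast
  then have "slen (w', \<iota> (path_wt ps)) \<le> slen (w', \<nu>0)"
    using qb_path_sle[OF ps(1), of 0] qb_path_sle[OF ps0(1), of 0] ps ps0 by simp
  then have "pr (\<iota> (path_wt ps)) rho2 \<le> pr \<nu>0 rho2" by (simp add: slen_def)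
  moreover have "le \<nu>0 (\<iota> (path_wt ps))" using min qb_path_sle[OF ps(1), of 0] by simp
  ultimately have "\<nu>0 = \<iota> (path_wt ps)" by (rule le_antisym_rho2[rotated])
  also have "path_wt ps = qb_wt \<Phi> \<Delta> w w'" by (simp add: qb_wt_def ps_def)
  finally have eq: "\<nu>0 = \<iota> (qb_wt \<Phi> \<Delta> w w')" .
  show "(w, 0) \<preceq> (w', \<iota> (qb_wt \<Phi> \<Delta> w w'))"
    using qb_path_sle[OF ps0(1), of 0] ps0 eq by simp
  show "\<And>\<nu>. (w, 0) \<preceq> (w', \<nu>) \<Longrightarrow> le (\<iota> (qb_wt \<Phi> \<Delta> w w')) \<nu>" using min eq by simp
qed

lemma sle_iff_qb_wt:
  assumes w: "w \<in> W" and w': "w' \<in> W"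
  shows "(w, \<mu>) \<preceq> (w', \<mu>') \<longleftrightarrow> le (\<mu> + \<iota> (qb_wt \<Phi> \<Delta> w w')) \<mu>'"
proof
  assume "(w, \<mu>) \<preceq> (w', \<mu>')"
  from sle_translate[OF this, of "- \<mu>"] have "(w, 0) \<preceq> (w', \<mu>' - \<mu>)" by simp
  then have "le (\<iota> (qb_wt \<Phi> \<Delta> w w')) (\<mu>' - \<mu>)" using qb_wt_minimal[OF w w'] by blast
  then show "le (\<mu> + \<iota> (qb_wt \<Phi> \<Delta> w w')) \<mu>'" by (rule le_diff_cong[rotated]) simp
next
  assume "le (\<mu> + \<iota> (qb_wt \<Phi> \<Delta> w w')) \<mu>'"
  then have "(w', \<mu> + \<iota> (qb_wt \<Phi> \<Delta> w w')) \<preceq> (w', \<mu>')" by (rule sle_mono[OF w'])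
  moreover have "(w, \<mu>) \<preceq> (w', \<mu> + \<iota> (qb_wt \<Phi> \<Delta> w w'))"
    using sle_translate[OF qb_wt_minimal(1)[OF w w'], of \<mu>] by (simp add: add.commute)
  ultimately show "(w, \<mu>) \<preceq> (w', \<mu>')" by (rule rtranclp_trans[rotated])
qed

section \<open>Lifting in the Bruhat order and the criterion\<close>

abbreviation ble (infix "\<sqsubseteq>" 50) where "x \<sqsubseteq> y \<equiv> bruhat_le \<Phi> \<Delta> pr \<iota> x y"

lemma bstep_ble: "bstep x y \<Longrightarrow> x \<sqsubseteq> y"
  by (simp add: bruhat_le_def)

lemma ble_trans: "x \<sqsubseteq> y \<Longrightarrow> y \<sqsubseteq> z \<Longrightarrow> x \<sqsubseteq> z"
  unfolding bruhat_le_def by (rule rtranclp_trans)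

lemma bstep_E: "bstep x y \<Longrightarrow> fst x \<in> W \<and> fst y \<in> W"
  unfolding bruhat_step_iff by (metis fst_mult fst_r weyl_comp refl_in_weyl pos_fst)

lemma ble_len: "x \<sqsubseteq> y \<Longrightarrow> x = y \<or> len x < len y"
  unfolding bruhat_le_def
proof (induction rule: rtranclp_induct)
  case (step y z)
  have "len y < len z" using step(2) unfolding bruhat_step_def by blast
  then show ?case using step by auto
qed simp

lemma bstep_mult_r:
  assumes "fst x \<in> W" "pos a"
  shows "pos (x \<star> a) \<Longrightarrow> bstep x (x \<odot> r a)" "\<not> pos (x \<star> a) \<Longrightarrow> bstep (x \<odot> r a) x"
proof -
  have A: "fst a \<in> \<Phi>" using assms pos_fst by blast
  show "bstep x (x \<odot> r a)" if "pos (x \<star> a)"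
    unfolding bruhat_step_iff using assms that by blast
  show "bstep (x \<odot> r a) x" if "\<not> pos (x \<star> a)"
  proof -
    have "pos ((x \<odot> r a) \<star> a)"
      using assms A that by (simp add: aact_mult refl_in_weyl r_act_self aact_aneg pos_aneg)
    moreover have "x = x \<odot> r a \<odot> r a" using assms A by (simp add: mult_r_r)
    moreover have "fst (x \<odot> r a) \<in> W" using assms A by (simp add: weyl_comp refl_in_weyl)
    ultimately show ?thesis unfolding bruhat_step_iff using assms by blast
  qed
qed

lemma bstep_right:
  assumes s: "bstep x y" and a: "simple a"
  shows "y = x \<odot> r a \<or> bstep (x \<odot> r a) (y \<odot> r a)"
proof -
  obtain b where x: "fst x \<in> W" and b: "pos b" "pos (x \<star> b)" "y = x \<odot> r b"
    using s unfolding bruhat_step_iff by blast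
  have A: "fst a \<in> \<Phi>" and B: "fst b \<in> \<Phi>" using a b by (auto simp: simple_root pos_fst)
  show ?thesis
  proof (cases "b = a")
    case False
    \<comment> \<open>Chosen so that \<open>x \<odot> r a\<close> sends it where \<open>x\<close>
      sends \<open>b\<close>.\<close>
    let ?c = "r a \<star> b"
    have c: "pos ?c" using a b False simple_permutes by blast
    then have C: "fst ?c \<in> \<Phi>" by (rule pos_fst)
    have ac: "r a \<star> ?c = b" using A B by (simp add: r_act_r)
    have "(x \<odot> r a) \<star> ?c = x \<star> b"
      using aact_mult[of x "r a" ?c] x A C ac by (simp add: refl_in_weyl)
    moreover have "y \<odot> r a = x \<odot> r a \<odot> r ?c"
    proof -
      have "r a \<odot> r ?c = r b \<odot> r a" using mult_r_conj[of "r a" ?c] A C ac by (simp add: refl_in_weyl)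
      moreover have "x \<odot> r a \<odot> r ?c = x \<odot> (r a \<odot> r ?c)"
        by (rule mult_assoc) (use x A C in \<open>simp_all add: refl_in_weyl\<close>)
      moreover have "x \<odot> r b \<odot> r a = x \<odot> (r b \<odot> r a)"
        by (rule mult_assoc) (use x A B in \<open>simp_all add: refl_in_weyl\<close>)
      ultimately show ?thesis using b by simp
    qed
    moreover have "fst (x \<odot> r a) \<in> W" using x A by (simp add: weyl_comp refl_in_weyl)
    ultimately have "bstep (x \<odot> r a) (y \<odot> r a)"
      unfolding bruhat_step_iff using b c by (intro conjI exI[of _ ?c]) simp_all
    then show ?thesis by simp
  qed (use b in simp)
qed

lemma ble_right_lift:
  assumes "x \<sqsubseteq> y" and x: "fst x \<in> W" and a: "simple a"
  shows "x \<odot> r a \<sqsubseteq> y \<odot> r a \<or> x \<odot> r a \<sqsubseteq> y \<and> x \<sqsubseteq> y \<odot> r a"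
  using assms(1) unfolding bruhat_le_def
proof (induction rule: rtranclp_induct)
  case (step y z)
  have y: "fst y \<in> W" using step(2) bstep_E by blast
  from bstep_right[OF step(2) a] show ?case
  proof
    assume z: "z = y \<odot> r a"
    then have "z \<odot> r a = y" using y a simple_root by (simp add: mult_r_r)
    then show ?thesis using step z by auto
  next
    assume "bstep (y \<odot> r a) (z \<odot> r a)"
    then show ?thesis using step by (meson rtranclp.rtrancl_into_rtrancl)
  qed
qed simp

text \<open>An element of length zero need not be trivial, but it keeps positive affine roots
  positive, so multiplying by its inverse on the right maps Bruhat steps to Bruhat steps.\<close>

lemma ble_mult_ainv:
  assumes "u \<sqsubseteq> v" and u: "fst u \<in> W" and y: "fst y \<in> W" "ainvs y = {}"
  shows "u \<odot> ainv y \<sqsubseteq> v \<odot> ainv y"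
  using assms(1) unfolding bruhat_le_def
proof (induction rule: rtranclp_induct)
  case (step v z)
  obtain b where v: "fst v \<in> W" and b: "pos b" "pos (v \<star> b)" "z = v \<odot> r b"
    using step(2) unfolding bruhat_step_iff by blast
  have B: "fst b \<in> \<Phi>" using b pos_fst by blast
  let ?c = "y \<star> b"
  have iW: "fst (ainv y) \<in> W" using y by (simp add: weyl_inv)
  have c: "pos ?c" using y b unfolding ainvs_def by blast
  then have C: "fst ?c \<in> \<Phi>" by (rule pos_fst)
  have ac: "ainv y \<star> ?c = b"
    using aact_mult[OF iW y(1) B] y B by (simp add: ainv_mult)
  have "(v \<odot> ainv y) \<star> ?c = v \<star> b" using aact_mult[OF v iW C] ac by simp
  moreover have "z \<odot> ainv y = v \<odot> ainv y \<odot> r ?c"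
  proof -
    have "ainv y \<odot> r ?c = r b \<odot> ainv y" using mult_r_conj[OF iW C] ac by simp
    moreover have "v \<odot> ainv y \<odot> r ?c = v \<odot> (ainv y \<odot> r ?c)"
      by (rule mult_assoc[OF v iW]) (use C in \<open>simp add: refl_in_weyl\<close>)
    moreover have "v \<odot> r b \<odot> ainv y = v \<odot> (r b \<odot> ainv y)"
      by (rule mult_assoc[OF v _ iW]) (use B in \<open>simp add: refl_in_weyl\<close>)
    ultimately show ?thesis using b by simp
  qed
  moreover have "fst (v \<odot> ainv y) \<in> W" using v y by (simp add: weyl_comp weyl_inv)
  ultimately have "bstep (v \<odot> ainv y) (z \<odot> ainv y)"
    unfolding bruhat_step_iff using b c by (intro conjI exI[of _ ?c]) simp_all
  then show ?case using step by (meson rtranclp.rtrancl_into_rtrancl)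
qed simp

text \<open>Stripping simple reflections off the right of \<open>y\<close>, and off \<open>y'\<close> whenever this lowers it,
  preserves all hypotheses. The last one says that lengths add in \<open>x\<^sub>1 y\<close>.\<close>
lemma ble_cancel_right:
  assumes "y' \<sqsubseteq> y" "x1 \<odot> y \<sqsubseteq> x2 \<odot> y'" "fst x1 \<in> W" "fst x2 \<in> W" "fst y \<in> W" "fst y' \<in> W"
    "\<And>a. pos a \<Longrightarrow> \<not> pos (y \<star> a) \<Longrightarrow> \<not> pos (x1 \<star> y \<star> a)"
  shows "x1 \<sqsubseteq> x2"
  using assms
proof (induction "len y" arbitrary: y y' rule: less_induct)
  case less
  note W = less.prems(3-6)
  show ?case
  proof (cases "ainvs y = {}")
    case True
    then have "y' = y" using ble_len[OF less.prems(1)] by (simp add: len_ainvs)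
    then have "x1 \<odot> y \<odot> ainv y \<sqsubseteq> x2 \<odot> y \<odot> ainv y"
      using less.prems(2) W True by (intro ble_mult_ainv) (simp_all add: weyl_comp)
    then show ?thesis using W by (simp add: mult_assoc weyl_inv mult_ainv)
  next
    case False
    then obtain a where a: "simple a" "\<not> pos (y \<star> a)" using simple_descent[OF W(3)] by metis
    have A: "fst a \<in> \<Phi>" "pos a" using a simple_root simple_pos by auto
    let ?y = "y \<odot> r a"
    have rW: "refl (fst a) \<in> W" using A by (simp add: refl_in_weyl)
    have yW: "fst ?y \<in> W" "fst (y' \<odot> r a) \<in> W" using W rW by (simp_all add: weyl_comp)
    have lt: "len ?y < len y"
      using bstep_mult_r(2)[OF W(3) A(2) a(2)] unfolding bruhat_step_def by blast
    have assoc: "x1 \<odot> y \<odot> r a = x1 \<odot> ?y" "x2 \<odot> y' \<odot> r a = x2 \<odot> (y' \<odot> r a)"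
      using W rW by (simp_all add: mult_assoc)
    \<comment> \<open>Additivity of lengths makes the descent \<open>a\<close> of \<open>y\<close> a
      descent of \<open>x1 \<odot> y\<close> too.\<close>
    have "\<not> pos ((x1 \<odot> y) \<star> a)"
      using less.prems(7)[OF A(2) a(2)] W A by (simp add: aact_mult)
    then have x1y: "x1 \<odot> ?y \<sqsubseteq> x1 \<odot> y"
      using bstep_mult_r(2)[of "x1 \<odot> y" a] W A assoc by (simp add: weyl_comp bstep_ble)
    have lift1: "y' \<odot> r a \<sqsubseteq> ?y \<or> y' \<odot> r a \<sqsubseteq> y \<and> y' \<sqsubseteq> ?y"
      using ble_right_lift[OF less.prems(1) W(4) a(1)] .
    have lift2: "x1 \<odot> ?y \<sqsubseteq> x2 \<odot> (y' \<odot> r a) \<or> x1 \<odot> y \<sqsubseteq> x2 \<odot> (y' \<odot> r a)"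
      using ble_right_lift[OF less.prems(2) _ a(1)] W assoc by (auto simp: weyl_comp)
    have cond: "\<not> pos (x1 \<star> ?y \<star> b)" if b: "pos b" "\<not> pos (?y \<star> b)" for b
    proof -
      have B: "fst b \<in> \<Phi>" using b pos_fst by blast
      have eq: "?y \<star> b = y \<star> r a \<star> b" using W rW B by (simp add: aact_mult)
      have "pos (?y \<star> a)"
        using a A W rW by (simp add: aact_mult r_act_self aact_aneg pos_aneg)
      then have "b \<noteq> a" using b by blast
      then have "pos (r a \<star> b)" using a b simple_permutes by blast
      then show ?thesis using less.prems(7) b eq by simp
    qed
    show ?thesis
    \<comment> \<open>If \<open>a\<close> is an ascent of \<open>y'\<close>, only \<open>y\<close>
      is shortened; otherwise both are.\<close>
    proof (cases "pos (y' \<star> a)")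
      case True
      then have "y' \<sqsubseteq> y' \<odot> r a" using bstep_mult_r(1)[OF W(4) A(2)] bstep_ble by blast
      then have "y' \<sqsubseteq> ?y" using lift1 ble_trans by blast
      moreover have "x1 \<odot> ?y \<sqsubseteq> x2 \<odot> y'" using x1y less.prems(2) ble_trans by blast
      ultimately show ?thesis by (rule less.hyps[OF lt]) (use W yW cond in blast)+
    next
      case False
      then have "y' \<odot> r a \<sqsubseteq> y'" using bstep_mult_r(2)[OF W(4) A(2)] bstep_ble by blast
      then have "y' \<odot> r a \<sqsubseteq> ?y" using lift1 ble_trans by blast
      moreover have "x1 \<odot> ?y \<sqsubseteq> x2 \<odot> (y' \<odot> r a)" using x1y lift2 ble_trans by blast
      ultimately show ?thesis by (rule less.hyps[OF lt]) (use W yW cond in blast)+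
    qed
  qed
qed

text \<open>A maximal sum of a perturbed pairing over \<open>v P\<close> makes it nonnegative there;
  then no inversion of \<open>x\<close> has finite part outside \<open>v P\<close>. This is length
  positivity.\<close>

lemma ex_length_positive:
  assumes x: "fst x \<in> W"
  obtains v where "v \<in> W" "\<And>c. pos c \<Longrightarrow> inv v (fst c) \<notin> P \<Longrightarrow> pos (x \<star> c)"
proof -
  \<comment> \<open>A perturbation of \<open>\<langle>\<mu>, \<cdot>\<rangle>\<close> whose signs refine those of the length functional of \<open>x\<close>.\<close>
  define \<phi> where "\<phi> \<beta> = 2 * hscale * real_of_int (pr (snd x) \<beta>)
      + two_rho_check \<bullet> \<beta> - two_rho_check \<bullet> fst x \<beta>" for \<beta>
  define F where "F v = (\<Sum>\<beta>\<in>P. \<phi> (v \<beta>))" for v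
  have neg: "\<phi> (- \<beta>) = - \<phi> \<beta>" if "\<beta> \<in> \<Phi>" for \<beta>
    using that x by (simp add: \<phi>_def pr_uminus_right Q_root weyl_uminus)
  \<comment> \<open>Passing to \<open>v \<circ> refl \<delta>\<close> flips only the
    \<open>\<delta>\<close> term of \<open>F\<close>, so maximality over the finite group gives
    nonnegativity on the base, and linearity extends it to \<open>P\<close>.\<close>
  obtain v where v: "v \<in> W" and max: "\<And>u. u \<in> W \<Longrightarrow> F u \<le> F v"
    using ex_is_arg_min_if_finite[OF finite_weyl, of "\<lambda>v. - F v"] id_in_weyl
    by (fastforce simp: is_arg_min_def not_less)
  have base: "\<phi> (v \<delta>) \<ge> 0" if d: "\<delta> \<in> \<Delta>" for \<delta>
  proof -
    have D: "\<delta> \<in> P" "\<delta> \<in> \<Phi>" using d base_pos base_subset by auto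
    have "F (v \<circ> refl \<delta>) = \<phi> (v (refl \<delta> \<delta>)) + (\<Sum>\<beta>\<in>P - {\<delta>}. \<phi> (v (refl \<delta> \<beta>)))"
      unfolding F_def using D finite_pos by (simp add: sum.remove)
    also have "\<dots> = - \<phi> (v \<delta>) + (\<Sum>\<beta>\<in>P - {\<delta>}. \<phi> (v \<beta>))"
      using sum_refl_base[OF d, of "\<lambda>\<beta>. \<phi> (v \<beta>)"] v D by (simp add: weyl_uminus neg)
    finally have "F (v \<circ> refl \<delta>) = - \<phi> (v \<delta>) + (\<Sum>\<beta>\<in>P - {\<delta>}. \<phi> (v \<beta>))" .
    moreover have "F v = \<phi> (v \<delta>) + (\<Sum>\<beta>\<in>P - {\<delta>}. \<phi> (v \<beta>))"
      unfolding F_def using D finite_pos by (simp add: sum.remove)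
    moreover have "F (v \<circ> refl \<delta>) \<le> F v" using v D by (intro max weyl_comp refl_in_weyl)
    ultimately show ?thesis by linarith
  qed
  have dom: "\<phi> (v \<beta>) \<ge> 0" if b: "\<beta> \<in> P" for \<beta>
  proof -
    obtain c where c: "\<beta> = (\<Sum>\<gamma>\<in>\<Delta>. real (c \<gamma>) *\<^sub>R \<gamma>)"
      using b by (auto simp: pos_roots_def nonneg_int_comb_def)
    have D: "v \<gamma> \<in> Q" if "\<gamma> \<in> \<Delta>" for \<gamma> using that base_subset v by (auto intro!: Q_root)
    have D': "real n *\<^sub>R v \<gamma> \<in> Q" if "\<gamma> \<in> \<Delta>" for \<gamma> n
      using Q_scale[OF D[OF that], of "int n"] by simp
    have vb: "v \<beta> = (\<Sum>\<gamma>\<in>\<Delta>. real (c \<gamma>) *\<^sub>R v \<gamma>)"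
      unfolding c using weyl_linear[OF v] by (simp add: linear_sum linear_scale)
    have "pr (snd x) (v \<beta>) = (\<Sum>\<gamma>\<in>\<Delta>. int (c \<gamma>) * pr (snd x) (v \<gamma>))"
      unfolding vb by (simp add: pr_sum D D' pr_scale_nat)
    moreover have "fst x (v \<beta>) = (\<Sum>\<gamma>\<in>\<Delta>. real (c \<gamma>) *\<^sub>R fst x (v \<gamma>))"
      unfolding vb using weyl_linear[OF x] by (simp add: linear_sum linear_scale)
    ultimately have "\<phi> (v \<beta>) = (\<Sum>\<gamma>\<in>\<Delta>. real (c \<gamma>) * \<phi> (v \<gamma>))"
      unfolding \<phi>_def by (simp add: vb inner_sum_right sum_distrib_left sum.distrib[symmetric]
          sum_subtractf[symmetric] algebra_simps)
    then show ?thesis using base by (simp add: sum_nonneg)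
  qed
  have "pos (x \<star> c)" if c: "pos c" "inv v (fst c) \<notin> P" for c
  proof -
    have C: "fst c \<in> \<Phi>" "hgt c > 0" using c by (auto simp: pos_hgt)
    have xc: "fst (x \<star> c) \<in> \<Phi>" using x C by simp
    have "- inv v (fst c) \<in> P" using c C v neg_iff[of "inv v (fst c)"] by (simp add: weyl_inv)
    then have "\<phi> (v (- inv v (fst c))) \<ge> 0" by (rule dom)
    then have le0: "\<phi> (fst c) \<le> 0" using v C by (simp add: weyl_uminus neg)
    let ?n = "pr (snd x) (fst c)"
    have bd: "\<bar>two_rho_check \<bullet> fst c\<bar> < hscale" "\<bar>two_rho_check \<bullet> fst x (fst c)\<bar> < hscale"
      using x C by (simp_all add: two_rho_check_less_hscale)
    have c0: "snd c \<ge> 0" using c by (auto simp: aff_pos_def split: if_splits)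
    \<comment> \<open>The correction in \<open>\<phi>\<close> is below \<open>2 * hscale\<close> in
      absolute value, so a nonzero pairing decides the sign, and the perturbation matters only where
      the pairing is zero.\<close>
    have n0: "?n \<le> 0"
    proof (rule ccontr)
      assume "\<not> ?n \<le> 0"
      then have "2 * hscale * 1 \<le> 2 * hscale * real_of_int ?n"
        using hscale_pos by (intro mult_left_mono) auto
      then show False using le0 bd by (simp add: \<phi>_def)
    qed
    show ?thesis
    proof (cases "?n = 0")
      case True
      then have "hgt (x \<star> c) \<ge> hgt c" using le0 by (simp add: \<phi>_def hgt_def aff_act_def)
      then show ?thesis using C xc by (simp add: pos_hgt)
    next
      case False
      then have "snd (x \<star> c) \<ge> 1" using n0 c0 by (simp add: aff_act_def)
      then show ?thesis using hgt_pos_of_snd[OF xc] xc by (simp add: pos_hgt)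
    qed
  qed
  then show ?thesis using that v by blast
qed

text \<open>\<open>h\<close> is adjusted along the Bruhat chain: the sign of the finite part of
  \<open>b\<close>, where \<open>h \<star> b = a\<close>, decides whether a step extends the
  relation above \<open>y \<odot> h\<close> or the one below \<open>h\<close>.\<close>

lemma ble_imp_sle:
  assumes "x1 \<sqsubseteq> x2" and x1: "fst x1 \<in> W" and g: "fst g \<in> W"
  shows "\<exists>h. fst h \<in> W \<and> h \<preceq> g \<and> x1 \<odot> g \<preceq> x2 \<odot> h"
  using assms(1) unfolding bruhat_le_def
proof (induction rule: rtranclp_induct)
  case base
  then show ?case using g by blast
next
  case (step y z)
  then obtain h where h: "fst h \<in> W" "h \<preceq> g" "x1 \<odot> g \<preceq> y \<odot> h" by blast
  obtain a where y: "fst y \<in> W" and a: "pos a" "pos (y \<star> a)" "z = y \<odot> r a"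
    using step(2) unfolding bruhat_step_iff by blast
  have A: "fst a \<in> \<Phi>" using a pos_fst by blast
  then have rW: "fst (r a) \<in> W" by (simp add: refl_in_weyl)
  obtain b where b: "fst b \<in> \<Phi>" "h \<star> b = a" using aact_surj[OF h(1) A] by blast
  have conj: "r a \<odot> h = h \<odot> r b" using mult_r_conj[OF h(1) b(1)] b by simp
  show ?case
  proof (cases "fst b \<in> P")
    case True
    have "z \<odot> h = y \<odot> h \<odot> r b"
      using a mult_assoc[OF y rW h(1)] mult_assoc[OF y h(1), of "r b"] conj b
      by (simp add: refl_in_weyl)
    moreover have "(y \<odot> h) \<star> b = y \<star> a" using y h b by (simp add: aact_mult)
    ultimately have "sstep (y \<odot> h) (z \<odot> h)"
      unfolding sstep_def using y h True a by (intro conjI exI[of _ b]) (simp_all add: weyl_comp)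
    then show ?thesis using h by (meson rtranclp.rtrancl_into_rtrancl)
  next
    case False
    let ?h = "r a \<odot> h"
    have hW: "fst ?h \<in> W" using h rW by (simp add: weyl_comp)
    have "z \<odot> ?h = y \<odot> (r a \<odot> ?h)" using a mult_assoc[OF y rW hW] by simp
    also have "\<dots> = y \<odot> h" using h A by (simp add: r_r_mult)
    finally have "z \<odot> ?h = y \<odot> h" .
    moreover have "\<not> up a h"
      using False b h by (metis fst_aact weyl_inv_left)
    then have "sstep ?h h" using h a by (intro sstep_r_mult_down)
    ultimately show ?thesis using h hW by (metis converse_rtranclp_into_rtranclp)
  qed
qed

text \<open>One shift large enough for both relations makes them Bruhat relations; length positivity
  supplies the additivity asked for by \<open>ble_cancel_right\<close>.\<close>

lemma ble_of_sle:
  assumes x1: "fst x1 \<in> W" and x2: "fst x2 \<in> W" and v: "v \<in> W"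
    and lp: "\<And>c. pos c \<Longrightarrow> inv v (fst c) \<notin> P \<Longrightarrow> pos (x1 \<star> c)"
    and h: "fst h \<in> W" "h \<preceq> (v, 0)" "x1 \<odot> (v, 0) \<preceq> x2 \<odot> h"
  shows "x1 \<sqsubseteq> x2"
proof -
  obtain N M where "\<forall>n\<ge>N. shift n h \<sqsubseteq> shift n (v, 0)"
    "\<forall>n\<ge>M. shift n (x1 \<odot> (v, 0)) \<sqsubseteq> shift n (x2 \<odot> h)"
    using sle_shift_bruhat h by meson
  then obtain n where n: "shift n h \<sqsubseteq> shift n (v, 0)"
    "shift n (x1 \<odot> (v, 0)) \<sqsubseteq> shift n (x2 \<odot> h)" by (metis max.cobounded1 max.cobounded2)
  let ?y = "shift n (v, 0)"
  show ?thesis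
  proof (rule ble_cancel_right[of "shift n h" ?y])
    show "shift n h \<sqsubseteq> ?y" by (rule n)
    show "x1 \<odot> ?y \<sqsubseteq> x2 \<odot> shift n h" using n x1 x2 by (simp add: shift_mult)
    fix a assume a: "pos a" "\<not> pos (?y \<star> a)"
    have A: "fst a \<in> \<Phi>" using a pos_fst by blast
    have yW: "fst ?y \<in> W" and yA: "fst (?y \<star> a) \<in> \<Phi>" using v A by simp_all
    \<comment> \<open>The translation part of \<open>?y\<close> is dominant, so it cannot lower the
      level of a root with negative finite part.\<close>
    have aP: "fst a \<in> P"
    proof (rule ccontr)
      assume "fst a \<notin> P"
      then have "- fst a \<in> P" using A by (simp add: neg_iff)
      then have "cht (- fst a) \<ge> 1" "snd a \<ge> 1" using cht_pos a by (auto simp: aff_pos_def)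
      then have "cht (fst a) \<le> 0" "snd a \<ge> 1" using A by (simp_all add: pr_uminus_right Q_root)
      moreover from this have "int n * cht (fst a) \<le> 0" by (simp add: mult_nonneg_nonpos)
      ultimately have "snd (?y \<star> a) \<ge> 1"
        using pr_shift[of "fst a" n "(v, 0)"] A by (simp add: aff_act_def Q_root pr_zero)
      then show False using a hgt_pos_of_snd[OF yA] yA by (simp add: pos_hgt)
    qed
    \<comment> \<open>The negative of \<open>?y \<star> a\<close> is positive, and
      \<open>inv v\<close> takes its finite part back to \<open>- fst a\<close>, so length
      positivity applies to it.\<close>
    have "pos (aneg (?y \<star> a))" using a yA by (simp add: pos_aneg)
    moreover have "inv v (fst (aneg (?y \<star> a))) \<notin> P"
      using v A aP neg_iff[OF A] by (simp add: weyl_uminus[OF weyl_inv])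
    ultimately have "pos (x1 \<star> aneg (?y \<star> a))" by (rule lp)
    then show "\<not> pos (x1 \<star> ?y \<star> a)" using x1 yA by (simp add: aact_aneg pos_aneg)
  qed (use x1 x2 v h in simp_all)
qed

text \<open>The translation \<open>\<kappa>\<close> is eliminated:
  \<open>- \<iota> (qb_wt \<Phi> \<Delta> v2 v1)\<close> is the largest value allowed by the first
  relation and hence the best for the second.\<close>

lemma weight_inequality_iff:
  assumes "w1 \<in> W" "w2 \<in> W" "v1 \<in> W" "v2 \<in> W"
  shows "le (act (inv v1) \<mu>1 + \<iota> (qb_wt \<Phi> \<Delta> v2 v1) + \<iota> (qb_wt \<Phi> \<Delta> (w1 \<circ> v1) (w2 \<circ> v2)))
      (act (inv v2) \<mu>2) \<longleftrightarrow>
    (\<exists>\<kappa>. (v2, \<kappa>) \<preceq> (v1, 0) \<and> (w1, \<mu>1) \<odot> (v1, 0) \<preceq> (w2, \<mu>2) \<odot> (v2, \<kappa>))"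
    (is "le (?A + ?a + ?b) ?B \<longleftrightarrow> ?r")
proof -
  have m: "(w1, \<mu>1) \<odot> (v1, 0) = (w1 \<circ> v1, ?A)" "\<And>\<kappa>. (w2, \<mu>2) \<odot> (v2, \<kappa>) = (w2 \<circ> v2, ?B + \<kappa>)"
    by (simp_all add: aff_mult_def)
  have r: "?r \<longleftrightarrow> (\<exists>\<kappa>. le (\<kappa> + ?a) 0 \<and> le (?A + ?b) (?B + \<kappa>))"
    unfolding m using assms by (simp add: sle_iff_qb_wt weyl_comp)
  show ?thesis
  proof
    assume "le (?A + ?a + ?b) ?B"
    then have "le (?A + ?b) (?B + - ?a)" by (rule le_diff_cong[rotated]) simp
    moreover have "le (- ?a + ?a) 0" by simp
    ultimately show ?r unfolding r by blast
  next
    assume ?r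
    then obtain \<kappa> where l: "le (\<kappa> + ?a) 0" "le (?A + ?b) (?B + \<kappa>)" unfolding r by blast
    have "le (?A + ?a + ?b) (?B + \<kappa> + ?a)" by (rule le_diff_cong[OF _ l(2)]) simp
    moreover have "le (?B + \<kappa> + ?a) ?B" by (rule le_diff_cong[OF _ l(1)]) simp
    ultimately show "le (?A + ?a + ?b) ?B" by (rule le_trans)
  qed
qed

lemma bruhat_le_iff_weights:
  assumes w: "w1 \<in> W" "w2 \<in> W"
  shows "(w1, \<mu>1) \<sqsubseteq> (w2, \<mu>2) \<longleftrightarrow> (\<forall>v1\<in>W. \<exists>v2\<in>W.
    le (act (inv v1) \<mu>1 + \<iota> (qb_wt \<Phi> \<Delta> v2 v1) + \<iota> (qb_wt \<Phi> \<Delta> (w1 \<circ> v1) (w2 \<circ> v2)))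
      (act (inv v2) \<mu>2))"
proof
  assume b: "(w1, \<mu>1) \<sqsubseteq> (w2, \<mu>2)"
  show "\<forall>v1\<in>W. \<exists>v2\<in>W.
    le (act (inv v1) \<mu>1 + \<iota> (qb_wt \<Phi> \<Delta> v2 v1) + \<iota> (qb_wt \<Phi> \<Delta> (w1 \<circ> v1) (w2 \<circ> v2)))
      (act (inv v2) \<mu>2)"
  proof
    fix v1 assume v1: "v1 \<in> W"
    obtain v2 \<kappa> where v2: "v2 \<in> W" "(v2, \<kappa>) \<preceq> (v1, 0)"
      "(w1, \<mu>1) \<odot> (v1, 0) \<preceq> (w2, \<mu>2) \<odot> (v2, \<kappa>)"
      using ble_imp_sle[OF b, of "(v1, 0)"] w v1 by auto
    then show "\<exists>v2\<in>W.
      le (act (inv v1) \<mu>1 + \<iota> (qb_wt \<Phi> \<Delta> v2 v1) + \<iota> (qb_wt \<Phi> \<Delta> (w1 \<circ> v1) (w2 \<circ> v2)))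
        (act (inv v2) \<mu>2)"
      using weight_inequality_iff[OF w v1 v2(1)] by blast
  qed
next
  assume wts: "\<forall>v1\<in>W. \<exists>v2\<in>W.
    le (act (inv v1) \<mu>1 + \<iota> (qb_wt \<Phi> \<Delta> v2 v1) + \<iota> (qb_wt \<Phi> \<Delta> (w1 \<circ> v1) (w2 \<circ> v2)))
      (act (inv v2) \<mu>2)"
  obtain v1 where v1: "v1 \<in> W"
    and lp: "\<And>c. pos c \<Longrightarrow> inv v1 (fst c) \<notin> P \<Longrightarrow> pos ((w1, \<mu>1) \<star> c)"
    using ex_length_positive[of "(w1, \<mu>1)"] w by (metis fst_conv)
  then obtain v2 \<kappa> where "v2 \<in> W" "(v2, \<kappa>) \<preceq> (v1, 0)"
    "(w1, \<mu>1) \<odot> (v1, 0) \<preceq> (w2, \<mu>2) \<odot> (v2, \<kappa>)"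
    using wts weight_inequality_iff[OF w v1] by blast
  then show "(w1, \<mu>1) \<sqsubseteq> (w2, \<mu>2)"
    using w by (intro ble_of_sle[OF _ _ v1 lp, of _ "(v2, \<kappa>)"]) simp_all
qed

end

theorem theorem1p1:
  fixes \<Phi> \<Delta> :: "'v::euclidean_space set"
    and pr :: "'x::ab_group_add \<Rightarrow> 'v \<Rightarrow> int"
    and \<iota> :: "'v \<Rightarrow> 'x"
    and w1 w2 :: "'v \<Rightarrow> 'v" and \<mu>1 \<mu>2 :: 'x
  assumes "root_system \<Phi>" and "is_base \<Phi> \<Delta>" and "cochar_datum \<Phi> pr \<iota>"
    and "w1 \<in> weyl \<Phi>" and "w2 \<in> weyl \<Phi>"
  shows "bruhat_le \<Phi> \<Delta> pr \<iota> (w1, \<mu>1) (w2, \<mu>2) \<longleftrightarrow>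
    (\<forall>v1\<in>weyl \<Phi>. \<exists>v2\<in>weyl \<Phi>.
       coweight_le \<Phi> \<Delta> \<iota>
         (actX \<Phi> pr \<iota> (inv v1) \<mu>1 + \<iota> (qb_wt \<Phi> \<Delta> v2 v1) + \<iota> (qb_wt \<Phi> \<Delta> (w1 \<circ> v1) (w2 \<circ> v2)))
         (actX \<Phi> pr \<iota> (inv v2) \<mu>2))"
proof -
  interpret cochar_root_system \<Phi> \<Delta> pr \<iota>
    by unfold_locales (fact assms)+
  show ?thesis using assms by (intro bruhat_le_iff_weights)
qed

end
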